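(* Let $G$ be a cofinal graph, let $\sigma$ be the left shift on the space $\mathcal P(G)$ of infinite paths in $G$, and let $\phi : \mathcal P(G) \to \mathbb R$ be a function such that $\lim_{k \to \infty} \operatorname{var}_k(\phi) = 0$. 1) Assume that $NW_G = \emptyset$. Then there is a $\phi$-conformal measure for the left shift on $\mathcal P(G)$. 2) Assume that $NW_G$ is non-empty and finite, and that $\phi$ satisfies Bowen's condition on $NW_G$. Then there is a $\phi$-conformal measure for the left shift on $\mathcal P(G)$ if and only if $\mathbb P(-\phi) = 0$, and it is then unique up to multiplication by a scalar. 3) Assume that $NW_G$ is infinite. Then there is a $\phi$-conformal measure for the left shift on $\mathcal P(G)$ if and only if $\mathbb P(-\phi) \leq 0$.
   Context: $G$ is a directed graph with countable vertex set $V_G$ and countable edge set $E_G$; $r(e)$, $s(e)$ are the range and source of an edge. An infinite path is a sequence $p = (p_i)_{i=1}^\infty$ of edges with $r(p_i)=s(p_{i+1})$ for all $i$; finite paths $\mu = e_1\cdots e_n$ are defined similarly, with $s(\mu)=s(e_1)$, $r(\mu)=r(e_n)$. $\mathcal P(G)$ is the set of infinite paths with the topology having as base the cylinders $Z(\mu) = \{p : p_i=e_i,\ i=1,\dots,n\}$; the left shift $\sigma(p_1p_2p_3\cdots)=p_2p_3\cdots$ is a local homeomorphism of this locally compact second countable Hausdorff space. "$G$ is cofinal" means: every vertex emits only finitely many edges, every vertex emits at least one edge, and for every $v \in V_G$ and $p \in \mathcal P(G)$ there are a finite path $\mu$ and $i \in \mathbb N$ with $s(\mu)=v$ and $r(\mu)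 = s(p_i)$. The set $NW_G$ of non-wandering vertices consists of the vertices $v$ for which there is a finite path $\mu$ with $s(\mu)=r(\mu)=v$. $NW_G$ also denotes the subgraph consisting of these vertices and the edges they emit. $\operatorname{var}_k(\phi) = \sup\{|\phi(x)-\phi(y)| : x_i = y_i,\ i = 1,\dots,k\}$. $\phi$ satisfies Bowen's condition on $NW_G$ when there is $C>0$ such that $\left|\sum_{i=0}^{n-1}[\phi(\sigma^i(x)) - \phi(\sigma^i(y))]\right| \leq C$ for all $n \geq 1$ and all $x,y \in \mathcal P(NW_G)$ whose first $n$ edges agree. A $\phi$-conformal measure is a regular non-zero Borel measure $m$ (finite on compact sets) on $\mathcal P(G)$ with $m(\sigma(A)) = \int_A e^{\phi}\, dm$ for every Borel set $A$ on which $\sigma$ is injective. For continuous $\psi : \mathcal P(G) \to \mathbb R$ put $L_\psi(f)(x) = \sum_{y \in \sigma^{-1}(x)} e^{\psi(y)} f(y)$ for $f \in C_c(\mathcal P(G))$ (continuous compactly supported functions). The pressure is $\mathbb P(\psi) = \sup_{x} \mathbb P_x(\psi)$, where $\mathbb P_x(\psi) = \log\left(\limsup_n (L_\psi^n(f)(x))^{1/n}\right) \in [-\infty,\infty]$ (with $\log 0 = -\infty$, $\log \infty=\infty$) for any non-negative non-zero $f \in C_c(\mathcal P(G))$; this is independent of the choice of $f$. *)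

theory Defs
  imports "HOL-Analysis.Analysis" "Graph_Theory.Arc_Walk"
begin

text \<open>
  A directed graph is a \<open>pre_digraph\<close> satisfying \<^locale>\<open>wf_digraph\<close>. Neither finiteness nor the
  absence of loops and parallel edges is required; the source of an edge \<open>e\<close> is \<open>tail G e\<close> and
  its range is \<open>head G e\<close>. An infinite path is a function on \<open>nat\<close>, so that the edge
  \<open>p\<^sub>1\<close> of the usual notation is \<open>p 0\<close>.
\<close>

definition infinite_paths :: "('a, 'b) pre_digraph \<Rightarrow> (nat \<Rightarrow> 'b) set" where
  "infinite_paths G = {p. \<forall>i. p i \<in> arcs G \<and> head G (p i) = tail G (p (Suc i))}"

text \<open>Finite paths have at least one edge, whereas \<open>awalk\<close> also allows the empty walk.\<close>

definition finite_path :: "('a, 'b) pre_digraph \<Rightarrow> 'a \<Rightarrow> 'b list \<Rightarrow> 'a \<Rightarrow> bool" where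
  "finite_path G v \<mu> w \<longleftrightarrow> pre_digraph.awalk G v \<mu> w \<and> \<mu> \<noteq> []"

definition cylinder :: "('a, 'b) pre_digraph \<Rightarrow> 'b list \<Rightarrow> (nat \<Rightarrow> 'b) set" where
  "cylinder G \<mu> = {p \<in> infinite_paths G. \<forall>i < length \<mu>. p i = \<mu> ! i}"

definition is_cylinder :: "('a, 'b) pre_digraph \<Rightarrow> (nat \<Rightarrow> 'b) set \<Rightarrow> bool" where
  "is_cylinder G U \<longleftrightarrow> (\<exists>v \<mu> w. finite_path G v \<mu> w \<and> U = cylinder G \<mu>)"

definition path_topology :: "('a, 'b) pre_digraph \<Rightarrow> (nat \<Rightarrow> 'b) topology" where
  "path_topology G = topology (arbitrary union_of (is_cylinder G))"

lemma openin_path_topology: "openin (path_topology G) = arbitrary union_of (is_cylinder G)"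
proof -
  have "(arbitrary union_of (is_cylinder G)) (S \<inter> T)"
    if S: "is_cylinder G S" and T: "is_cylinder G T" for S T
  proof (cases "S \<inter> T = {}")
    case True
    then show ?thesis by (metis arbitrary_union_of_empty)
  next
    case False
    then obtain p where p: "p \<in> S" "p \<in> T" by auto
    from S T obtain \<mu> \<nu> where eq: "S = cylinder G \<mu>" "T = cylinder G \<nu>"
      unfolding is_cylinder_def by blast
    have "cylinder G \<mu> \<subseteq> cylinder G \<nu>" if "length \<nu> \<le> length \<mu>"
      using p that unfolding eq cylinder_def by auto
    moreover have "cylinder G \<nu> \<subseteq> cylinder G \<mu>" if "length \<mu> \<le> length \<nu>"
      using p that unfolding eq cylinder_def by auto
    ultimately have "S \<inter> T = S \<or> S \<inter> T = T"
      unfolding eq by (meson Int_absorb1 Int_absorb2 nat_le_linear)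
    with S T show ?thesis by (metis arbitrary_union_of_inc)
  qed
  then show ?thesis
    unfolding path_topology_def by (metis istopology_base_eq topology_inverse')
qed

lemma topspace_path_topology:
  assumes "wf_digraph G"
  shows "topspace (path_topology G) = infinite_paths G"
proof
  show "topspace (path_topology G) \<subseteq> infinite_paths G"
    unfolding topspace_def openin_path_topology union_of_def is_cylinder_def cylinder_def
    by blast
next
  interpret wf_digraph G by fact
  show "infinite_paths G \<subseteq> topspace (path_topology G)"
  proof
    fix p assume p: "p \<in> infinite_paths G"
    then have "finite_path G (tail G (p 0)) [p 0] (head G (p 0))"
      by (auto simp: finite_path_def awalk_def infinite_paths_def)
    then have "is_cylinder G (cylinder G [p 0])"
      unfolding is_cylinder_def by blast
    then have "openin (path_topology G) (cylinder G [p 0])"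
      unfolding openin_path_topology by (rule arbitrary_union_of_inc)
    moreover have "p \<in> cylinder G [p 0]"
      using p by (simp add: cylinder_def)
    ultimately show "p \<in> topspace (path_topology G)"
      using openin_subset by blast
  qed
qed

definition path_shift :: "(nat \<Rightarrow> 'b) \<Rightarrow> nat \<Rightarrow> 'b" where
  "path_shift p = (\<lambda>i. p (Suc i))"

definition cofinal_graph :: "('a, 'b) pre_digraph \<Rightarrow> bool" where
  "cofinal_graph G \<longleftrightarrow>
     (\<forall>v \<in> verts G. finite (out_arcs G v)) \<and>
     (\<forall>v \<in> verts G. out_arcs G v \<noteq> {}) \<and>
     (\<forall>v \<in> verts G. \<forall>p \<in> infinite_paths G. \<exists>\<mu> i. finite_path G v \<mu> (tail G (p i)))"

definition NW :: "('a, 'b) pre_digraph \<Rightarrow> 'a set" where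
  "NW G = {v \<in> verts G. \<exists>\<mu>. finite_path G v \<mu> v}"

definition NW_graph :: "('a, 'b) pre_digraph \<Rightarrow> ('a, 'b) pre_digraph" where
  "NW_graph G =
     \<lparr>verts = NW G, arcs = {e \<in> arcs G. tail G e \<in> NW G}, tail = tail G, head = head G\<rparr>"

definition var :: "('a, 'b) pre_digraph \<Rightarrow> ((nat \<Rightarrow> 'b) \<Rightarrow> real) \<Rightarrow> nat \<Rightarrow> ereal" where
  "var G \<phi> k = Sup {ereal \<bar>\<phi> x - \<phi> y\<bar> | x y.
     x \<in> infinite_paths G \<and> y \<in> infinite_paths G \<and> (\<forall>i < k. x i = y i)}"

definition bowen_condition :: "('a, 'b) pre_digraph \<Rightarrow> ((nat \<Rightarrow> 'b) \<Rightarrow> real) \<Rightarrow> bool" where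
  "bowen_condition G \<phi> \<longleftrightarrow>
     (\<exists>C > 0. \<forall>n \<ge> 1. \<forall>x \<in> infinite_paths G. \<forall>y \<in> infinite_paths G.
        (\<forall>i < n. x i = y i) \<longrightarrow>
        \<bar>\<Sum>i<n. \<phi> ((path_shift ^^ i) x) - \<phi> ((path_shift ^^ i) y)\<bar> \<le> C)"

definition regular_borel_measure :: "'x topology \<Rightarrow> 'x measure \<Rightarrow> bool" where
  "regular_borel_measure T m \<longleftrightarrow>
     sets m = sets (sigma (topspace T) {U. openin T U}) \<and>
     (\<forall>K. compactin T K \<longrightarrow> emeasure m K < \<infinity>) \<and>
     (\<forall>A \<in> sets m. emeasure m A = (INF U \<in> {U. openin T U \<and> A \<subseteq> U}. emeasure m U)) \<and>
     (\<forall>U. openin T U \<longrightarrow> emeasure m U = (SUP K \<in> {K. compactin T K \<and> K \<subseteq> U}. emeasure m K))"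

definition conformal_measure ::
  "('a, 'b) pre_digraph \<Rightarrow> ((nat \<Rightarrow> 'b) \<Rightarrow> real) \<Rightarrow> (nat \<Rightarrow> 'b) measure \<Rightarrow> bool" where
  "conformal_measure G \<phi> m \<longleftrightarrow>
     regular_borel_measure (path_topology G) m \<and>
     emeasure m (space m) \<noteq> 0 \<and>
     (\<forall>A \<in> sets m. inj_on path_shift A \<longrightarrow>
        emeasure m (path_shift ` A) = (\<integral>\<^sup>+ x \<in> A. ennreal (exp (\<phi> x)) \<partial>m))"

text \<open>
  Values of such functions outside \<open>topspace T\<close> are unconstrained; they are never used below.
\<close>

definition Cc :: "'x topology \<Rightarrow> ('x \<Rightarrow> real) set" where
  "Cc T = {f. continuous_map T euclideanreal f \<and>
              compactin T (T closure_of {x \<in> topspace T. f x \<noteq> 0})}"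

text \<open>
  A vertex may receive infinitely many edges, so the fibre of the shift over \<open>x\<close> may be infinite.
  For \<open>f\<close> in \<^const>\<open>Cc\<close> only finitely many terms of the sum are non-zero.
\<close>

definition transfer_operator ::
  "('a, 'b) pre_digraph \<Rightarrow> ((nat \<Rightarrow> 'b) \<Rightarrow> real) \<Rightarrow>
     ((nat \<Rightarrow> 'b) \<Rightarrow> real) \<Rightarrow> (nat \<Rightarrow> 'b) \<Rightarrow> real" where
  "transfer_operator G \<psi> f x =
     (\<Sum>\<^sub>\<infinity>y \<in> {y \<in> infinite_paths G. path_shift y = x}. exp (\<psi> y) * f y)"

definition ln_ereal :: "ereal \<Rightarrow> ereal" where
  "ln_ereal t = (if t = \<infinity> then \<infinity> else if t \<le> 0 then - \<infinity> else ereal (ln (real_of_ereal t)))"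

definition is_test_function :: "('a, 'b) pre_digraph \<Rightarrow> ((nat \<Rightarrow> 'b) \<Rightarrow> real) \<Rightarrow> bool" where
  "is_test_function G f \<longleftrightarrow>
     f \<in> Cc (path_topology G) \<and>
     (\<forall>x \<in> infinite_paths G. 0 \<le> f x) \<and> (\<exists>x \<in> infinite_paths G. f x \<noteq> 0)"

text \<open>
  For cofinal \<open>G\<close> and \<open>\<psi>\<close> with \<open>var G \<psi> k\<close> tending to 0 the value does not depend on the
  non-negative non-zero \<open>f\<close> in \<^const>\<open>Cc\<close>, so that an arbitrary one may be chosen.
\<close>

definition pressure_at ::
  "('a, 'b) pre_digraph \<Rightarrow> ((nat \<Rightarrow> 'b) \<Rightarrow> real) \<Rightarrow> (nat \<Rightarrow> 'b) \<Rightarrow> ereal" where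
  "pressure_at G \<psi> x =
     (let f = (SOME f. is_test_function G f)
      in ln_ereal (limsup (\<lambda>n. ereal (root n ((transfer_operator G \<psi> ^^ n) f x)))))"

definition pressure :: "('a, 'b) pre_digraph \<Rightarrow> ((nat \<Rightarrow> 'b) \<Rightarrow> real) \<Rightarrow> ereal" where
  "pressure G \<psi> = (SUP x \<in> infinite_paths G. pressure_at G \<psi> x)"

end

theory Submission
  imports Defs "HOL-Complex_Analysis.Great_Picard"
begin

text \<open>
  A conformal measure is determined by its values on the compact open sets, and being conformal
  amounts to finite additivity together with the bounds
  $e^{\inf_A \phi}\, h(A) \leq h(\sigma A) \leq e^{\sup_A \phi}\, h(A)$ for compact open $A$ on which
  $\sigma$ is injective: since $\mathrm{var}_k(\phi) \to 0$, subdividing $A$ makes these bounds sharp.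
  Conversely, every such set function $h$, called a weight below, extends to a conformal measure.

  Weights arise as limits of the normalised measures $\sum_n q_k^n (L_{-\phi}^n)^* \delta_{x_k}$
  with $q_k \to 1$. The points $x_k$ escape along a path if there are no non-wandering vertices, and
  through distinct non-wandering vertices if there are infinitely many of them; in the finite case
  $x_k$ is constant and Bowen's condition forces the normalising factor to diverge when the pressure
  is 0. Cofinality is used in the form that hereditary saturated sets of vertices are trivial.

  Conversely, integrating $L_{-\phi}^n 1$ bounds the pressure of any $\phi$ admitting a conformal
  measure. Under Bowen's condition any two weights $h, h'$ have bounded ratio, and with the largest $t$
  such that $t h' \leq h$ the weight $h - t h'$ must vanish.
\<close>

text \<open>Weights are given by inequalities on a countable ring because these pass to pointwise
  limits: a diagonal subsequence of bounded real sequences suffices, although \<open>X\<close> need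
  not be compact and a vertex may receive infinitely many edges. The price is that such inequalities
  neither compose nor subtract sharply; on pieces where \<phi> oscillates by at most \<eta> the loss
  is of order exp(2\<eta>) - 1, and refinement removes it.

  Normalising at a single vertex is enough, since one induction carries boundedness, summability or
  vanishing from a vertex to the ranges of its edges, and back to a vertex from the ranges of all
  its edges.

  Bowen's condition on \<open>NW G\<close> alone is enough because that set is hereditary: paths
  starting in it stay in it, and estimates are pulled back to the other vertices edge by edge. If
  \<open>NW G\<close> is finite, the union of its sets \<open>Z v\<close> is compact and mapped into
  itself by the shift, so that uniform smallness of a single \<open>W N\<close> there forces
  exponential decay and negative pressure. Hence at pressure 0 some series diverges, which is what a
  constant base point requires.\<close>

lemma shift_funpow: "(path_shift ^^ n) x = (\<lambda>i. x (i + n))"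
  by (induction n arbitrary: x) (auto simp: path_shift_def)

lemma path_shift_case_nat [simp]: "path_shift (case_nat e x) = x"
  by (simp add: path_shift_def)

lemma case_nat_path_shift: "case_nat (x 0) (path_shift x) = x"
  by (auto simp: path_shift_def fun_eq_iff split: nat.split)

definition birkhoff :: "((nat \<Rightarrow> 'b) \<Rightarrow> real) \<Rightarrow> nat \<Rightarrow> (nat \<Rightarrow> 'b) \<Rightarrow> real" where
  "birkhoff \<phi> n x = (\<Sum>i<n. \<phi> ((path_shift ^^ i) x))"

lemma birkhoff_0 [simp]: "birkhoff \<phi> 0 x = 0"
  by (simp add: birkhoff_def)

lemma birkhoff_Suc: "birkhoff \<phi> (Suc n) x = \<phi> x + birkhoff \<phi> n (path_shift x)"
  unfolding birkhoff_def
  by (subst sum.lessThan_Suc_shift) (simp add: funpow_swap1)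

lemma birkhoff_add:
  "birkhoff \<phi> (m + n) x = birkhoff \<phi> m x + birkhoff \<phi> n ((path_shift ^^ m) x)"
  by (induction m arbitrary: x) (auto simp: birkhoff_Suc funpow_swap1)

text \<open>With s = exp \<eta>, these are the losses that occur when two-sided bounds are
  subtracted in \<open>weight_diff\<close>; all of them are absorbed into exp(2\<eta>) - 1, the form
  of error that \<open>refine_le\<close> admits.\<close>

lemma exp_refine_bounds:
  fixes s :: real assumes "1 \<le> s"
  shows "s - 1 \<le> s * s - 1" "s - 1/s \<le> s * s - 1" "1 - 1/s \<le> s * s - 1"
proof -
  have "s * s - s = s * (s - 1)" by (simp add: algebra_simps)
  then have *: "s \<le> s * s" using assms by (smt (verit) mult_nonneg_nonneg)
  then show "s - 1 \<le> s * s - 1" by simp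
  define r where "r = 1/s"
  have r: "r \<le> 1" "s * r = 1" using assms by (auto simp: r_def)
  have "0 \<le> (s - r) * (s - 1)" using r(1) assms by (intro mult_nonneg_nonneg) linarith+
  then show "s - 1/s \<le> s * s - 1" unfolding r_def[symmetric] using r by (simp add: algebra_simps)
  have "0 \<le> (s - 1) * (1 - r)" using r(1) assms by (intro mult_nonneg_nonneg) auto
  then have "1 - r \<le> s - 1" using r(2) by (simp add: algebra_simps)
  then show "1 - 1/s \<le> s * s - 1" unfolding r_def[symmetric] using * by simp
qed

lemma birkhoff_Suc_right: "birkhoff \<phi> (Suc n) x = birkhoff \<phi> n x + \<phi> ((path_shift ^^ n) x)"
  by (simp add: birkhoff_def)

lemma ln_ereal_less_imp:
  assumes "ln_ereal t < ereal (ln r)" "r > 0" shows "t < ereal r"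
proof (cases t)
  case (real s)
  then show ?thesis using assms by (cases "s \<le> 0") (auto simp: ln_ereal_def)
qed (use assms in \<open>auto simp: ln_ereal_def\<close>)

lemma ln_ereal_le:
  assumes "t \<le> ereal r" "r > 0" shows "ln_ereal t \<le> ereal (ln r)"
proof (cases t)
  case (real s)
  then show ?thesis using assms by (cases "s \<le> 0") (auto simp: ln_ereal_def)
qed (use assms in \<open>auto simp: ln_ereal_def\<close>)

text \<open>Abel's argument: some partial sum of \<open>a\<close> exceeds \<open>M\<close>, a
  partial sum depends continuously on \<open>q\<close>, and the remaining terms are
  non-negative.\<close>

lemma suminf_damped_tendsto_at_top:
  fixes a :: "nat \<Rightarrow> real"
  assumes a: "\<And>n. 0 \<le> a n" "\<not> summable a"
    and q: "\<And>k. 0 \<le> q k" "q \<longlonglongrightarrow> 1" and s: "\<And>k. summable (\<lambda>n. q k ^ n * a n)"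
  shows "filterlim (\<lambda>k. \<Sum>n. q k ^ n * a n) at_top sequentially"
  unfolding filterlim_at_top
proof
  fix M :: real
  have "\<exists>N. M < (\<Sum>n<N. a n)"
  proof (rule ccontr)
    assume "\<nexists>N. M < (\<Sum>n<N. a n)"
    then have "\<And>N. (\<Sum>n<N. a n) \<le> M" by (simp add: not_less)
    then have "summable a" using a(1) by (intro summableI_nonneg_bounded) auto
    then show False using a(2) by simp
  qed
  then obtain N where N: "M < (\<Sum>n<N. a n)" by blast
  have "(\<lambda>k. \<Sum>n<N. q k ^ n * a n) \<longlonglongrightarrow> (\<Sum>n<N. 1 ^ n * a n)"
    by (intro tendsto_intros q)
  then have "eventually (\<lambda>k. M < (\<Sum>n<N. q k ^ n * a n)) sequentially"
    using N by (intro order_tendstoD) auto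
  then show "eventually (\<lambda>k. M \<le> (\<Sum>n. q k ^ n * a n)) sequentially"
  proof eventually_elim
    case (elim k)
    have "(\<Sum>n<N. q k ^ n * a n) \<le> (\<Sum>n. q k ^ n * a n)"
      using a(1) q(1) by (intro sum_le_suminf s) auto
    then show ?case using elim by simp
  qed
qed

text \<open>\<open>verts_nonempty\<close> excludes the empty graph, which satisfies
  \<open>cofinal_graph\<close> and has \<open>NW G\<close> empty, but whose path space carries no
  non-zero measure.\<close>

locale cofinal_system = wf_digraph G for G :: "('a, 'b) pre_digraph" +
  fixes \<phi> :: "(nat \<Rightarrow> 'b) \<Rightarrow> real"
  assumes verts_nonempty: "verts G \<noteq> {}"
    and countable_verts: "countable (verts G)"
    and countable_arcs: "countable (arcs G)"
    and cofinal: "cofinal_graph G"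
    and var_tendsto_0: "var G \<phi> \<longlonglongrightarrow> 0"
begin

abbreviation X :: "(nat \<Rightarrow> 'b) set" where "X \<equiv> infinite_paths G"

abbreviation \<sigma> :: "(nat \<Rightarrow> 'b) \<Rightarrow> nat \<Rightarrow> 'b" where "\<sigma> \<equiv> path_shift"

definition Z :: "'a \<Rightarrow> (nat \<Rightarrow> 'b) set" where
  "Z v = {x \<in> X. tail G (x 0) = v}"

text \<open>Cylinders indexed by a path instead of a word. \<open>cyl 0 x\<close> is all of
  \<open>X\<close>, which is not compact if there are infinitely many vertices; this is the reason
  for the conditions \<open>n > 0\<close> below.\<close>

definition cyl :: "nat \<Rightarrow> (nat \<Rightarrow> 'b) \<Rightarrow> (nat \<Rightarrow> 'b) set" where
  "cyl n x = {y \<in> X. \<forall>i<n. y i = x i}"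

lemma finite_out: "v \<in> verts G \<Longrightarrow> finite (out_arcs G v)"
  and out_nonempty: "v \<in> verts G \<Longrightarrow> out_arcs G v \<noteq> {}"
  and cofinalD: "v \<in> verts G \<Longrightarrow> p \<in> X \<Longrightarrow> \<exists>\<mu> i. finite_path G v \<mu> (tail G (p i))"
  using cofinal unfolding cofinal_graph_def by blast+

lemma X_arcs: "x \<in> X \<Longrightarrow> x i \<in> arcs G"
  and X_head: "x \<in> X \<Longrightarrow> head G (x i) = tail G (x (Suc i))"
  by (auto simp: infinite_paths_def)

lemma X_tail_verts: "x \<in> X \<Longrightarrow> tail G (x i) \<in> verts G"
  using X_arcs by simp

lemma shift_X: "x \<in> X \<Longrightarrow> \<sigma> x \<in> X"
  by (auto simp: infinite_paths_def path_shift_def)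

lemma shift_funpow_X: "x \<in> X \<Longrightarrow> (\<sigma> ^^ n) x \<in> X"
  by (induction n) (auto intro: shift_X)

lemma case_nat_X: "e \<in> arcs G \<Longrightarrow> x \<in> X \<Longrightarrow> tail G (x 0) = head G e \<Longrightarrow> case_nat e x \<in> X"
  by (auto simp: infinite_paths_def split: nat.split)

text \<open>The last hypothesis says that \<open>S\<close> is saturated. A vertex outside such a set
  emits an edge that again leads outside it, and choosing such edges recursively gives the
  path.\<close>

lemma avoiding_path:
  assumes "v \<in> verts G" "v \<notin> S"
    and "\<And>v. v \<in> verts G \<Longrightarrow> (\<And>e. e \<in> out_arcs G v \<Longrightarrow> head G e \<in> S) \<Longrightarrow> v \<in> S"
  obtains p where "p \<in> X" "tail G (p 0) = v" "\<And>i. tail G (p i) \<notin> S"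
proof -
  have step: "\<exists>e\<in>out_arcs G u. head G e \<notin> S" if "u \<in> verts G" "u \<notin> S" for u
    using assms(3) that by blast
  obtain e0 where e0: "e0 \<in> out_arcs G v" "head G e0 \<notin> S"
    using step assms by blast
  define f where "f = rec_nat e0 (\<lambda>_ e. SOME e'. e' \<in> out_arcs G (head G e) \<and> head G e' \<notin> S)"
  have f0: "f 0 = e0" and fSuc: "f (Suc n) = (SOME e'. e' \<in> out_arcs G (head G (f n)) \<and> head G e' \<notin> S)" for n
    by (simp_all add: f_def)
  have nxt: "f (Suc n) \<in> out_arcs G (head G (f n)) \<and> head G (f (Suc n)) \<notin> S"
    if "f n \<in> arcs G" "head G (f n) \<notin> S" for n
    unfolding fSuc by (rule someI_ex) (use step[of "head G (f n)"] that in auto)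
  have f: "f n \<in> arcs G \<and> head G (f n) \<notin> S" for n
    by (induction n) (use nxt e0 f0 in auto)
  have consec: "head G (f n) = tail G (f (Suc n))" for n
    using nxt[of n] f[of n] by auto
  have tails: "tail G (f n) \<notin> S" for n
  proof (cases n)
    case 0 then show ?thesis using e0 f0 assms(2) by simp
  next
    case (Suc m) then show ?thesis using f[of m] consec[of m] by metis
  qed
  show thesis
    proof (rule that)
    show "f \<in> X" using f consec by (simp add: infinite_paths_def)
    show "tail G (f 0) = v" using e0 f0 by simp
  qed (rule tails)
qed

lemma Z_nonempty: "v \<in> verts G \<Longrightarrow> Z v \<noteq> {}"
proof -
  assume v: "v \<in> verts G"
  show ?thesis
  proof (rule avoiding_path[OF v, of "{}"])
    show "v \<notin> {}" by simp
    show "u \<in> {}" if "u \<in> verts G" "\<And>e. e \<in> out_arcs G u \<Longrightarrow> head G e \<in> {}" for u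
      using that(2) out_nonempty[OF that(1)] by blast
  qed (auto simp: Z_def)
qed

lemma closed_finite_path:
  assumes "finite_path G v \<mu> w" "v \<in> T" "\<And>e. e \<in> arcs G \<Longrightarrow> tail G e \<in> T \<Longrightarrow> head G e \<in> T"
  shows "w \<in> T"
proof -
  have "awalk v \<mu> w" using assms(1) by (simp add: finite_path_def)
  then show ?thesis using assms(2)
    by (induction \<mu> arbitrary: v) (auto simp: awalk_simps intro: assms(3))
qed

text \<open>If a vertex missed the saturated set \<open>S\<close>, some infinite path would avoid
  \<open>S\<close> altogether. Cofinality connects \<open>v0\<close> to that path, but whatever is
  reached from \<open>v0\<close> lies in \<open>T\<close>, hence in \<open>S\<close>. With two sets,
  heredity is asked of \<open>T\<close> only; \<open>T\<close> is \<open>NW G\<close> where the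
  property itself is only known to pass backwards along edges.\<close>

lemma cofinal_induct:
  assumes "v0 \<in> verts G" "v0 \<in> T" "T \<subseteq> S"
    and hereditary: "\<And>e. e \<in> arcs G \<Longrightarrow> tail G e \<in> T \<Longrightarrow> head G e \<in> T"
    and saturated: "\<And>v. v \<in> verts G \<Longrightarrow> (\<And>e. e \<in> out_arcs G v \<Longrightarrow> head G e \<in> S) \<Longrightarrow> v \<in> S"
  shows "verts G \<subseteq> S"
proof (rule ccontr)
  assume "\<not> verts G \<subseteq> S"
  then obtain w where "w \<in> verts G" "w \<notin> S" by blast
  then obtain p where p: "p \<in> X" "\<And>i. tail G (p i) \<notin> S"
    using avoiding_path[of w S] saturated by metis
  then show False
    using cofinalD[OF assms(1) p(1)] closed_finite_path[OF _ assms(2) hereditary] assms(3) by blast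
qed

lemma finite_path_preimage:
  assumes "finite_path G v \<mu> (tail G (x 0))" "x \<in> X"
  obtains n y where "n > 0" "y \<in> Z v" "(\<sigma> ^^ n) y = x"
proof -
  have "awalk v \<mu> (tail G (x 0))" "\<mu> \<noteq> []" using assms(1) by (auto simp: finite_path_def)
  then have "\<exists>y\<in>Z v. (\<sigma> ^^ length \<mu>) y = x"
  proof (induction \<mu> arbitrary: v)
    case Nil then show ?case by simp
  next
    case (Cons e \<mu>)
    then have e: "e \<in> arcs G" "tail G e = v" and w: "awalk (head G e) \<mu> (tail G (x 0))"
      by (auto simp: awalk_Cons_iff)
    obtain z where z: "z \<in> Z (head G e)" "(\<sigma> ^^ length \<mu>) z = x"
    proof (cases "\<mu> = []")
      case True
      then show ?thesis using that[of x] w assms(2) by (auto simp: awalk_Nil_iff Z_def)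
    next
      case False
      then show ?thesis using that Cons.IH[OF w False] by blast
    qed
    show ?case
      by (rule bexI[of _ "case_nat e z"])
        (use z e in \<open>auto simp: Z_def funpow_swap1 intro: case_nat_X\<close>)
  qed
  then show thesis using that[of "length \<mu>"] \<open>\<mu> \<noteq> []\<close> by blast
qed

lemma path_prefix_finite_path:
  assumes "x \<in> X" "n > 0"
  shows "finite_path G (tail G (x 0)) (map x [0..<n]) (tail G (x n))"
proof -
  have "awalk (tail G (x 0)) (map x [0..<n]) (tail G (x n))"
  proof (induction n)
    case 0 then show ?case using assms by (simp add: awalk_Nil_iff X_tail_verts)
  next
    case (Suc n)
    have "awalk (tail G (x n)) [x n] (tail G (x (Suc n)))"
      using assms by (simp add: awalk_simps X_arcs X_head)
    then show ?case using awalk_appendI[OF Suc] by simp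
  qed
  then show ?thesis using assms(2) by (simp add: finite_path_def)
qed

text \<open>Uniform continuity of \<phi> in terms of edges, the form in which the decay of
  \<open>var\<close> enters all estimates.\<close>

lemma osc:
  assumes "\<epsilon> > 0"
  shows "\<exists>N. \<forall>x\<in>X. \<forall>y\<in>X. (\<forall>i<N. x i = y i) \<longrightarrow> \<bar>\<phi> x - \<phi> y\<bar> \<le> \<epsilon>"
proof -
  have "eventually (\<lambda>k. var G \<phi> k < ereal \<epsilon>) sequentially"
    using order_tendstoD(2)[OF var_tendsto_0] assms by simp
  then obtain N where N: "var G \<phi> N < ereal \<epsilon>" by (auto simp: eventually_sequentially)
  show ?thesis
  proof (intro exI[of _ N] ballI impI)
    fix x y assume "x \<in> X" "y \<in> X" "\<forall>i<N. x i = y i"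
    then have "ereal \<bar>\<phi> x - \<phi> y\<bar> \<le> var G \<phi> N"
      unfolding var_def by (intro Sup_upper) auto
    then show "\<bar>\<phi> x - \<phi> y\<bar> \<le> \<epsilon>" using N by (metis ereal_less_eq(3) le_less_trans less_imp_le)
  qed
qed

subsection \<open>The ring of compact open sets\<close>

text \<open>
  A set of paths is compact and open if and only if its paths start in finitely many vertices and
  membership is decided by finitely many edges.
\<close>

definition K :: "(nat \<Rightarrow> 'b) set set" where
  "K = {A. A \<subseteq> X \<and> finite ((\<lambda>x. tail G (x 0)) ` A) \<and>
           (\<exists>N. \<forall>x\<in>A. \<forall>y\<in>X. (\<forall>i<N. x i = y i) \<longrightarrow> y \<in> A)}"

lemma K_subset: "A \<in> K \<Longrightarrow> A \<subseteq> X"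
  by (simp add: K_def)

lemma K_empty [simp]: "{} \<in> K"
  by (auto simp: K_def)

lemma KI:
  assumes "A \<subseteq> X" "finite F" "\<And>x. x \<in> A \<Longrightarrow> tail G (x 0) \<in> F"
    and "\<And>x y. x \<in> A \<Longrightarrow> y \<in> X \<Longrightarrow> (\<And>i. i < N \<Longrightarrow> x i = y i) \<Longrightarrow> y \<in> A"
  shows "A \<in> K"
  using assms unfolding K_def by (auto intro!: exI[of _ N] intro: finite_subset[of _ F])

lemma KE:
  assumes "A \<in> K"
  obtains N where "\<And>x y. x \<in> A \<Longrightarrow> y \<in> X \<Longrightarrow> (\<And>i. i < N \<Longrightarrow> x i = y i) \<Longrightarrow> y \<in> A"
  using assms unfolding K_def by blast

lemma K_finite: "A \<in> K \<Longrightarrow> finite ((\<lambda>x. tail G (x 0)) ` A)"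
  by (simp add: K_def)

lemma K_Un [intro]:
  assumes A: "A \<in> K" and B: "B \<in> K" shows "A \<union> B \<in> K"
proof -
  obtain M where M: "\<And>x y. x \<in> A \<Longrightarrow> y \<in> X \<Longrightarrow> (\<And>i. i < M \<Longrightarrow> x i = y i) \<Longrightarrow> y \<in> A"
    using KE[OF A] by blast
  obtain N where N: "\<And>x y. x \<in> B \<Longrightarrow> y \<in> X \<Longrightarrow> (\<And>i. i < N \<Longrightarrow> x i = y i) \<Longrightarrow> y \<in> B"
    using KE[OF B] by blast
  show ?thesis
  proof (rule KI[where N = "max M N"])
    show "finite ((\<lambda>x. tail G (x 0)) ` A \<union> (\<lambda>x. tail G (x 0)) ` B)"
      using A B by (simp add: K_finite)
    show "y \<in> A \<union> B" if "x \<in> A \<union> B" "y \<in> X" "\<And>i. i < max M N \<Longrightarrow> x i = y i" for x y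
      using that M[of x y] N[of x y] by auto
  qed (use A B K_subset in auto)
qed

lemma K_Diff [intro]:
  assumes A: "A \<in> K" and B: "B \<in> K" shows "A - B \<in> K"
proof -
  obtain M where M: "\<And>x y. x \<in> A \<Longrightarrow> y \<in> X \<Longrightarrow> (\<And>i. i < M \<Longrightarrow> x i = y i) \<Longrightarrow> y \<in> A"
    using KE[OF A] by blast
  obtain N where N: "\<And>x y. x \<in> B \<Longrightarrow> y \<in> X \<Longrightarrow> (\<And>i. i < N \<Longrightarrow> x i = y i) \<Longrightarrow> y \<in> B"
    using KE[OF B] by blast
  show ?thesis
  proof (rule KI[where N = "max M N"])
    show "finite ((\<lambda>x. tail G (x 0)) ` A)"
      using A by (simp add: K_finite)
    show "y \<in> A - B" if "x \<in> A - B" "y \<in> X" "\<And>i. i < max M N \<Longrightarrow> x i = y i" for x y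
      using that M[of x y] N[of y x] K_subset[OF A] by auto
  qed (use K_subset[OF A] in auto)
qed

lemma K_Int [intro]: "A \<in> K \<Longrightarrow> B \<in> K \<Longrightarrow> A \<inter> B \<in> K"
  by (metis Diff_Diff_Int K_Diff)

lemma K_UNION: "finite I \<Longrightarrow> (\<And>i. i \<in> I \<Longrightarrow> A i \<in> K) \<Longrightarrow> (\<Union>i\<in>I. A i) \<in> K"
  by (induction I rule: finite_induct) auto

lemma Z_K [intro, simp]: "Z v \<in> K"
  by (auto simp: K_def Z_def intro!: exI[of _ 1] intro: finite_subset[of _ "{v}"])

lemma K_cyl_Int [intro]:
  assumes A: "A \<in> K" shows "A \<inter> cyl n z \<in> K"
proof -
  obtain M where M: "\<And>x y. x \<in> A \<Longrightarrow> y \<in> X \<Longrightarrow> (\<And>i. i < M \<Longrightarrow> x i = y i) \<Longrightarrow> y \<in> A"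
    using KE[OF A] by blast
  show ?thesis
  proof (rule KI[where N = "max M n"])
    show "finite ((\<lambda>x. tail G (x 0)) ` A)"
      using A by (simp add: K_finite)
    show "y \<in> A \<inter> cyl n z" if "x \<in> A \<inter> cyl n z" "y \<in> X" "\<And>i. i < max M n \<Longrightarrow> x i = y i" for x y
      using that M[of x y] by (auto simp: cyl_def)
  qed (use K_subset[OF A] in auto)
qed

lemma Z_subset: "Z v \<subseteq> X"
  by (auto simp: Z_def)

lemma cyl_K [intro]: "n > 0 \<Longrightarrow> cyl n x \<in> K"
proof -
  assume "n > 0"
  then have "cyl n x = Z (tail G (x 0)) \<inter> cyl n x" by (auto simp: cyl_def Z_def)
  then show ?thesis using K_cyl_Int[OF Z_K] by metis
qed

lemma cyl_subset: "cyl n x \<subseteq> X"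
  by (auto simp: cyl_def)

lemma cyl_self: "x \<in> X \<Longrightarrow> x \<in> cyl n x"
  by (simp add: cyl_def)

lemma cyl_eq_iff_map: "cyl n x = {y\<in>X. map y [0..<n] = map x [0..<n]}"
  by (auto simp: cyl_def)

text \<open>This is where it matters that vertices emit only finitely many edges. Finite
  subdivisions, compactness of the sets in \<open>K\<close> and finiteness of fibres within them all
  rest on it.\<close>

lemma finite_prefixes_Z: "v \<in> verts G \<Longrightarrow> finite ((\<lambda>x. map x [0..<n]) ` Z v)"
proof (induction n arbitrary: v)
  case (Suc n)
  have "(\<lambda>x. map x [0..<Suc n]) ` Z v \<subseteq>
     (\<Union>e\<in>out_arcs G v. (#) e ` (\<lambda>x. map x [0..<n]) ` Z (head G e))"
  proof
    fix l assume "l \<in> (\<lambda>x. map x [0..<Suc n]) ` Z v"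
    then obtain x where x: "x \<in> Z v" "l = map x [0..<Suc n]" by auto
    then have "l = x 0 # map (\<sigma> x) [0..<n]"
      by (simp only: map_upt_Suc path_shift_def)
    moreover have "x 0 \<in> out_arcs G v" "\<sigma> x \<in> Z (head G (x 0))"
      using x by (auto simp: Z_def X_arcs shift_X X_head) (simp add: path_shift_def)
    ultimately show "l \<in> (\<Union>e\<in>out_arcs G v. (#) e ` (\<lambda>x. map x [0..<n]) ` Z (head G e))" by blast
  qed
  moreover have "finite (\<Union>e\<in>out_arcs G v. (#) e ` (\<lambda>x. map x [0..<n]) ` Z (head G e))"
    using Suc finite_out by auto
  ultimately show ?case by (rule finite_subset)
qed (simp add: image_constant_conv)

lemma K_verts: "A \<in> K \<Longrightarrow> (\<lambda>x. tail G (x 0)) ` A \<subseteq> verts G"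
  using K_subset X_tail_verts by blast

lemma finite_prefixes_K:
  assumes "A \<in> K" shows "finite ((\<lambda>x. map x [0..<n]) ` A)"
proof (rule finite_subset)
  show "(\<lambda>x. map x [0..<n]) ` A \<subseteq> (\<Union>v\<in>(\<lambda>x. tail G (x 0)) ` A. (\<lambda>x. map x [0..<n]) ` Z v)"
    using K_subset[OF assms] by (auto simp: Z_def)
  show "finite (\<Union>v\<in>(\<lambda>x. tail G (x 0)) ` A. (\<lambda>x. map x [0..<n]) ` Z v)"
    using assms K_verts[OF assms] finite_prefixes_Z by (intro finite_UN_I) (auto simp: K_def)
qed

text \<open>The partition of \<open>A\<close> by the first \<open>n\<close> edges. Being indexed by
  points of \<open>A\<close>, its members are non-empty, so each has a reference point at which
  \<phi> can be evaluated.\<close>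

definition pieces :: "nat \<Rightarrow> (nat \<Rightarrow> 'b) set \<Rightarrow> (nat \<Rightarrow> 'b) set set" where
  "pieces n A = (\<lambda>x. A \<inter> cyl n x) ` A"

lemma finite_pieces: "A \<in> K \<Longrightarrow> finite (pieces n A)"
proof -
  assume A: "A \<in> K"
  have "pieces n A = (\<lambda>l. A \<inter> {y\<in>X. map y [0..<n] = l}) ` (\<lambda>x. map x [0..<n]) ` A"
    unfolding pieces_def cyl_eq_iff_map by (simp add: image_image)
  then show ?thesis using finite_prefixes_K[OF A] by simp
qed

lemma pieces_K: "A \<in> K \<Longrightarrow> B \<in> pieces n A \<Longrightarrow> B \<in> K"
  by (auto simp: pieces_def)

lemma Union_pieces: "A \<subseteq> X \<Longrightarrow> \<Union> (pieces n A) = A"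
  unfolding pieces_def using cyl_self by blast

lemma disjoint_pieces: "disjoint (pieces n A)"
  unfolding pieces_def disjoint_def cyl_def by auto

lemma pieces_nonempty: "A \<subseteq> X \<Longrightarrow> B \<in> pieces n A \<Longrightarrow> B \<noteq> {} \<and> B \<subseteq> A"
  unfolding pieces_def using cyl_self by blast

lemma pieces_agree: "B \<in> pieces n A \<Longrightarrow> x \<in> B \<Longrightarrow> y \<in> B \<Longrightarrow> i < n \<Longrightarrow> x i = y i"
  by (auto simp: pieces_def cyl_def)

text \<open>A member of \<open>K\<close> is coded by a length and a finite set of words of that
  length. Countability allows diagonal subsequences and lets \<open>K\<close> generate the Borel
  sets.\<close>

lemma countable_K: "countable K"
proof -
  let ?g = "\<lambda>(N, L). {x \<in> X. map x [0..<N] \<in> L}"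
  let ?D = "(UNIV :: nat set) \<times> {L. finite L \<and> L \<subseteq> lists (arcs G)}"
  have "K \<subseteq> ?g ` ?D"
  proof
    fix A assume A: "A \<in> K"
    then obtain N where N: "\<forall>x\<in>A. \<forall>y\<in>X. (\<forall>i<N. x i = y i) \<longrightarrow> y \<in> A" by (auto simp: K_def)
    let ?L = "(\<lambda>x. map x [0..<N]) ` A"
    have "A = ?g (N, ?L)"
      using N K_subset[OF A] by (auto simp: Ball_def)
    moreover have "(N, ?L) \<in> ?D"
      using finite_prefixes_K[OF A] K_subset[OF A] X_arcs by (auto simp: subset_eq)
    ultimately show "A \<in> ?g ` ?D" by blast
  qed
  moreover have "countable ?D"
    by (intro countable_SIGMA countable_Collect_finite_subset countable_lists countable_arcs)
      (auto)
  ultimately show ?thesis by (rule countable_subset[OF _ countable_image])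
qed

text \<open>\<phi> may be unbounded on \<open>X\<close>, but \<open>A\<close> is covered by finitely
  many pieces on which it varies by at most 1.\<close>

lemma phi_bounded:
  assumes "A \<in> K" obtains B where "\<And>x. x \<in> A \<Longrightarrow> \<bar>\<phi> x\<bar> \<le> B"
proof -
  obtain N where N: "\<forall>x\<in>X. \<forall>y\<in>X. (\<forall>i<N. x i = y i) \<longrightarrow> \<bar>\<phi> x - \<phi> y\<bar> \<le> 1"
    using osc[OF zero_less_one] by blast
  have "\<exists>B. \<forall>x\<in>P. \<bar>\<phi> x\<bar> \<le> B" if P: "P \<in> pieces N A" for P
  proof -
    obtain y where y: "y \<in> P" using pieces_nonempty[OF K_subset[OF assms] P] by blast
    have PX: "P \<subseteq> X" by (rule K_subset[OF pieces_K[OF assms P]])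
    have "\<forall>x\<in>P. \<bar>\<phi> x\<bar> \<le> \<bar>\<phi> y\<bar> + 1"
    proof
      fix x assume "x \<in> P"
      then have "\<bar>\<phi> x - \<phi> y\<bar> \<le> 1" using N y PX pieces_agree[OF P, of x y] by (simp add: subset_iff)
      then show "\<bar>\<phi> x\<bar> \<le> \<bar>\<phi> y\<bar> + 1" by linarith
    qed
    then show ?thesis by blast
  qed
  then have "\<forall>P\<in>pieces N A. \<exists>B. \<forall>x\<in>P. \<bar>\<phi> x\<bar> \<le> B" by blast
  then obtain b where b: "\<forall>P\<in>pieces N A. \<forall>x\<in>P. \<bar>\<phi> x\<bar> \<le> b P" by (rule bchoice[THEN exE])
  have fin: "finite (b ` pieces N A)" by (rule finite_imageI[OF finite_pieces[OF assms]])
  show thesis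
  proof (rule that[of "Max (b ` pieces N A)"])
    fix x assume "x \<in> A"
    then obtain P where P: "P \<in> pieces N A" "x \<in> P"
      using Union_pieces[of A N] K_subset[OF assms] by blast
    then have "\<bar>\<phi> x\<bar> \<le> b P" using b by simp
    also have "\<dots> \<le> Max (b ` pieces N A)" using P fin by auto
    finally show "\<bar>\<phi> x\<bar> \<le> Max (b ` pieces N A)" .
  qed
qed

lemma shift_K: assumes "A \<in> K" shows "\<sigma> ` A \<in> K"
proof -
  obtain N where N: "\<And>x y. x \<in> A \<Longrightarrow> y \<in> X \<Longrightarrow> (\<And>i. i < N \<Longrightarrow> x i = y i) \<Longrightarrow> y \<in> A"
    using KE[OF assms] by blast
  have AX: "A \<subseteq> X" using K_subset assms .
  \<comment> \<open>Shifting costs one edge, so fewer than \<open>N\<close> edges would decide most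
    cases; \<open>Suc N\<close> guarantees agreement at index 0, without which the lost first edge
    could not be put in front of \<open>y\<close>.\<close>
  show ?thesis
  proof (rule KI[where N = "Suc N"])
    show "finite (head G ` (\<Union>v\<in>(\<lambda>x. tail G (x 0)) ` A. out_arcs G v))"
      by (intro finite_imageI finite_UN_I[OF K_finite[OF assms]] finite_out) (use K_verts[OF assms] in auto)
    show "tail G (y 0) \<in> head G ` (\<Union>v\<in>(\<lambda>x. tail G (x 0)) ` A. out_arcs G v)" if y: "y \<in> \<sigma> ` A" for y
    proof -
      obtain x where x: "x \<in> A" "y = \<sigma> x" using y by blast
      then have "tail G (y 0) = head G (x 0)" using AX by (auto simp: path_shift_def X_head)
      moreover have "x 0 \<in> out_arcs G (tail G (x 0))" using x AX X_arcs by auto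
      ultimately show ?thesis using x by blast
    qed
    show "y \<in> \<sigma> ` A" if x: "x \<in> \<sigma> ` A" and "y \<in> X" and eq: "\<And>i. i < Suc N \<Longrightarrow> x i = y i" for x y
    proof -
      obtain x' where x': "x' \<in> A" "x = \<sigma> x'" using x by blast
      have "case_nat (x' 0) y \<in> X"
        using that x' AX eq[of 0] by (intro case_nat_X X_arcs) (auto simp: path_shift_def X_head)
      moreover have "x' i = case_nat (x' 0) y i" if "i < N" for i
        using eq[of "i - 1"] x' that by (auto simp: path_shift_def split: nat.split)
      ultimately have "case_nat (x' 0) y \<in> A" using N x' by blast
      then show ?thesis by (metis image_eqI path_shift_case_nat)
    qed
  qed (use AX shift_X in auto)
qed

lemma shift_funpow_K: "A \<in> K \<Longrightarrow> (\<sigma> ^^ n) ` A \<in> K"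
proof (induction n)
  case (Suc n)
  have "(\<sigma> ^^ Suc n) ` A = \<sigma> ` (\<sigma> ^^ n) ` A" by (simp add: image_comp)
  then show ?case using Suc shift_K by simp
qed simp

subsection \<open>Compact open sets in the path topology\<close>

abbreviation T where "T \<equiv> path_topology G"

lemma topspace_T [simp]: "topspace T = X"
  by (rule topspace_path_topology) unfold_locales

lemma cyl_mono: "m \<le> n \<Longrightarrow> cyl n x \<subseteq> cyl m x"
  by (auto simp: cyl_def)

lemma openin_T_iff: "openin T U \<longleftrightarrow> U \<subseteq> X \<and> (\<forall>x\<in>U. \<exists>n. cyl n x \<subseteq> U)"
proof
  assume U: "openin T U"
  then obtain \<U> where \<U>: "\<And>S. S \<in> \<U> \<Longrightarrow> is_cylinder G S" "U = \<Union>\<U>"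
    unfolding openin_path_topology union_of_def by auto
  have "\<exists>n. cyl n x \<subseteq> U" if x: "x \<in> U" for x
  proof -
    obtain S where S: "S \<in> \<U>" "x \<in> S" using x \<U>(2) by blast
    obtain \<mu> where \<mu>: "S = cylinder G \<mu>" using \<U>(1)[OF S(1)] by (auto simp: is_cylinder_def)
    have "cyl (length \<mu>) x \<subseteq> S" using S(2) unfolding \<mu> cyl_def cylinder_def by auto
    then show ?thesis using S(1) \<U>(2) by blast
  qed
  then show "U \<subseteq> X \<and> (\<forall>x\<in>U. \<exists>n. cyl n x \<subseteq> U)"
    using openin_subset[OF U] by simp
next
  assume U: "U \<subseteq> X \<and> (\<forall>x\<in>U. \<exists>n. cyl n x \<subseteq> U)"
  \<comment> \<open>One edge more than necessary, because basic cylinders come from paths with at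
    least one edge.\<close>
  let ?\<U> = "{cyl (Suc n) x | n x. x \<in> U \<and> cyl (Suc n) x \<subseteq> U}"
  have "U = \<Union>?\<U>"
  proof
    show "U \<subseteq> \<Union>?\<U>"
    proof
      fix x assume x: "x \<in> U"
      then obtain n where "cyl n x \<subseteq> U" using U by blast
      then have "cyl (Suc n) x \<subseteq> U" using cyl_mono[of n "Suc n" x] by auto
      moreover have "x \<in> cyl (Suc n) x" using x U cyl_self by blast
      ultimately show "x \<in> \<Union>?\<U>" using x by blast
    qed
  qed blast
  moreover have "is_cylinder G (cyl (Suc n) x)" if "x \<in> U" for n x
  proof -
    have "x \<in> X" using U that by blast
    then have "finite_path G (tail G (x 0)) (map x [0..<Suc n]) (tail G (x (Suc n)))"
      by (rule path_prefix_finite_path) simp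
    moreover have "cyl (Suc n) x = cylinder G (map x [0..<Suc n])"
      by (auto simp: cyl_def cylinder_def nth_append less_Suc_eq)
    ultimately show ?thesis unfolding is_cylinder_def by blast
  qed
  then have "?\<U> \<subseteq> Collect (is_cylinder G)" by auto
  ultimately show "openin T U"
    unfolding openin_path_topology union_of_def arbitrary_def by (intro exI[of _ ?\<U>]) simp
qed

lemma K_determined: assumes "A \<in> K" shows "\<exists>n. \<forall>x\<in>A. cyl n x \<subseteq> A"
proof -
  obtain N where N: "\<And>x y. x \<in> A \<Longrightarrow> y \<in> X \<Longrightarrow> (\<And>i. i < N \<Longrightarrow> x i = y i) \<Longrightarrow> y \<in> A"
    using KE[OF assms] by blast
  have "cyl N x \<subseteq> A" if "x \<in> A" for x
  proof
    fix y assume "y \<in> cyl N x"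
    then show "y \<in> A" by (intro N[OF \<open>x \<in> A\<close>]) (auto simp: cyl_def)
  qed
  then show ?thesis by blast
qed

lemma K_openin: "A \<in> K \<Longrightarrow> openin T A"
  unfolding openin_T_iff using K_subset[of A] K_determined[of A] by auto

lemma K_closedin: assumes "A \<in> K" shows "closedin T A"
proof -
  obtain n where n: "\<forall>x\<in>A. cyl n x \<subseteq> A" using K_determined[OF assms] by blast
  have "openin T (X - A)"
    unfolding openin_T_iff
  proof (intro conjI ballI exI)
    fix x assume x: "x \<in> X - A"
    show "cyl n x \<subseteq> X - A"
    proof
      fix y assume y: "y \<in> cyl n x"
      then have "x \<in> cyl n y" using x by (auto simp: cyl_def)
      then show "y \<in> X - A" using n x y by (auto simp: cyl_def)
    qed
  qed auto
  then show ?thesis using K_subset[OF assms] by (simp add: closedin_def)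
qed

text \<open>Koenig's lemma: if \<open>A\<close> has no finite subcover, neither has one of its
  finitely many pieces, one of the pieces of that piece, and so on. The nested bad pieces single out
  a path in \<open>A\<close>, and an open set of the cover around this path contains one of
  them.\<close>

lemma compactin_K: assumes A: "A \<in> K" shows "compactin T A"
  unfolding compactin_def
proof (intro conjI allI impI)
  show "A \<subseteq> topspace T" using K_subset[OF A] by simp
  fix \<U> assume \<U>: "(\<forall>U\<in>\<U>. openin T U) \<and> A \<subseteq> \<Union>\<U>"
  let ?good = "\<lambda>B. \<exists>\<F>. finite \<F> \<and> \<F> \<subseteq> \<U> \<and> B \<subseteq> \<Union>\<F>"
  show "?good A"
  proof (rule ccontr)
    assume bad: "\<not> ?good A"
    have ne: "A \<noteq> {}" using bad by (auto dest: spec[of _ "{}"])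
    let ?P = "\<lambda>n x. x \<in> A \<and> \<not> ?good (A \<inter> cyl n x)"
    have base: "\<exists>x. ?P 0 x"
    proof -
      obtain x where x: "x \<in> A" using ne by blast
      have "A \<inter> cyl 0 x = A" using K_subset[OF A] by (auto simp: cyl_def)
      then have "?P 0 x" using bad x by (simp only: simp_thms)
      then show ?thesis by (intro exI)
    qed
    have step: "\<exists>y. ?P (Suc n) y \<and> y \<in> cyl n x" if x: "?P n x" for x n
    proof (rule ccontr)
      assume none: "\<nexists>y. ?P (Suc n) y \<and> y \<in> cyl n x"
      let ?B = "A \<inter> cyl n x"
      have B: "?B \<in> K" using A by blast
      have "\<forall>C\<in>pieces (Suc n) ?B. ?good C"
      proof
        fix C assume "C \<in> pieces (Suc n) ?B"
        then obtain y where y: "y \<in> ?B" "C = ?B \<inter> cyl (Suc n) y" by (auto simp: pieces_def)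
        then have "?good (A \<inter> cyl (Suc n) y)" using none by blast
        then show "?good C" using y(2) by blast
      qed
      then obtain g where g: "\<forall>C\<in>pieces (Suc n) ?B. finite (g C) \<and> g C \<subseteq> \<U> \<and> C \<subseteq> \<Union>(g C)"
        by (rule bchoice[THEN exE])
      have "finite (\<Union>C\<in>pieces (Suc n) ?B. g C)" using finite_pieces[OF B] g by blast
      moreover have "(\<Union>C\<in>pieces (Suc n) ?B. g C) \<subseteq> \<U>" using g by blast
      moreover have "?B \<subseteq> \<Union>(\<Union>C\<in>pieces (Suc n) ?B. g C)"
        using Union_pieces[OF K_subset[OF B], of "Suc n"] g by blast
      ultimately show False using x by blast
    qed
    have "\<exists>f. \<forall>n. ?P n (f n) \<and> f (Suc n) \<in> cyl n (f n)"
      by (rule dependent_nat_choice[OF base step])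
    then obtain f where f0: "\<forall>n. ?P n (f n) \<and> f (Suc n) \<in> cyl n (f n)" ..
    have f: "?P n (f n)" "f (Suc n) \<in> cyl n (f n)" for n
      using spec[OF f0, of n] by (rule conjunct1, rule conjunct2)
    have agree: "i < n \<Longrightarrow> f (n + k) i = f n i" for i n k
    proof (induction k)
      case (Suc k)
      then show ?case using f(2)[of "n + k"] by (simp add: cyl_def)
    qed simp
    \<comment> \<open>Later choices keep the edges fixed earlier, so the edge at position
      \<open>i\<close> is settled from stage \<open>Suc i\<close> on.\<close>
    define p where "p i = f (Suc i) i" for i
    have p: "p i = f n i" if "i < n" for i n
      using agree[of i "Suc i" "n - Suc i"] that by (simp add: p_def)
    have fX: "f n \<in> X" for n using f(1)[of n] K_subset[OF A] by blast
    have pX: "p \<in> X"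
      unfolding infinite_paths_def
    proof (intro CollectI allI conjI)
      fix i
      show "p i \<in> arcs G" using p[of i "Suc i"] X_arcs[OF fX] by simp
      show "head G (p i) = tail G (p (Suc i))"
        using p[of i "Suc (Suc i)"] p[of "Suc i" "Suc (Suc i)"] X_head[OF fX] by simp
    qed
    obtain N where N: "\<forall>x\<in>A. cyl N x \<subseteq> A" using K_determined[OF A] by blast
    have "p \<in> cyl N (f N)" using p pX by (simp add: cyl_def)
    then have "p \<in> A" using N f(1)[of N] by blast
    then obtain U where U: "U \<in> \<U>" "p \<in> U" using \<U> by blast
    then obtain n where n: "cyl n p \<subseteq> U" using \<U> openin_T_iff by blast
    have "cyl n (f n) = cyl n p" using p by (simp add: cyl_def)
    then have "A \<inter> cyl n (f n) \<subseteq> \<Union>{U}" using n by auto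
    then have "?good (A \<inter> cyl n (f n))" using U(1) by (intro exI[of _ "{U}"]) simp
    then show False using f(1)[of n] by blast
  qed
qed

lemma openin_Union_K: assumes "openin T U" shows "U = \<Union>{A\<in>K. A \<subseteq> U}"
proof
  show "U \<subseteq> \<Union>{A\<in>K. A \<subseteq> U}"
  proof
    fix x assume x: "x \<in> U"
    then obtain n where "cyl n x \<subseteq> U" using assms openin_T_iff by blast
    then have "cyl (Suc n) x \<subseteq> U" using cyl_mono[of n "Suc n" x] by auto
    moreover have "x \<in> X" using x assms openin_T_iff by blast
    ultimately show "x \<in> \<Union>{A\<in>K. A \<subseteq> U}"
      using cyl_self[of x "Suc n"] cyl_K[of "Suc n" x] by blast
  qed
qed blast

lemma X_Union_Z: "X = (\<Union>v\<in>verts G. Z v)"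
  using X_tail_verts by (auto simp: Z_def)

lemma compactin_subset_K: assumes "compactin T C" obtains A where "A \<in> K" "C \<subseteq> A"
proof -
  have "C \<subseteq> \<Union>(Z ` verts G)" using compactin_subset_topspace[OF assms] X_Union_Z by auto
  moreover have "\<forall>U\<in>Z ` verts G. openin T U" using K_openin by auto
  ultimately obtain \<F> where "finite \<F>" "\<F> \<subseteq> Z ` verts G" "C \<subseteq> \<Union>\<F>"
    using assms unfolding compactin_def by meson
  moreover from this have "\<Union>\<F> \<in> K" using K_UNION[of \<F> "\<lambda>A. A"] by auto
  ultimately show thesis using that by blast
qed

subsection \<open>Splicing paths\<close>

definition splice :: "nat \<Rightarrow> (nat \<Rightarrow> 'b) \<Rightarrow> (nat \<Rightarrow> 'b) \<Rightarrow> nat \<Rightarrow> 'b" where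
  "splice n x y = (\<lambda>i. if i < n then x i else y (i - n))"

lemma splice_X:
  assumes "x \<in> X" "y \<in> X" "tail G (y 0) = tail G (x n)"
  shows "splice n x y \<in> X"
  unfolding infinite_paths_def
proof (intro CollectI allI conjI)
  fix i
  show "splice n x y i \<in> arcs G" using assms X_arcs by (simp add: splice_def)
  consider "Suc i < n" | "Suc i = n" | "n \<le> i" by linarith
  then show "head G (splice n x y i) = tail G (splice n x y (Suc i))"
  proof cases
    case 1 then show ?thesis using assms X_head by (simp add: splice_def)
  next
    case 2 then show ?thesis using assms X_head[of x i] by (auto simp: splice_def)
  next
    case 3 then show ?thesis using assms X_head[of y "i - n"] by (simp add: splice_def Suc_diff_le)
  qed
qed

lemma shift_splice [simp]: "(\<sigma> ^^ n) (splice n x y) = y"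
  by (simp add: shift_funpow splice_def)

lemma splice_agree: "i < n \<Longrightarrow> splice n x y i = x i"
  by (simp add: splice_def)

lemma splice_self: "splice n x ((\<sigma> ^^ n) x) = x"
  by (auto simp: shift_funpow splice_def)

lemma inj_on_shift_cyl: "inj_on (\<sigma> ^^ n) (cyl (n + k) x)"
proof (rule inj_onI)
  fix y z assume *: "y \<in> cyl (n + k) x" "z \<in> cyl (n + k) x" "(\<sigma> ^^ n) y = (\<sigma> ^^ n) z"
  then have "y i = z i" for i
    by (cases "i < n") (auto simp: cyl_def shift_funpow dest: fun_cong[of _ _ "i - n"])
  then show "y = z" by blast
qed

text \<open>For \<open>k = 0\<close> the second factor is all of \<open>X\<close> and only the
  vertex reached after \<open>n\<close> edges restricts the image, whence the factor
  \<open>Z\<close>. The case \<open>n = k = 0\<close> has to be excluded because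
  \<open>cyl 0 x\<close> does not fix an initial vertex.\<close>

lemma shift_funpow_cyl:
  assumes "x \<in> X" and nk: "n > 0 \<or> k > 0"
  shows "(\<sigma> ^^ n) ` cyl (n + k) x = Z (tail G (x n)) \<inter> cyl k ((\<sigma> ^^ n) x)"
proof
  show "(\<sigma> ^^ n) ` cyl (n + k) x \<subseteq> Z (tail G (x n)) \<inter> cyl k ((\<sigma> ^^ n) x)"
  proof
    fix y assume "y \<in> (\<sigma> ^^ n) ` cyl (n + k) x"
    then obtain z where z: "z \<in> X" "\<And>i. i < n + k \<Longrightarrow> z i = x i" "y = (\<sigma> ^^ n) z"
      by (auto simp: cyl_def)
    have "tail G (z n) = tail G (x n)"
    proof (cases "k > 0")
      case True then show ?thesis using z(2)[of n] by simp
    next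
      case False
      then obtain m where "n = Suc m" using nk by (cases n) auto
      then show ?thesis using z X_head[OF z(1), of m] X_head[OF assms(1), of m] by simp
    qed
    then show "y \<in> Z (tail G (x n)) \<inter> cyl k ((\<sigma> ^^ n) x)"
      using z shift_funpow_X[OF z(1), of n] by (simp add: Z_def cyl_def shift_funpow)
  qed
  show "Z (tail G (x n)) \<inter> cyl k ((\<sigma> ^^ n) x) \<subseteq> (\<sigma> ^^ n) ` cyl (n + k) x"
  proof
    fix y assume y: "y \<in> Z (tail G (x n)) \<inter> cyl k ((\<sigma> ^^ n) x)"
    have "splice n x y \<in> cyl (n + k) x"
      using y assms splice_X[of x y n] by (auto simp: cyl_def Z_def splice_def shift_funpow)
    then show "y \<in> (\<sigma> ^^ n) ` cyl (n + k) x" by (metis image_eqI shift_splice)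
  qed
qed

definition E :: "'b \<Rightarrow> (nat \<Rightarrow> 'b) set" where
  "E e = {x \<in> X. x 0 = e}"

lemma E_K [simp, intro]: "E e \<in> K"
  by (rule KI[where F = "{tail G e}" and N = 1]) (auto simp: E_def)

lemma inj_on_shift_E: "inj_on \<sigma> (E e)"
  by (rule inj_onI) (metis (mono_tags, lifting) E_def case_nat_path_shift mem_Collect_eq)

lemma shift_E: assumes "e \<in> arcs G" shows "\<sigma> ` E e = Z (head G e)"
proof
  show "\<sigma> ` E e \<subseteq> Z (head G e)"
    by (auto simp: E_def Z_def shift_X X_head) (simp add: path_shift_def)
  show "Z (head G e) \<subseteq> \<sigma> ` E e"
  proof
    fix y assume "y \<in> Z (head G e)"
    then have "case_nat e y \<in> E e" using assms by (auto simp: E_def Z_def intro: case_nat_X)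
    then show "y \<in> \<sigma> ` E e" by (metis image_eqI path_shift_case_nat)
  qed
qed

lemma Z_Union_E: "Z v = (\<Union>e\<in>out_arcs G v. E e)"
  using X_arcs by (auto simp: Z_def E_def)

lemma disjoint_E: "disjoint_family_on E I"
  by (auto simp: disjoint_family_on_def E_def)

lemma disjoint_Z: "disjoint_family_on Z I"
  by (auto simp: disjoint_family_on_def Z_def)

subsection \<open>Additive functions and weights\<close>

text \<open>Additivity is relative to a set because the pull-back of an additive function under
  \<sigma> is additive only where \<sigma> is injective. Values outside \<open>K\<close> are
  arbitrary.\<close>

definition additive_on :: "(nat \<Rightarrow> 'b) set \<Rightarrow> ((nat \<Rightarrow> 'b) set \<Rightarrow> real) \<Rightarrow> bool" where
  "additive_on A F \<longleftrightarrow>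
     (\<forall>B\<in>K. \<forall>C\<in>K. B \<subseteq> A \<longrightarrow> C \<subseteq> A \<longrightarrow> B \<inter> C = {} \<longrightarrow> F (B \<union> C) = F B + F C)"

lemma additive_on_empty: "additive_on A F \<Longrightarrow> F {} = 0"
  unfolding additive_on_def using K_empty by fastforce

lemma additive_on_UN:
  assumes F: "additive_on A F" and "finite I" "disjoint_family_on C I"
    and "\<And>i. i \<in> I \<Longrightarrow> C i \<in> K" "\<And>i. i \<in> I \<Longrightarrow> C i \<subseteq> A"
  shows "F (\<Union>i\<in>I. C i) = (\<Sum>i\<in>I. F (C i))"
  using assms(2-)
proof (induction I rule: finite_induct)
  case empty then show ?case using additive_on_empty[OF F] by simp
next
  case (insert i I)
  have "C i \<inter> (\<Union>j\<in>I. C j) = {}"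
    using insert.hyps(2) insert.prems(1) by (auto simp: disjoint_family_on_def)
  moreover have "(\<Union>j\<in>I. C j) \<in> K" using insert by (intro K_UNION) auto
  moreover have "C i \<in> K" "C i \<subseteq> A" "(\<Union>j\<in>I. C j) \<subseteq> A" using insert.prems by auto
  ultimately have "F (C i \<union> (\<Union>j\<in>I. C j)) = F (C i) + F (\<Union>j\<in>I. C j)"
    using F unfolding additive_on_def by blast
  moreover have "F (\<Union>j\<in>I. C j) = (\<Sum>j\<in>I. F (C j))"
    using insert by (intro insert.IH) (auto simp: disjoint_family_on_def)
  ultimately show ?case using insert.hyps by simp
qed

lemma additive_on_pieces:
  assumes "additive_on A F" "A \<in> K"
  shows "F A = (\<Sum>B\<in>pieces n A. F B)"
proof -
  have "F (\<Union>B\<in>pieces n A. B) = (\<Sum>B\<in>pieces n A. F B)"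
  proof (rule additive_on_UN[OF assms(1) finite_pieces[OF assms(2)]])
    show "disjoint_family_on (\<lambda>B. B) (pieces n A)"
      using disjoint_pieces by (auto simp: disjoint_family_on_def disjoint_def)
  qed (use assms pieces_K pieces_nonempty[OF K_subset[OF assms(2)]] in auto)
  then show ?thesis using Union_pieces[OF K_subset[OF assms(2)], of n] by simp
qed

lemma additive_on_shift:
  assumes "additive_on X h" "inj_on (\<sigma> ^^ n) A"
  shows "additive_on A (\<lambda>B. h ((\<sigma> ^^ n) ` B))"
  unfolding additive_on_def
proof (intro ballI impI)
  fix B C assume BC: "B \<in> K" "C \<in> K" "B \<subseteq> A" "C \<subseteq> A" "B \<inter> C = {}"
  have "(\<sigma> ^^ n) ` B \<inter> (\<sigma> ^^ n) ` C = {}"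
    using inj_on_image_Int[OF assms(2) BC(3,4)] BC(5) by simp
  moreover have "(\<sigma> ^^ n) ` B \<in> K" "(\<sigma> ^^ n) ` C \<in> K" using BC by (auto intro: shift_funpow_K)
  ultimately show "h ((\<sigma> ^^ n) ` (B \<union> C)) = h ((\<sigma> ^^ n) ` B) + h ((\<sigma> ^^ n) ` C)"
    using assms(1) K_subset unfolding additive_on_def image_Un by simp
qed

lemma additive_on_mult: "additive_on A F \<Longrightarrow> additive_on A (\<lambda>B. c * F B)"
  by (simp add: additive_on_def algebra_simps)

lemma additive_on_add: "additive_on A F \<Longrightarrow> additive_on A H \<Longrightarrow> additive_on A (\<lambda>B. F B + H B)"
  by (simp add: additive_on_def)

lemma additive_on_diff: "additive_on A F \<Longrightarrow> additive_on A H \<Longrightarrow> additive_on A (\<lambda>B. F B - H B)"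
  by (simp add: additive_on_def)

lemma additive_on_mono: "additive_on A F \<Longrightarrow> B \<subseteq> A \<Longrightarrow> additive_on B F"
  unfolding additive_on_def by (meson subset_trans)

text \<open>
  An inequality between additive functions needs to be checked only on pieces where \<open>\<phi>\<close> has small
  oscillation, and only up to an error that is small relative to a third additive function.
\<close>

lemma refine_le:
  assumes A: "A \<in> K" and add: "additive_on A F" "additive_on A H" "additive_on A D"
    and le: "\<And>\<eta> B. \<lbrakk>\<eta> > 0; B \<in> K; B \<subseteq> A; B \<noteq> {}; \<And>x y. x \<in> B \<Longrightarrow> y \<in> B \<Longrightarrow> \<bar>\<phi> x - \<phi> y\<bar> \<le> \<eta>\<rbrakk>
        \<Longrightarrow> F B \<le> H B + (exp (2 * \<eta>) - 1) * D B"
  shows "F A \<le> H A"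
proof -
  have *: "F A \<le> H A + (exp (2 * \<eta>) - 1) * D A" if \<eta>: "\<eta> > 0" for \<eta>
  proof -
    obtain N where N: "\<forall>x\<in>X. \<forall>y\<in>X. (\<forall>i<N. x i = y i) \<longrightarrow> \<bar>\<phi> x - \<phi> y\<bar> \<le> \<eta>"
      using osc[OF \<eta>] by blast
    have "F A = (\<Sum>B\<in>pieces N A. F B)" by (rule additive_on_pieces[OF add(1) A])
    also have "\<dots> \<le> (\<Sum>B\<in>pieces N A. H B + (exp (2 * \<eta>) - 1) * D B)"
    proof (rule sum_mono)
      fix B assume B: "B \<in> pieces N A"
      have B': "B \<noteq> {}" "B \<subseteq> A" "B \<in> K"
        using pieces_nonempty[OF K_subset[OF A] B] pieces_K[OF A B] by auto
      show "F B \<le> H B + (exp (2 * \<eta>) - 1) * D B"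
      proof (rule le[OF \<eta> B'(3,2,1)])
        fix x y assume xy: "x \<in> B" "y \<in> B"
        then have "x \<in> X" "y \<in> X" using K_subset[OF B'(3)] by auto
        then show "\<bar>\<phi> x - \<phi> y\<bar> \<le> \<eta>" using N pieces_agree[OF B xy] by blast
      qed
    qed
    also have "\<dots> = H A + (exp (2 * \<eta>) - 1) * D A"
      by (simp add: sum.distrib additive_on_pieces[OF add(2) A, of N]
          additive_on_pieces[OF add(3) A, of N] sum_distrib_left)
    finally show ?thesis .
  qed
  have "(\<lambda>n. H A + (exp (2 * inverse (real (Suc n))) - 1) * D A) \<longlonglongrightarrow> H A + (exp (2 * 0) - 1) * D A"
    by (intro tendsto_intros LIMSEQ_inverse_real_of_nat)
  then have "(\<lambda>n. H A + (exp (2 * inverse (real (Suc n))) - 1) * D A) \<longlonglongrightarrow> H A" by simp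
  then show ?thesis by (rule LIMSEQ_le_const) (use * in auto)
qed

text \<open>The conformality equation with the integral replaced by its trivial bounds. In this form
  it is closed under pointwise limits on \<open>K\<close>; values outside \<open>K\<close> are
  arbitrary.\<close>

definition weight :: "((nat \<Rightarrow> 'b) set \<Rightarrow> real) \<Rightarrow> bool" where
  "weight h \<longleftrightarrow> (\<forall>A\<in>K. 0 \<le> h A) \<and> additive_on X h \<and>
     (\<forall>A\<in>K. \<forall>a b. inj_on \<sigma> A \<longrightarrow> (\<forall>x\<in>A. a \<le> \<phi> x \<and> \<phi> x \<le> b) \<longrightarrow>
        exp a * h A \<le> h (\<sigma> ` A) \<and> h (\<sigma> ` A) \<le> exp b * h A)"

lemma weight_nonneg: "weight h \<Longrightarrow> A \<in> K \<Longrightarrow> 0 \<le> h A"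
  and weight_additive: "weight h \<Longrightarrow> additive_on X h"
  by (auto simp: weight_def)

lemma weight_shift:
  assumes "weight h" "A \<in> K" "inj_on \<sigma> A" "\<And>x. x \<in> A \<Longrightarrow> a \<le> \<phi> x" "\<And>x. x \<in> A \<Longrightarrow> \<phi> x \<le> b"
  shows "exp a * h A \<le> h (\<sigma> ` A)" "h (\<sigma> ` A) \<le> exp b * h A"
proof -
  have "\<forall>x\<in>A. a \<le> \<phi> x \<and> \<phi> x \<le> b" using assms(4,5) by blast
  then show "exp a * h A \<le> h (\<sigma> ` A)" "h (\<sigma> ` A) \<le> exp b * h A"
    using assms(1-3) unfolding weight_def by blast+
qed

lemma weight_additive_on: "weight h \<Longrightarrow> A \<in> K \<Longrightarrow> additive_on A h"
  using additive_on_mono weight_additive K_subset by blast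

lemma weight_mono:
  assumes "weight h" "A \<in> K" "B \<in> K" "A \<subseteq> B" shows "h A \<le> h B"
proof -
  have "h (A \<union> (B - A)) = h A + h (B - A)"
    using weight_additive[OF assms(1), unfolded additive_on_def, rule_format, of A "B - A"]
      K_Diff[OF assms(3,2)] assms(2) K_subset[OF assms(2)] K_subset[OF assms(3)] by auto
  moreover have "A \<union> (B - A) = B" using assms(4) by blast
  moreover have "0 \<le> h (B - A)" using assms by (auto intro: weight_nonneg)
  ultimately show ?thesis by simp
qed

lemma weight_UN:
  assumes "weight h" "finite I" "disjoint_family_on C I" "\<And>i. i \<in> I \<Longrightarrow> C i \<in> K"
  shows "h (\<Union>i\<in>I. C i) = (\<Sum>i\<in>I. h (C i))"
  using additive_on_UN[OF weight_additive[OF assms(1)] assms(2,3)] assms(4) K_subset by blast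

text \<open>Chaining the one-step bounds directly would lose the oscillation of \<phi> at every
  step. On a small piece the value of \<phi> is known up to \<eta>, the remaining Birkhoff sum is
  then known up to \<eta> as well, and the resulting factor exp(2\<eta>) disappears under
  refinement.\<close>

lemma weight_nstep:
  assumes "weight h" "A \<in> K" "inj_on (\<sigma> ^^ n) A"
    and "\<And>x. x \<in> A \<Longrightarrow> a \<le> birkhoff \<phi> n x" "\<And>x. x \<in> A \<Longrightarrow> birkhoff \<phi> n x \<le> b"
  shows "exp a * h A \<le> h ((\<sigma> ^^ n) ` A) \<and> h ((\<sigma> ^^ n) ` A) \<le> exp b * h A"
  using assms(2-)
proof (induction n arbitrary: A a b)
  case 0
  show ?case
  proof (cases "A = {}")
    case True
    then show ?thesis using additive_on_empty[OF weight_additive[OF assms(1)]] by simp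
  next
    case False
    then have "a \<le> 0" "0 \<le> b" using 0 by auto
    then show ?thesis using weight_nonneg[OF assms(1) 0(1)]
      by (simp add: mult_left_le_one_le mult_le_cancel_right1)
  qed
next
  case (Suc n)
  have img: "(\<sigma> ^^ Suc n) ` B = (\<sigma> ^^ n) ` \<sigma> ` B" for B
    by (simp add: funpow_Suc_right image_comp del: funpow.simps)
  have inj1: "inj_on \<sigma> A" and inj2: "inj_on (\<sigma> ^^ n) (\<sigma> ` A)"
    using Suc.prems(2) unfolding funpow_Suc_right by (rule inj_on_imageI2, rule inj_on_imageI)
  have pos: "0 \<le> h B" if "B \<in> K" for B using weight_nonneg[OF assms(1) that] .
  have key: "exp a * h B \<le> exp (2 * \<eta>) * h ((\<sigma> ^^ Suc n) ` B) \<and>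
      h ((\<sigma> ^^ Suc n) ` B) \<le> exp (2 * \<eta>) * (exp b * h B)"
    if \<eta>: "\<eta> > 0" and B: "B \<in> K" "B \<subseteq> A" "B \<noteq> {}"
      and o: "\<And>x y. x \<in> B \<Longrightarrow> y \<in> B \<Longrightarrow> \<bar>\<phi> x - \<phi> y\<bar> \<le> \<eta>" for \<eta> B
  proof -
    obtain x0 where x0: "x0 \<in> B" using B by blast
    define c where "c = \<phi> x0"
    have phiB: "c - \<eta> \<le> \<phi> x" "\<phi> x \<le> c + \<eta>" if "x \<in> B" for x
      using o[OF that x0] by (auto simp: c_def)
    have "exp (c - \<eta>) * h B \<le> h (\<sigma> ` B)" and up1: "h (\<sigma> ` B) \<le> exp (c + \<eta>) * h B"
      using weight_shift[OF assms(1) B(1) inj_on_subset[OF inj1 B(2)] phiB] by auto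
    note low1 = this(1)
    have bb: "a - (c + \<eta>) \<le> birkhoff \<phi> n y" "birkhoff \<phi> n y \<le> b - (c - \<eta>)" if "y \<in> \<sigma> ` B" for y
    proof -
      obtain x where x: "x \<in> B" "y = \<sigma> x" using \<open>y \<in> \<sigma> ` B\<close> by blast
      have "a \<le> \<phi> x + birkhoff \<phi> n y" "\<phi> x + birkhoff \<phi> n y \<le> b"
        using Suc.prems(3,4)[of x] x B(2) by (auto simp: birkhoff_Suc)
      then show "a - (c + \<eta>) \<le> birkhoff \<phi> n y" "birkhoff \<phi> n y \<le> b - (c - \<eta>)"
        using phiB[OF x(1)] by linarith+
    qed
    have IH: "exp (a - (c + \<eta>)) * h (\<sigma> ` B) \<le> h ((\<sigma> ^^ n) ` \<sigma> ` B) \<and>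
        h ((\<sigma> ^^ n) ` \<sigma> ` B) \<le> exp (b - (c - \<eta>)) * h (\<sigma> ` B)"
      by (rule Suc.IH[OF shift_K[OF B(1)] inj_on_subset[OF inj2] bb]) (use B(2) in auto)
    have "exp (b - (c - \<eta>)) * h (\<sigma> ` B) \<le> exp (b - (c - \<eta>)) * (exp (c + \<eta>) * h B)"
      using up1 by simp
    also have "\<dots> = exp (2 * \<eta>) * (exp b * h B)"
      by (simp add: mult.assoc[symmetric] exp_add[symmetric])
    finally have 1: "h ((\<sigma> ^^ Suc n) ` B) \<le> exp (2 * \<eta>) * (exp b * h B)" using IH img by simp
    have "exp (a - 2 * \<eta>) * h B = exp (a - (c + \<eta>)) * (exp (c - \<eta>) * h B)"
      by (simp add: mult.assoc[symmetric] exp_add[symmetric])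
    also have "\<dots> \<le> exp (a - (c + \<eta>)) * h (\<sigma> ` B)" using low1 by simp
    finally have "exp (a - 2 * \<eta>) * h B \<le> h ((\<sigma> ^^ Suc n) ` B)" using IH img by simp
    then have "exp (2 * \<eta>) * (exp (a - 2 * \<eta>) * h B) \<le> exp (2 * \<eta>) * h ((\<sigma> ^^ Suc n) ` B)" by simp
    moreover have "exp (2 * \<eta>) * (exp (a - 2 * \<eta>) * h B) = exp a * h B"
      by (simp add: mult.assoc[symmetric] exp_add[symmetric])
    ultimately show ?thesis using 1 by simp
  qed
  have addh: "additive_on A h" by (rule weight_additive_on[OF assms(1) Suc.prems(1)])
  have adds: "additive_on A (\<lambda>B. h ((\<sigma> ^^ Suc n) ` B))"
    by (rule additive_on_shift[OF weight_additive[OF assms(1)] Suc.prems(2)])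
  have "exp a * h A \<le> h ((\<sigma> ^^ Suc n) ` A)"
    by (rule refine_le[OF Suc.prems(1) additive_on_mult[OF addh] adds adds])
      (use key in \<open>auto simp: algebra_simps\<close>)
  moreover have "h ((\<sigma> ^^ Suc n) ` A) \<le> exp b * h A"
    by (rule refine_le[OF Suc.prems(1) adds additive_on_mult[OF addh] additive_on_mult[OF addh, of "exp b"]])
      (use key in \<open>auto simp: algebra_simps\<close>)
  ultimately show ?case by blast
qed

text \<open>The bounds for \<open>h\<close> and \<open>h'\<close> with fixed \<open>a\<close> and
  \<open>b\<close> cannot be subtracted. On a small piece both weights are multiplied by nearly the
  same factor exp(\<phi>), so the difference is multiplied by that factor too, up to an error that
  refinement removes.\<close>

lemma weight_diff:
  assumes h: "weight h" and h': "weight h'" and t: "t \<ge> 0" "\<And>A. A \<in> K \<Longrightarrow> t * h' A \<le> h A"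
  shows "weight (\<lambda>A. h A - t * h' A)"
proof -
  let ?D = "\<lambda>A. h A - t * h' A"
  have addD: "additive_on X ?D"
    by (intro additive_on_diff additive_on_mult weight_additive h h')
  have "exp a * ?D A \<le> ?D (\<sigma> ` A) \<and> ?D (\<sigma> ` A) \<le> exp b * ?D A"
    if A: "A \<in> K" and inj: "inj_on \<sigma> A" and ab: "\<forall>x\<in>A. a \<le> \<phi> x \<and> \<phi> x \<le> b" for A a b
  proof -
    have addDA: "additive_on A ?D" using additive_on_mono[OF addD K_subset[OF A]] .
    have addh: "additive_on A h" "additive_on A h'" using h h' A by (auto intro: weight_additive_on)
    have adds: "additive_on A (\<lambda>B. ?D (\<sigma> ` B))"
      using additive_on_shift[of ?D 1 A] addD inj by simp
    \<comment> \<open>The error is proportional to \<open>h\<close> and \<open>t * h'\<close>,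
      possibly much larger than their difference; therefore it is measured by these functions and
      not by \<open>?D\<close> alone.\<close>
    have key: "exp a * ?D B \<le> ?D (\<sigma> ` B) + (exp (2*\<eta>) - 1) * (exp a * ?D B + exp b * (t * h' B)) \<and>
        ?D (\<sigma> ` B) \<le> exp b * ?D B + (exp (2*\<eta>) - 1) * (exp b * h B)"
      if \<eta>: "\<eta> > 0" and B: "B \<in> K" "B \<subseteq> A" "B \<noteq> {}"
        and o: "\<And>x y. x \<in> B \<Longrightarrow> y \<in> B \<Longrightarrow> \<bar>\<phi> x - \<phi> y\<bar> \<le> \<eta>" for \<eta> B
    proof -
      obtain x0 where x0: "x0 \<in> B" using B by blast
      define c where "c = exp (\<phi> x0)"
      define s where "s = exp \<eta>"
      have c: "c > 0" "exp a \<le> c" "c \<le> exp b" using ab x0 B(2) by (auto simp: c_def)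
      have s: "s \<ge> 1" "exp (2*\<eta>) = s * s" using \<eta> by (auto simp: s_def simp flip: exp_add)
      have e: "exp (\<phi> x0 - \<eta>) = c / s" "exp (\<phi> x0 + \<eta>) = c * s"
        by (auto simp: c_def s_def exp_diff exp_add)
      have phiB: "\<phi> x0 - \<eta> \<le> \<phi> x" "\<phi> x \<le> \<phi> x0 + \<eta>" if "x \<in> B" for x
        using o[OF that x0] by auto
      note w = weight_shift[OF h B(1) inj_on_subset[OF inj B(2)] phiB]
        weight_shift[OF h' B(1) inj_on_subset[OF inj B(2)] phiB]
      have w1: "c / s * h B \<le> h (\<sigma> ` B)" "h (\<sigma> ` B) \<le> c * s * h B" and
        w2: "c / s * h' B \<le> h' (\<sigma> ` B)" "h' (\<sigma> ` B) \<le> c * s * h' B"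
        using w unfolding e by auto
      define u where "u = t * h' B"
      define d where "d = ?D B"
      have hB: "h B = d + u" by (simp add: d_def u_def)
      have u0: "u \<ge> 0" using weight_nonneg[OF h' B(1)] t by (simp add: u_def)
      have d0: "d \<ge> 0" using t(2)[OF B(1)] by (simp add: d_def)
      have w3: "c / s * u \<le> t * h' (\<sigma> ` B)" "t * h' (\<sigma> ` B) \<le> c * s * u"
        using mult_left_mono[OF w2(1) t(1)] mult_left_mono[OF w2(2) t(1)]
        by (simp_all add: u_def algebra_simps)
      have eb: "exp b > 0" "exp a > 0" by auto
      have "?D (\<sigma> ` B) \<le> c * s * (d + u) - c / s * u" using w1(2) w3(1) hB by simp
      also have "\<dots> = c * (s * d + (s - 1/s) * u)" using s by (simp add: field_simps)
      also have "\<dots> \<le> exp b * (s * d + (s - 1/s) * u)"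
      proof (rule mult_right_mono[OF c(3)])
        have "1/s \<le> 1" using s(1) by simp
        then have "1/s \<le> s" using s(1) by linarith
        then show "0 \<le> s * d + (s - 1/s) * u" using s d0 u0 by simp
      qed
      also have "\<dots> \<le> exp b * ((1 + (s * s - 1)) * d + (s * s - 1) * u)"
        using exp_refine_bounds[OF s(1)] d0 u0 by (intro mult_left_mono add_mono mult_right_mono) auto
      also have "\<dots> = exp b * d + (s * s - 1) * (exp b * (d + u))" by (simp add: algebra_simps)
      finally have up: "?D (\<sigma> ` B) \<le> exp b * d + (s * s - 1) * (exp b * h B)" using hB by simp
      have "exp a * d = exp a * (1 - 1/s) * d + exp a * (1/s) * d" by (simp add: algebra_simps)
      also have "\<dots> \<le> exp a * (s * s - 1) * d + c * (1/s) * d"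
        using exp_refine_bounds[OF s(1)] d0 c(2) s(1) by (intro add_mono mult_right_mono mult_left_mono) auto
      also have "c * (1/s) * d = (c / s * (d + u) - c * s * u) + c * (s - 1/s) * u"
        using s by (simp add: field_simps)
      also have "\<dots> \<le> ?D (\<sigma> ` B) + exp b * (s * s - 1) * u"
      proof (rule add_mono)
        show "c / s * (d + u) - c * s * u \<le> ?D (\<sigma> ` B)" using w1(1) w3(2) hB by simp
        show "c * (s - 1/s) * u \<le> exp b * (s * s - 1) * u"
        proof (intro mult_right_mono mult_mono)
          show "0 \<le> s - 1/s" using s(1) by (simp add: divide_le_eq) (use exp_refine_bounds(1)[OF s(1)] in linarith)
        qed (use exp_refine_bounds[OF s(1)] c u0 in auto)
      qed
      finally have low: "exp a * d \<le> ?D (\<sigma> ` B) + (s * s - 1) * (exp a * d + exp b * u)"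
        by (simp add: algebra_simps)
      show ?thesis using up low unfolding s(2) d_def u_def by simp
    qed
    have "exp a * ?D A \<le> ?D (\<sigma> ` A)"
      by (rule refine_le[OF A additive_on_mult[OF addDA] adds
            additive_on_add[OF additive_on_mult[OF addDA, of "exp a"]
              additive_on_mult[OF additive_on_mult[OF addh(2), of t], of "exp b"]]])
        (use key in blast)
    moreover have "?D (\<sigma> ` A) \<le> exp b * ?D A"
      by (rule refine_le[OF A adds additive_on_mult[OF addDA] additive_on_mult[OF addh(1), of "exp b"]])
        (use key in blast)
    ultimately show ?thesis by blast
  qed
  then show ?thesis using addD t(2) unfolding weight_def by auto
qed

lemma weight_Z: assumes "weight h" "v \<in> verts G" shows "h (Z v) = (\<Sum>e\<in>out_arcs G v. h (E e))"
  unfolding Z_Union_E using finite_out[OF assms(2)] disjoint_E by (intro weight_UN[OF assms(1)]) auto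

lemma weight_edge_bounds:
  assumes "weight h" "e \<in> arcs G"
  obtains a b where "a > 0" "b > 0" "a * h (E e) \<le> h (Z (head G e))" "h (Z (head G e)) \<le> b * h (E e)"
proof -
  obtain B where B: "\<And>x. x \<in> E e \<Longrightarrow> \<bar>\<phi> x\<bar> \<le> B" using phi_bounded[OF E_K] by blast
  have "- B \<le> \<phi> x" "\<phi> x \<le> B" if "x \<in> E e" for x using B[OF that] by auto
  then have "exp (- B) * h (E e) \<le> h (\<sigma> ` E e)" "h (\<sigma> ` E e) \<le> exp B * h (E e)"
    using weight_shift[OF assms(1) E_K inj_on_shift_E] by blast+
  then show thesis using that[of "exp (- B)" "exp B"] shift_E[OF assms(2)] by simp
qed

lemma weight_K_le_Z:
  assumes "weight h" "A \<in> K" shows "h A \<le> (\<Sum>v\<in>(\<lambda>x. tail G (x 0)) ` A. h (Z v))"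
proof -
  let ?F = "(\<lambda>x. tail G (x 0)) ` A"
  have "(\<Union>v\<in>?F. Z v) \<in> K" using K_finite[OF assms(2)] by (rule K_UNION) simp
  moreover have "A \<subseteq> (\<Union>v\<in>?F. Z v)" using K_subset[OF assms(2)] by (auto simp: Z_def)
  ultimately have "h A \<le> h (\<Union>v\<in>?F. Z v)" by (rule weight_mono[OF assms])
  also have "\<dots> = (\<Sum>v\<in>?F. h (Z v))"
    using K_finite[OF assms(2)] disjoint_Z by (intro weight_UN[OF assms(1)]) auto
  finally show ?thesis .
qed

text \<open>The vertices \<open>u\<close> with \<open>h (Z u) = 0\<close> form a hereditary and
  saturated set, since \<open>h (E e)\<close> and \<open>h (Z (head G e))\<close> bound each other
  up to constants. One such vertex would make all of them null, and with them
  \<open>A\<close>.\<close>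

lemma weight_Z_pos:
  assumes h: "weight h" and A: "A \<in> K" "h A \<noteq> 0" and v: "v \<in> verts G"
  shows "h (Z v) > 0"
proof (rule ccontr)
  assume "\<not> h (Z v) > 0"
  then have v0: "h (Z v) = 0" using weight_nonneg[OF h, of "Z v"] by auto
  let ?S = "{u. h (Z u) = 0}"
  have "verts G \<subseteq> ?S"
  proof (rule cofinal_induct[OF v _ order_refl])
    show "v \<in> ?S" using v0 by simp
    show "head G e \<in> ?S" if e: "e \<in> arcs G" "tail G e \<in> ?S" for e
    proof -
      have "h (E e) \<le> h (Z (tail G e))"
        by (rule weight_mono[OF h E_K Z_K]) (auto simp: E_def Z_def)
      then have "h (E e) = 0" using e(2) weight_nonneg[OF h E_K[of e]] by auto
      moreover obtain b where "h (Z (head G e)) \<le> b * h (E e)"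
        using weight_edge_bounds[OF h e(1)] by blast
      ultimately show ?thesis using weight_nonneg[OF h Z_K[of "head G e"]] by simp
    qed
    show "u \<in> ?S" if u: "u \<in> verts G" "\<And>e. e \<in> out_arcs G u \<Longrightarrow> head G e \<in> ?S" for u
    proof -
      have "h (E e) = 0" if e: "e \<in> out_arcs G u" for e
      proof -
        have ea: "e \<in> arcs G" using e by simp
        obtain a where "a > 0" "a * h (E e) \<le> h (Z (head G e))"
          using weight_edge_bounds[OF h ea] by blast
        then show ?thesis using u(2)[OF e] weight_nonneg[OF h E_K[of e]]
          by (simp add: mult_le_0_iff)
      qed
      then show ?thesis using weight_Z[OF h u(1)] by simp
    qed
  qed
  then have "(\<Sum>v\<in>(\<lambda>x. tail G (x 0)) ` A. h (Z v)) = 0"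
    using K_verts[OF A(1)] by (intro sum.neutral) auto
  then show False using weight_K_le_Z[OF h A(1)] weight_nonneg[OF h A(1)] A(2) by simp
qed

lemma birkhoff_bounded:
  assumes "A \<in> K" shows "\<exists>B. \<forall>x\<in>A. \<bar>birkhoff \<phi> n x\<bar> \<le> B"
  using assms
proof (induction n arbitrary: A)
  case (Suc n)
  obtain B where B: "\<forall>x\<in>\<sigma> ` A. \<bar>birkhoff \<phi> n x\<bar> \<le> B" using Suc.IH[OF shift_K[OF Suc.prems]] by blast
  obtain C where C: "\<And>x. x \<in> A \<Longrightarrow> \<bar>\<phi> x\<bar> \<le> C" using phi_bounded[OF Suc.prems] by blast
  have "\<forall>x\<in>A. \<bar>birkhoff \<phi> (Suc n) x\<bar> \<le> C + B"
    using B C by (fastforce simp: birkhoff_Suc)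
  then show ?case by blast
qed auto

text \<open>Full support: the n-fold shift carries the cylinder onto some \<open>Z u\<close> and
  distorts \<open>h\<close> by a bounded factor.\<close>

lemma weight_cyl_pos:
  assumes h: "weight h" and A: "A \<in> K" "h A \<noteq> 0" and x: "x \<in> X" "n > 0"
  shows "h (cyl n x) > 0"
proof -
  obtain B where B: "\<forall>y\<in>cyl n x. \<bar>birkhoff \<phi> n y\<bar> \<le> B" using birkhoff_bounded cyl_K[OF x(2)] by blast
  have img: "(\<sigma> ^^ n) ` cyl n x = Z (tail G (x n))"
    using shift_funpow_cyl[OF x(1), of n 0] x(2) by (auto simp: cyl_def Z_def)
  have "- B \<le> birkhoff \<phi> n y" "birkhoff \<phi> n y \<le> B" if "y \<in> cyl n x" for y using B that by fastforce+
  then have "h (Z (tail G (x n))) \<le> exp B * h (cyl n x)"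
    using weight_nstep[OF h cyl_K[OF x(2)], of n x "- B" B] inj_on_shift_cyl[of n 0 x] img by auto
  moreover have "h (Z (tail G (x n))) > 0" using weight_Z_pos[OF h A] X_tail_verts[OF x(1)] by blast
  ultimately show ?thesis by (smt (verit) exp_gt_zero mult_nonneg_nonpos)
qed

subsection \<open>Weights and conformal measures\<close>

lemma ring_of_sets_K: "ring_of_sets X K"
  by (rule ring_of_setsI) (use K_subset in auto)

text \<open>Every open set is a union of members of \<open>K\<close>, and the union is countable
  because \<open>K\<close> is.\<close>

lemma sigma_sets_K: "sigma_sets X K = sigma_sets X {U. openin T U}"
proof
  have "K \<subseteq> {U. openin T U}" using K_openin by blast
  then show "sigma_sets X K \<subseteq> sigma_sets X {U. openin T U}" by (rule sigma_sets_mono')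
  have "U \<in> sigma_sets X K" if "openin T U" for U
  proof -
    have "countable {A\<in>K. A \<subseteq> U}" using countable_K by (rule countable_subset[rotated]) blast
    then have "\<Union>{A\<in>K. A \<subseteq> U} \<in> sigma_sets X K" by (rule sigma_sets_UNION) (auto intro: sigma_sets.Basic)
    then show ?thesis using openin_Union_K[OF that] by simp
  qed
  then show "sigma_sets X {U. openin T U} \<subseteq> sigma_sets X K" by (intro sigma_sets_mono) auto
qed

definition borel_path :: "(nat \<Rightarrow> 'b) measure \<Rightarrow> bool" where
  "borel_path m \<longleftrightarrow> sets m = sigma_sets X K"

lemma sets_sigma_T: "sets (sigma (topspace T) {U. openin T U}) = sigma_sets X K"
  using openin_subset[of T] by (subst sets_measure_of) (auto simp: sigma_sets_K)

lemma borel_path_K: "borel_path m \<Longrightarrow> A \<in> K \<Longrightarrow> A \<in> sets m"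
  unfolding borel_path_def by (simp add: sigma_sets.Basic)

lemma borel_path_space: assumes "borel_path m" shows "space m = X"
proof -
  have "sets m = sets (sigma X K)" using assms K_subset by (subst sets_measure_of) (auto simp: borel_path_def)
  then show ?thesis using sets_eq_imp_space_eq by (metis space_measure_of_conv)
qed

lemma borel_path_openin: "borel_path m \<Longrightarrow> openin T U \<Longrightarrow> U \<in> sets m"
  unfolding borel_path_def sigma_sets_K by (simp add: sigma_sets.Basic)

lemma phi_measurable [measurable]: assumes "borel_path m" shows "\<phi> \<in> borel_measurable m"
proof (rule borel_measurableI)
  fix S :: "real set" assume S: "open S"
  have "openin T (\<phi> -` S \<inter> X)"
    unfolding openin_T_iff
  proof (intro conjI ballI)
    fix x assume x: "x \<in> \<phi> -` S \<inter> X"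
    then obtain \<epsilon> where e: "\<epsilon> > 0" "ball (\<phi> x) \<epsilon> \<subseteq> S" using S open_contains_ball[of S] by blast
    obtain N where N: "\<forall>x\<in>X. \<forall>y\<in>X. (\<forall>i<N. x i = y i) \<longrightarrow> \<bar>\<phi> x - \<phi> y\<bar> \<le> \<epsilon>/2"
      using osc[of "\<epsilon>/2"] e(1) by auto
    have "cyl N x \<subseteq> \<phi> -` S \<inter> X"
    proof
      fix y assume y: "y \<in> cyl N x"
      then have "\<bar>\<phi> x - \<phi> y\<bar> \<le> \<epsilon>/2" using N x by (auto simp: cyl_def)
      then have "\<phi> y \<in> ball (\<phi> x) \<epsilon>" using e(1) by (simp add: dist_real_def)
      then show "y \<in> \<phi> -` S \<inter> X" using e(2) y by (auto simp: cyl_def)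
    qed
    then show "\<exists>n. cyl n x \<subseteq> \<phi> -` S \<inter> X" ..
  qed blast
  then show "\<phi> -` S \<inter> space m \<in> sets m"
    using borel_path_openin[OF assms] borel_path_space[OF assms] by simp
qed

section \<open>From conformal measures to weights\<close>

lemma conformal_borel_path: "conformal_measure G \<phi> m \<Longrightarrow> borel_path m"
  unfolding conformal_measure_def regular_borel_measure_def borel_path_def using sets_sigma_T by simp

lemma conformal_finite_K:
  assumes "conformal_measure G \<phi> m" "A \<in> K" shows "emeasure m A = ennreal (measure m A)"
proof -
  have "emeasure m A < \<infinity>"
    using assms compactin_K unfolding conformal_measure_def regular_borel_measure_def by blast
  then show ?thesis by (simp add: emeasure_eq_ennreal_measure)
qed

lemma conformal_weight:
  assumes m: "conformal_measure G \<phi> m" shows "weight (measure m)"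
  unfolding weight_def
proof (intro conjI ballI allI impI)
  have b: "borel_path m" by (rule conformal_borel_path[OF m])
  show "additive_on X (measure m)"
    unfolding additive_on_def
  proof (intro ballI impI)
    fix B C assume "B \<in> K" "C \<in> K" "B \<inter> C = {}"
    then show "measure m (B \<union> C) = measure m B + measure m C"
      using conformal_finite_K[OF m] borel_path_K[OF b] by (intro measure_Union) auto
  qed
  fix A a b' assume A: "A \<in> K" and inj: "inj_on \<sigma> A" and ab: "\<forall>x\<in>A. a \<le> \<phi> x \<and> \<phi> x \<le> b'"
  have AS: "A \<in> sets m" using borel_path_K[OF b A] .
  have phi [measurable]: "\<phi> \<in> borel_measurable m" by (rule phi_measurable[OF b])
  have eq: "emeasure m (\<sigma> ` A) = (\<integral>\<^sup>+ x \<in> A. ennreal (exp (\<phi> x)) \<partial>m)"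
    using m AS inj unfolding conformal_measure_def by blast
  have "ennreal (exp a * measure m A) = (\<integral>\<^sup>+ x \<in> A. ennreal (exp a) \<partial>m)"
    using AS conformal_finite_K[OF m A] by (simp add: nn_integral_cmult ennreal_mult)
  also have "\<dots> \<le> (\<integral>\<^sup>+ x \<in> A. ennreal (exp (\<phi> x)) \<partial>m)"
    using ab by (intro nn_integral_mono) (auto simp: indicator_def)
  also have "\<dots> = ennreal (measure m (\<sigma> ` A))"
    using eq conformal_finite_K[OF m shift_K[OF A]] by simp
  finally show "exp a * measure m A \<le> measure m (\<sigma> ` A)" by (simp add: ennreal_le_iff)
  have "ennreal (measure m (\<sigma> ` A)) = (\<integral>\<^sup>+ x \<in> A. ennreal (exp (\<phi> x)) \<partial>m)"
    using eq conformal_finite_K[OF m shift_K[OF A]] by simp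
  also have "\<dots> \<le> (\<integral>\<^sup>+ x \<in> A. ennreal (exp b') \<partial>m)"
    using ab by (intro nn_integral_mono) (auto simp: indicator_def)
  also have "\<dots> = ennreal (exp b' * measure m A)"
    using AS conformal_finite_K[OF m A] by (simp add: nn_integral_cmult ennreal_mult)
  finally show "measure m (\<sigma> ` A) \<le> exp b' * measure m A" by (simp add: ennreal_le_iff)
qed simp

lemma borel_path_eqI:
  assumes "borel_path m" "borel_path m'"
    and eq: "\<And>A. A \<in> K \<Longrightarrow> emeasure m A = emeasure m' A"
    and fin: "\<And>A. A \<in> K \<Longrightarrow> emeasure m A \<noteq> \<infinity>"
  shows "m = m'"
proof -
  define f where "f = from_nat_into (verts G)"
  have f: "verts G = range f"
    unfolding f_def using verts_nonempty countable_verts by (simp add: range_from_nat_into)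
  show ?thesis
  proof (rule measure_eqI_generator_eq)
    show "Int_stable K" by (auto simp: Int_stable_def)
    show "K \<subseteq> Pow X" using K_subset by blast
    show "sets m = sigma_sets X K" "sets m' = sigma_sets X K" using assms by (auto simp: borel_path_def)
    show "range (\<lambda>n. Z (f n)) \<subseteq> K" by auto
    show "(\<Union>n. Z (f n)) = X" using X_Union_Z f by auto
    show "emeasure m (Z (f n)) \<noteq> \<infinity>" for n using fin by auto
  qed (rule eq)
qed

lemma conformal_nonzero_K:
  assumes m: "conformal_measure G \<phi> m" shows "\<exists>A\<in>K. measure m A \<noteq> 0"
proof (rule ccontr)
  assume "\<not> ?thesis"
  then have zero: "measure m A = 0" if "A \<in> K" for A using that by blast
  have b: "borel_path m" by (rule conformal_borel_path[OF m])
  have "(\<Union>v\<in>verts G. Z v) \<in> null_sets m"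
  proof (rule null_sets_UN'[OF countable_verts])
    fix v
    show "Z v \<in> null_sets m"
      using conformal_finite_K[OF m, of "Z v"] zero[of "Z v"] borel_path_K[OF b] by (simp add: null_sets_def)
  qed
  then show False
    using m borel_path_space[OF b] X_Union_Z unfolding conformal_measure_def null_sets_def by simp
qed

lemma proportional_measures:
  assumes m: "conformal_measure G \<phi> m" and m': "conformal_measure G \<phi> m'" and "c > 0"
    and eq: "\<And>A. A \<in> K \<Longrightarrow> measure m' A = c * measure m A"
  shows "m' = scale_measure (ennreal c) m"
proof (rule borel_path_eqI)
  show "borel_path m'" by (rule conformal_borel_path[OF m'])
  show "borel_path (scale_measure (ennreal c) m)"
    using conformal_borel_path[OF m] by (simp add: borel_path_def)
  fix A assume A: "A \<in> K"
  show "emeasure m' A = emeasure (scale_measure (ennreal c) m) A"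
    using conformal_finite_K[OF m A] conformal_finite_K[OF m' A] eq[OF A] \<open>c > 0\<close>
    by (simp add: ennreal_mult)
  show "emeasure m' A \<noteq> \<infinity>" using conformal_finite_K[OF m' A] by simp
qed

section \<open>From weights to conformal measures: extension, regularity, conformality\<close>

text \<open>A compact set that is a disjoint union of open sets has only finitely many non-empty
  summands, so finite additivity is already countable additivity.\<close>

lemma weight_countably_additive:
  assumes h: "weight h"
  shows "countably_additive K (\<lambda>A. ennreal (h A))"
  unfolding countably_additive_def
proof (intro allI impI)
  fix A :: "nat \<Rightarrow> (nat \<Rightarrow> 'b) set"
  assume A: "range A \<subseteq> K" "disjoint_family A" "(\<Union>i. A i) \<in> K"
  have AK: "A i \<in> K" for i using A(1) by blast
  have "compactin T (\<Union>i. A i)" by (rule compactin_K[OF A(3)])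
  moreover have "\<forall>U\<in>range A. openin T U" using AK K_openin by blast
  ultimately obtain \<F> where "finite \<F>" "\<F> \<subseteq> range A" "(\<Union>i. A i) \<subseteq> \<Union>\<F>"
    unfolding compactin_def by (meson subset_refl)
  then obtain C where C: "finite C" "(\<Union>i. A i) \<subseteq> (\<Union>i\<in>C. A i)"
    by (metis finite_subset_image)
  obtain N where N: "C \<subseteq> {..<N}" using finite_nat_bounded[OF C(1)] by blast
  have empty: "A i = {}" if "i \<notin> {..<N}" for i
  proof -
    have "A i \<inter> A j = {}" if "j \<in> C" for j
    proof -
      have "i \<noteq> j" using N \<open>i \<notin> {..<N}\<close> that by auto
      then show ?thesis using A(2) by (simp add: disjoint_family_on_def)
    qed
    then show ?thesis using C(2) by blast
  qed
  have "(\<Union>i. A i) = (\<Union>i\<in>{..<N}. A i)" using C(2) N by auto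
  then have "h (\<Union>i. A i) = (\<Sum>i<N. h (A i))"
    using weight_UN[OF h, of "{..<N}" A] A AK by (simp add: disjoint_family_on_def)
  moreover have "(\<Sum>i. ennreal (h (A i))) = (\<Sum>i<N. ennreal (h (A i)))"
    using empty additive_on_empty[OF weight_additive[OF h]] by (intro suminf_finite) auto
  moreover have "\<dots> = ennreal (\<Sum>i<N. h (A i))"
    using weight_nonneg[OF h AK] by (intro sum_ennreal) auto
  ultimately show "(\<Sum>i. ennreal (h (A i))) = ennreal (h (\<Union>i. A i))" by simp
qed

text \<open>The Caratheodory construction is carried out explicitly in order to keep the outer
  measure formula for all Borel sets; outer regularity is read off from it.\<close>

lemma weight_measure:
  assumes h: "weight h"
  obtains m where "borel_path m" "\<And>A. A \<in> K \<Longrightarrow> emeasure m A = ennreal (h A)"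
    "\<And>A. A \<in> sets m \<Longrightarrow> emeasure m A = outer_measure K (\<lambda>A. ennreal (h A)) A"
proof -
  interpret R: ring_of_sets X K by (rule ring_of_sets_K)
  let ?f = "\<lambda>A. ennreal (h A)"
  let ?O = "outer_measure K ?f"
  have posf: "positive K ?f"
    using additive_on_empty[OF weight_additive[OF h]] by (simp add: positive_def)
  note ca = weight_countably_additive[OF h]
  have add: "additive K ?f" by (rule R.countably_additive_additive[OF posf ca])
  have inc: "increasing K ?f" by (rule R.additive_increasing[OF posf add])
  define L where "L = lambda_system X (Pow X) ?O"
  have mls: "measure_space X L ?O"
    unfolding L_def
    by (rule sigma_algebra.caratheodory_lemma[OF sigma_algebra_Pow R.outer_measure_space_outer_measure[OF posf inc]])
  then have sls: "sigma_algebra X L" by (simp add: measure_space_def)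
  have "K \<subseteq> L" unfolding L_def by (rule R.algebra_subset_lambda_system[OF posf inc add])
  then have "sigma_sets X K \<subseteq> L" by (rule sigma_algebra.sigma_sets_subset[OF sls])
  moreover have sK: "sigma_algebra X (sigma_sets X K)"
    by (rule sigma_algebra_sigma_sets) (use K_subset in blast)
  ultimately have ms: "measure_space X (sigma_sets X K) ?O" by (intro measure_down[OF mls])
  define m where "m = measure_of X (sigma_sets X K) ?O"
  have sm: "sets m = sigma_sets X K"
    unfolding m_def by (rule sigma_algebra.sets_measure_of_eq[OF sK])
  have em: "emeasure m A = ?O A" if "A \<in> sets m" for A
    using ms that unfolding sm unfolding m_def measure_space_def
    by (intro emeasure_measure_of_sigma) auto
  show thesis
  proof (rule that)
    show "borel_path m" using sm by (simp add: borel_path_def)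
    show "emeasure m A = ?f A" if "A \<in> K" for A
      using em[of A] R.outer_measure_agrees[OF posf ca that] that sm by (simp add: sigma_sets.Basic)
  qed (rule em)
qed

text \<open>Outer regularity: the covers in the outer measure consist of compact open sets, and
  their unions are open. Inner regularity: an open set is an increasing countable union of compact
  open sets.\<close>

lemma weight_regular:
  assumes h: "weight h" and m: "borel_path m" "\<And>A. A \<in> K \<Longrightarrow> emeasure m A = ennreal (h A)"
    "\<And>A. A \<in> sets m \<Longrightarrow> emeasure m A = outer_measure K (\<lambda>A. ennreal (h A)) A"
  shows "regular_borel_measure T m"
  unfolding regular_borel_measure_def
proof (intro conjI allI impI ballI)
  show "sets m = sets (sigma (topspace T) {U. openin T U})"
    using m(1) unfolding sets_sigma_T borel_path_def .
  show "emeasure m C < \<infinity>" if C: "compactin T C" for C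
  proof -
    obtain A where A: "A \<in> K" "C \<subseteq> A" using compactin_subset_K[OF C] by blast
    then have "emeasure m C \<le> emeasure m A" by (intro emeasure_mono borel_path_K[OF m(1)])
    also have "\<dots> < \<infinity>" using m(2)[OF A(1)] by simp
    finally show ?thesis .
  qed
  show "emeasure m A = (INF U \<in> {U. openin T U \<and> A \<subseteq> U}. emeasure m U)" if A: "A \<in> sets m" for A
  proof (rule antisym)
    show "emeasure m A \<le> (INF U \<in> {U. openin T U \<and> A \<subseteq> U}. emeasure m U)"
      using borel_path_openin[OF m(1)] by (intro INF_greatest emeasure_mono) auto
    show "(INF U \<in> {U. openin T U \<and> A \<subseteq> U}. emeasure m U) \<le> emeasure m A"
      unfolding m(3)[OF A] outer_measure_def
    proof (rule INF_greatest, elim CollectE conjE)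
      fix C :: "nat \<Rightarrow> (nat \<Rightarrow> 'b) set"
      assume C: "range C \<subseteq> K" "disjoint_family C" "A \<subseteq> (\<Union>i. C i)"
      have CK: "C i \<in> K" for i using C(1) by blast
      have "openin T (\<Union>i. C i)" using CK K_openin by blast
      then have "(INF U \<in> {U. openin T U \<and> A \<subseteq> U}. emeasure m U) \<le> emeasure m (\<Union>i. C i)"
        using C(3) by (intro INF_lower) auto
      also have "\<dots> \<le> (\<Sum>i. emeasure m (C i))"
        using borel_path_K[OF m(1) CK] by (intro emeasure_subadditive_countably) auto
      also have "\<dots> = (\<Sum>i. ennreal (h (C i)))" using m(2) CK by simp
      finally show "(INF U \<in> {U. openin T U \<and> A \<subseteq> U}. emeasure m U) \<le> (\<Sum>i. ennreal (h (C i)))" .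
    qed
  qed
  show "emeasure m U = (SUP C \<in> {C. compactin T C \<and> C \<subseteq> U}. emeasure m C)" if U: "openin T U" for U
  proof (rule antisym)
    show "(SUP C \<in> {C. compactin T C \<and> C \<subseteq> U}. emeasure m C) \<le> emeasure m U"
      using borel_path_openin[OF m(1) U] by (intro SUP_least emeasure_mono) auto
    let ?I = "{A\<in>K. A \<subseteq> U}"
    define g where "g = from_nat_into ?I"
    have "countable ?I" using countable_K by (rule countable_subset[rotated]) blast
    moreover have "{} \<in> ?I" by simp
    ultimately have g: "range g = ?I" unfolding g_def by (intro range_from_nat_into) auto
    define B where "B n = (\<Union>i\<in>{..n}. g i)" for n
    have BK: "B n \<in> K" "B n \<subseteq> U" for n using g by (auto simp: B_def intro!: K_UNION)
    have inc: "incseq B" by (auto simp: incseq_def B_def intro: order_trans)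
    have "(\<Union>n. B n) = \<Union>(range g)" by (auto simp: B_def)
    then have "(\<Union>n. B n) = U" using g openin_Union_K[OF U] by simp
    then have "emeasure m U = (SUP n. emeasure m (B n))"
      using SUP_emeasure_incseq[OF _ inc, of m] borel_path_K[OF m(1) BK(1)] by (auto simp: image_subset_iff)
    also have "\<dots> \<le> (SUP C \<in> {C. compactin T C \<and> C \<subseteq> U}. emeasure m C)"
      using BK compactin_K by (intro SUP_least SUP_upper) auto
    finally show "emeasure m U \<le> (SUP C \<in> {C. compactin T C \<and> C \<subseteq> U}. emeasure m C)" .
  qed
qed

lemma vimage_case_nat:
  assumes "A \<subseteq> X" "e \<in> arcs G"
  shows "case_nat e -` A \<inter> Z (head G e) = \<sigma> ` (A \<inter> E e)"
proof
  show "case_nat e -` A \<inter> Z (head G e) \<subseteq> \<sigma> ` (A \<inter> E e)"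
  proof
    fix x assume x: "x \<in> case_nat e -` A \<inter> Z (head G e)"
    then have "case_nat e x \<in> A \<inter> E e" using assms by (auto simp: E_def)
    then show "x \<in> \<sigma> ` (A \<inter> E e)" by (metis image_eqI path_shift_case_nat)
  qed
  show "\<sigma> ` (A \<inter> E e) \<subseteq> case_nat e -` A \<inter> Z (head G e)"
  proof
    fix y assume "y \<in> \<sigma> ` (A \<inter> E e)"
    then obtain x where x: "x \<in> A" "x \<in> E e" "y = \<sigma> x" by blast
    then have "case_nat e y = x" using case_nat_path_shift[of x] by (simp add: E_def)
    moreover have "y \<in> Z (head G e)" using x shift_E[OF assms(2)] by blast
    ultimately show "y \<in> case_nat e -` A \<inter> Z (head G e)" using x by simp
  qed
qed

text \<open>On \<open>E e\<close> the shift has the measurable inverse branch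
  \<open>case_nat e\<close>, which makes images measurable. Both sides of the conformality equation,
  as functions of \<open>A\<close>, are then measures, a push-forward and a density; it suffices
  that they agree on \<open>K\<close>, where refinement applies.\<close>

lemma weight_edge_conformal:
  assumes h: "weight h" and m: "borel_path m" "\<And>A. A \<in> K \<Longrightarrow> emeasure m A = ennreal (h A)"
    and e: "e \<in> arcs G" and A: "A \<in> sets m"
  shows "\<sigma> ` (A \<inter> E e) \<in> sets m"
    and "emeasure m (\<sigma> ` (A \<inter> E e)) = (\<integral>\<^sup>+x. ennreal (exp (\<phi> x)) * indicator (A \<inter> E e) x \<partial>m)"
proof -
  note spm = borel_path_space[OF m(1)]
  have sm: "sets m = sigma_sets X K" using m(1) by (simp add: borel_path_def)
  have sub: "B \<subseteq> X" if "B \<in> sets m" for B using sets.sets_into_space[OF that] spm by simp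
  have phi [measurable]: "\<phi> \<in> borel_measurable m" by (rule phi_measurable[OF m(1)])
  have Zm: "Z v \<in> sets m" for v using borel_path_K[OF m(1)] by simp
  have Em [measurable]: "E e \<in> sets m" using borel_path_K[OF m(1)] by simp
  let ?R = "restrict_space m (Z (head G e))"
  have spR: "space ?R = Z (head G e)" using Z_subset spm by (auto simp: space_restrict_space)
  have cm: "case_nat e \<in> measurable ?R m"
  proof (rule measurable_sigma_sets[OF sm])
    show "K \<subseteq> Pow X" using K_subset by blast
    show "case_nat e \<in> space ?R \<rightarrow> X"
      unfolding spR using e by (auto simp: Z_def intro: case_nat_X)
    fix B assume B: "B \<in> K"
    have "case_nat e -` B \<inter> space ?R = \<sigma> ` (B \<inter> E e)"
      using vimage_case_nat[OF K_subset[OF B] e] spR by simp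
    moreover have "\<sigma> ` (B \<inter> E e) \<in> K" using B by (intro shift_K K_Int) auto
    moreover have "\<sigma> ` (B \<inter> E e) \<subseteq> Z (head G e)" using shift_E[OF e] by blast
    ultimately show "case_nat e -` B \<inter> space ?R \<in> sets ?R"
      using Zm borel_path_K[OF m(1)] spm Z_subset by (subst sets_restrict_space_iff) (auto simp: Int_absorb2)
  qed
  define m1 where "m1 = distr ?R m (case_nat e)"
  define m2 where "m2 = density m (\<lambda>x. ennreal (exp (\<phi> x)) * indicator (E e) x)"
  have img: "case_nat e -` B \<inter> space ?R = \<sigma> ` (B \<inter> E e)" if "B \<in> sets m" for B
    using vimage_case_nat[OF sub[OF that] e] spR by simp
  have imgS: "\<sigma> ` (B \<inter> E e) \<in> sets m" if B: "B \<in> sets m" for B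
    using measurable_sets[OF cm B] img[OF B] Zm[of "head G e"] Z_subset spm
    by (subst (asm) sets_restrict_space_iff) (auto simp: Int_absorb2)
  have e1: "emeasure m1 B = emeasure m (\<sigma> ` (B \<inter> E e))" if B: "B \<in> sets m" for B
  proof -
    have "emeasure m1 B = emeasure ?R (\<sigma> ` (B \<inter> E e))"
      unfolding m1_def using B cm by (simp add: emeasure_distr img)
    also have "\<dots> = emeasure m (\<sigma> ` (B \<inter> E e))"
    proof (rule emeasure_restrict_space)
      show "Z (head G e) \<inter> space m \<in> sets m" using Zm by auto
      show "\<sigma> ` (B \<inter> E e) \<subseteq> Z (head G e)" using shift_E[OF e] by blast
    qed
    finally show ?thesis .
  qed
  have e2: "emeasure m2 B = (\<integral>\<^sup>+x. ennreal (exp (\<phi> x)) * indicator (B \<inter> E e) x \<partial>m)" if B: "B \<in> sets m" for B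
    unfolding m2_def using B
    by (subst emeasure_density) (auto intro!: nn_integral_cong simp: indicator_def)
  have "m1 = m2"
  proof (rule borel_path_eqI)
    show "borel_path m1" "borel_path m2" using m(1) by (auto simp: m1_def m2_def borel_path_def)
    fix A0 assume A0: "A0 \<in> K"
    show "emeasure m1 A0 \<noteq> \<infinity>"
      using e1[OF borel_path_K[OF m(1) A0]] m(2)[OF shift_K[OF K_Int[OF A0 E_K]]] by simp
    let ?A = "A0 \<inter> E e"
    have A: "?A \<in> K" using A0 by blast
    have inj: "inj_on \<sigma> ?A" using inj_on_subset[OF inj_on_shift_E] by blast
    \<comment> \<open>The integral as a real-valued set function, so that \<open>refine_le\<close>
      can compare it with \<open>h\<close> of the shifted set; it is finite because \<phi> is
      bounded on members of \<open>K\<close>.\<close>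
    define H where "H B = enn2real (\<integral>\<^sup>+x. ennreal (exp (\<phi> x)) * indicator B x \<partial>m)" for B
    have bnd: "(\<integral>\<^sup>+x. ennreal (exp (\<phi> x)) * indicator B x \<partial>m) \<le> ennreal (exp b * h B)"
      if B: "B \<in> K" and b: "\<And>x. x \<in> B \<Longrightarrow> \<phi> x \<le> b" for B b
    proof -
      have "(\<integral>\<^sup>+x. ennreal (exp (\<phi> x)) * indicator B x \<partial>m) \<le> (\<integral>\<^sup>+x. ennreal (exp b) * indicator B x \<partial>m)"
        using b by (intro nn_integral_mono) (auto simp: indicator_def)
      also have "\<dots> = ennreal (exp b * h B)"
        using borel_path_K[OF m(1) B] m(2)[OF B] weight_nonneg[OF h B]
        by (simp add: nn_integral_cmult ennreal_mult)
      finally show ?thesis .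
    qed
    have fin: "(\<integral>\<^sup>+x. ennreal (exp (\<phi> x)) * indicator B x \<partial>m) < \<infinity>" if B: "B \<in> K" for B
    proof -
      obtain b where "\<And>x. x \<in> B \<Longrightarrow> \<bar>\<phi> x\<bar> \<le> b" using phi_bounded[OF B] by blast
      then have "\<phi> x \<le> b" if "x \<in> B" for x using that by fastforce
      from bnd[OF B this] show ?thesis by (simp add: less_le_trans le_less_trans)
    qed
    have Heq: "(\<integral>\<^sup>+x. ennreal (exp (\<phi> x)) * indicator B x \<partial>m) = ennreal (H B)" if "B \<in> K" for B
      using fin[OF that] by (simp add: H_def)
    have H0: "0 \<le> H B" for B by (simp add: H_def)
    have Hle: "H B \<le> exp b * h B" if B: "B \<in> K" and b: "\<And>x. x \<in> B \<Longrightarrow> \<phi> x \<le> b" for B b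
      using bnd[OF B b] weight_nonneg[OF h B] unfolding Heq[OF B] by (simp add: ennreal_le_iff)
    have Hge: "exp a * h B \<le> H B" if B: "B \<in> K" and a: "\<And>x. x \<in> B \<Longrightarrow> a \<le> \<phi> x" for B a
    proof -
      have "ennreal (exp a * h B) = (\<integral>\<^sup>+x. ennreal (exp a) * indicator B x \<partial>m)"
        using borel_path_K[OF m(1) B] m(2)[OF B] weight_nonneg[OF h B]
        by (simp add: nn_integral_cmult ennreal_mult)
      also have "\<dots> \<le> ennreal (H B)"
        unfolding Heq[OF B, symmetric] using a by (intro nn_integral_mono) (auto simp: indicator_def)
      finally show ?thesis using H0 by (simp add: ennreal_le_iff)
    qed
    have addH: "additive_on ?A H"
      unfolding additive_on_def
    proof (intro ballI impI)
      fix B C assume BC: "B \<in> K" "C \<in> K" "B \<inter> C = {}"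
      have [measurable]: "B \<in> sets m" "C \<in> sets m" using BC borel_path_K[OF m(1)] by auto
      have "(\<integral>\<^sup>+x. ennreal (exp (\<phi> x)) * indicator (B \<union> C) x \<partial>m) =
          (\<integral>\<^sup>+x. ennreal (exp (\<phi> x)) * indicator B x + ennreal (exp (\<phi> x)) * indicator C x \<partial>m)"
        using BC(3) by (intro nn_integral_cong) (auto simp: indicator_def)
      also have "\<dots> = (\<integral>\<^sup>+x. ennreal (exp (\<phi> x)) * indicator B x \<partial>m) + (\<integral>\<^sup>+x. ennreal (exp (\<phi> x)) * indicator C x \<partial>m)"
        by (rule nn_integral_add) auto
      finally have "ennreal (H (B \<union> C)) = ennreal (H B + H C)"
        using Heq[OF BC(1)] Heq[OF BC(2)] Heq[OF K_Un[OF BC(1,2)]] H0 by simp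
      then show "H (B \<union> C) = H B + H C"
        by (rule iffD1[OF ennreal_inj[OF H0 add_nonneg_nonneg[OF H0 H0]]])
    qed
    have adds: "additive_on ?A (\<lambda>B. h (\<sigma> ` B))"
      using additive_on_shift[OF weight_additive[OF h], of 1 ?A] inj by simp
    \<comment> \<open>Both quantities lie between exp(c - \<eta>) and exp(c + \<eta>) times
      \<open>h B\<close>, so their ratio is at most exp(2\<eta>).\<close>
    have key: "h (\<sigma> ` B) \<le> exp (2 * \<eta>) * H B" "H B \<le> exp (2 * \<eta>) * h (\<sigma> ` B)"
      if \<eta>: "\<eta> > 0" and B: "B \<in> K" "B \<subseteq> ?A" "B \<noteq> {}"
        and o: "\<And>x y. x \<in> B \<Longrightarrow> y \<in> B \<Longrightarrow> \<bar>\<phi> x - \<phi> y\<bar> \<le> \<eta>" for \<eta> B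
    proof -
      obtain x0 where x0: "x0 \<in> B" using B by blast
      define c where "c = \<phi> x0"
      have phiB: "c - \<eta> \<le> \<phi> x" "\<phi> x \<le> c + \<eta>" if "x \<in> B" for x
        using o[OF that x0] by (auto simp: c_def)
      note w = weight_shift[OF h B(1) inj_on_subset[OF inj B(2)] phiB]
      have eq: "exp (c + \<eta>) = exp (2 * \<eta>) * exp (c - \<eta>)" by (simp flip: exp_add)
      have "h (\<sigma> ` B) \<le> exp (2 * \<eta>) * (exp (c - \<eta>) * h B)" using w(2) eq by simp
      also have "\<dots> \<le> exp (2 * \<eta>) * H B" using Hge[OF B(1) phiB(1)] by simp
      finally show "h (\<sigma> ` B) \<le> exp (2 * \<eta>) * H B" .
      have "H B \<le> exp (2 * \<eta>) * (exp (c - \<eta>) * h B)" using Hle[OF B(1) phiB(2)] eq by simp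
      also have "\<dots> \<le> exp (2 * \<eta>) * h (\<sigma> ` B)" using w(1) by simp
      finally show "H B \<le> exp (2 * \<eta>) * h (\<sigma> ` B)" .
    qed
    have "h (\<sigma> ` ?A) \<le> H ?A"
      by (rule refine_le[OF A adds addH addH]) (use key(1) in \<open>auto simp: algebra_simps\<close>)
    moreover have "H ?A \<le> h (\<sigma> ` ?A)"
      by (rule refine_le[OF A addH adds adds]) (use key(2) in \<open>auto simp: algebra_simps\<close>)
    ultimately have "h (\<sigma> ` ?A) = H ?A" by simp
    then show "emeasure m1 A0 = emeasure m2 A0"
      using e1[OF borel_path_K[OF m(1) A0]] e2[OF borel_path_K[OF m(1) A0]] m(2)[OF shift_K[OF A]] Heq[OF A]
      by simp
  qed
  then show "emeasure m (\<sigma> ` (A \<inter> E e)) = (\<integral>\<^sup>+x. ennreal (exp (\<phi> x)) * indicator (A \<inter> E e) x \<partial>m)"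
    using e1[OF A] e2[OF A] by simp
  show "\<sigma> ` (A \<inter> E e) \<in> sets m" by (rule imgS[OF A])
qed

text \<open>Conformality is assembled from the countably many sets \<open>E e\<close>; injectivity
  of \<sigma> on \<open>A\<close> is what makes the images of the parts
  \<open>A \<inter> E e\<close> disjoint.\<close>

theorem weight_conformal_measure:
  assumes h: "weight h" and A0: "A0 \<in> K" "h A0 \<noteq> 0"
  shows "\<exists>m. conformal_measure G \<phi> m"
proof -
  obtain m where m: "borel_path m" "\<And>A. A \<in> K \<Longrightarrow> emeasure m A = ennreal (h A)"
    "\<And>A. A \<in> sets m \<Longrightarrow> emeasure m A = outer_measure K (\<lambda>A. ennreal (h A)) A"
    using weight_measure[OF h] by blast
  have spm: "space m = X" by (rule borel_path_space[OF m(1)])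
  have phi [measurable]: "\<phi> \<in> borel_measurable m" by (rule phi_measurable[OF m(1)])
  have "conformal_measure G \<phi> m"
    unfolding conformal_measure_def
  proof (intro conjI ballI impI)
    show "regular_borel_measure T m" by (rule weight_regular[OF h m])
    have "emeasure m A0 \<le> emeasure m (space m)" by (rule emeasure_space)
    moreover have "emeasure m A0 \<noteq> 0"
      using m(2)[OF A0(1)] A0(2) weight_nonneg[OF h A0(1)] by (simp add: ennreal_eq_0_iff)
    ultimately show "emeasure m (space m) \<noteq> 0" by auto
    fix A assume A [measurable]: "A \<in> sets m" and inj: "inj_on \<sigma> A"
    have AX: "A \<subseteq> X" using sets.sets_into_space[OF A] spm by simp
    have [measurable]: "E e \<in> sets m" for e :: 'b using borel_path_K[OF m(1)] by simp
    define m3 where "m3 = density m (\<lambda>x. ennreal (exp (\<phi> x)))"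
    have e3: "emeasure m3 B = (\<integral>\<^sup>+x. ennreal (exp (\<phi> x)) * indicator B x \<partial>m)" if "B \<in> sets m" for B
      unfolding m3_def using that by (rule emeasure_density[rotated]) simp
    have un: "A = (\<Union>e\<in>arcs G. A \<inter> E e)" using AX X_arcs by (auto simp: E_def)
    have "\<sigma> ` A = (\<Union>e\<in>arcs G. \<sigma> ` (A \<inter> E e))" by (subst un) blast
    also have "emeasure m \<dots> = (\<integral>\<^sup>+e. emeasure m (\<sigma> ` (A \<inter> E e)) \<partial>count_space (arcs G))"
    proof (rule emeasure_UN_countable[OF _ countable_arcs])
      show "\<sigma> ` (A \<inter> E e) \<in> sets m" if "e \<in> arcs G" for e
        by (rule weight_edge_conformal[OF h m(1,2) that A])
      show "disjoint_family_on (\<lambda>e. \<sigma> ` (A \<inter> E e)) (arcs G)"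
        unfolding disjoint_family_on_def
      proof (intro ballI impI)
        fix e f :: 'b assume "e \<noteq> f"
        have "\<sigma> ` (A \<inter> E e) \<inter> \<sigma> ` (A \<inter> E f) = \<sigma> ` ((A \<inter> E e) \<inter> (A \<inter> E f))"
          by (rule inj_on_image_Int[OF inj, symmetric]) auto
        then show "\<sigma> ` (A \<inter> E e) \<inter> \<sigma> ` (A \<inter> E f) = {}" using \<open>e \<noteq> f\<close> by (auto simp: E_def)
      qed
    qed
    also have "\<dots> = (\<integral>\<^sup>+e. emeasure m3 (A \<inter> E e) \<partial>count_space (arcs G))"
      by (intro nn_integral_cong) (simp add: weight_edge_conformal(2)[OF h m(1,2) _ A] e3)
    also have "\<dots> = emeasure m3 (\<Union>e\<in>arcs G. A \<inter> E e)"
    proof (rule emeasure_UN_countable[symmetric, OF _ countable_arcs])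
      show "A \<inter> E e \<in> sets m3" for e unfolding m3_def by simp
      show "disjoint_family_on (\<lambda>e. A \<inter> E e) (arcs G)" by (auto simp: disjoint_family_on_def E_def)
    qed
    also have "\<dots> = (\<integral>\<^sup>+x. ennreal (exp (\<phi> x)) * indicator A x \<partial>m)"
      using un e3[OF A] by simp
    finally show "emeasure m (\<sigma> ` A) = (\<integral>\<^sup>+x\<in>A. ennreal (exp (\<phi> x)) \<partial>m)" .
  qed
  then show ?thesis ..
qed

subsection \<open>Iterates of the transfer operator\<close>

text \<open>
  \<open>W n A x\<close> is the value at \<open>x\<close> of $L_{-\phi}^n 1_A$. The sum is finite for compact open
  \<open>A\<close>, even where the fibres of \<open>\<sigma>\<close> are infinite.
\<close>

definition W :: "nat \<Rightarrow> (nat \<Rightarrow> 'b) set \<Rightarrow> (nat \<Rightarrow> 'b) \<Rightarrow> real" where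
  "W n A x = (\<Sum>y | y \<in> A \<and> (\<sigma> ^^ n) y = x. exp (- birkhoff \<phi> n y))"

lemma finite_fibre: assumes "A \<in> K" shows "finite {y. y \<in> A \<and> (\<sigma> ^^ n) y = x}"
proof (rule inj_on_finite[OF _ _ finite_prefixes_K[OF assms]])
  show "inj_on (\<lambda>y. map y [0..<n]) {y. y \<in> A \<and> (\<sigma> ^^ n) y = x}"
  proof (rule inj_onI)
    fix y z assume *: "y \<in> {y. y \<in> A \<and> (\<sigma> ^^ n) y = x}" "z \<in> {y. y \<in> A \<and> (\<sigma> ^^ n) y = x}"
      "map y [0..<n] = map z [0..<n]"
    then have "splice n y x = splice n z x" by (auto simp: splice_def)
    then show "y = z" using * splice_self[of n y] splice_self[of n z] by auto
  qed
qed auto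

lemma W_nonneg: "0 \<le> W n A x"
  by (simp add: W_def sum_nonneg)

lemma W_mono: "B \<in> K \<Longrightarrow> A \<subseteq> B \<Longrightarrow> W n A x \<le> W n B x"
  unfolding W_def by (rule sum_mono2[OF finite_fibre]) auto

lemma W_additive: "additive_on A (\<lambda>A. W n A x)"
  unfolding additive_on_def
proof (intro ballI impI)
  fix B C assume BC: "B \<in> K" "C \<in> K" "B \<inter> C = {}"
  have "{y. y \<in> B \<union> C \<and> (\<sigma> ^^ n) y = x} =
      {y. y \<in> B \<and> (\<sigma> ^^ n) y = x} \<union> {y. y \<in> C \<and> (\<sigma> ^^ n) y = x}" by auto
  then show "W n (B \<union> C) x = W n B x + W n C x"
    unfolding W_def using BC by (auto intro!: sum.union_disjoint finite_fibre)
qed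

lemma W_UN:
  assumes "finite I" "disjoint_family_on C I" "\<And>i. i \<in> I \<Longrightarrow> C i \<in> K"
  shows "W n (\<Union>i\<in>I. C i) x = (\<Sum>i\<in>I. W n (C i) x)"
  using additive_on_UN[OF W_additive[of X n x] assms(1,2)] assms(3) K_subset by blast

lemma W_Z: "v \<in> verts G \<Longrightarrow> W n (Z v) x = (\<Sum>e\<in>out_arcs G v. W n (E e) x)"
  unfolding Z_Union_E using finite_out disjoint_E by (intro W_UN) auto

lemma W_K_le_Z:
  assumes "A \<in> K" shows "W n A x \<le> (\<Sum>v\<in>(\<lambda>x. tail G (x 0)) ` A. W n (Z v) x)"
proof -
  let ?F = "(\<lambda>x. tail G (x 0)) ` A"
  have "(\<Union>v\<in>?F. Z v) \<in> K" using K_finite[OF assms] by (rule K_UNION) simp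
  moreover have "A \<subseteq> (\<Union>v\<in>?F. Z v)" using K_subset[OF assms] by (auto simp: Z_def)
  ultimately have "W n A x \<le> W n (\<Union>v\<in>?F. Z v) x" by (rule W_mono)
  also have "\<dots> = (\<Sum>v\<in>?F. W n (Z v) x)"
    using K_finite[OF assms] disjoint_Z by (intro W_UN) auto
  finally show ?thesis .
qed

lemma W_0: "W 0 A x = (if x \<in> A then 1 else 0)"
proof -
  have "{y. y \<in> A \<and> y = x} = (if x \<in> A then {x} else {})" by auto
  then show ?thesis by (simp add: W_def)
qed

lemma W_pos: "A \<in> K \<Longrightarrow> y \<in> A \<Longrightarrow> (\<sigma> ^^ n) y = x \<Longrightarrow> 0 < W n A x"
  unfolding W_def using finite_fibre by (intro sum_pos) auto

text \<open>The m-fold shift maps the (n+m)-fibre within \<open>A\<close> bijectively onto the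
  n-fibre within its image, and Birkhoff sums form a cocycle. Thus \<open>W\<close> obeys the bounds
  of a weight except that the number of steps drops; summation over \<open>n\<close> hides this drop
  apart from the initial term.\<close>

lemma W_nstep:
  assumes A: "A \<in> K" "inj_on (\<sigma> ^^ m) A"
    and ab: "\<And>x. x \<in> A \<Longrightarrow> a \<le> birkhoff \<phi> m x" "\<And>x. x \<in> A \<Longrightarrow> birkhoff \<phi> m x \<le> b"
  shows "exp a * W (n + m) A x \<le> W n ((\<sigma> ^^ m) ` A) x" "W n ((\<sigma> ^^ m) ` A) x \<le> exp b * W (n + m) A x"
proof -
  let ?S = "{y. y \<in> A \<and> (\<sigma> ^^ (n + m)) y = x}"
  have "{z. z \<in> (\<sigma> ^^ m) ` A \<and> (\<sigma> ^^ n) z = x} = (\<sigma> ^^ m) ` ?S" by (auto simp: funpow_add)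
  moreover have "inj_on (\<sigma> ^^ m) ?S" by (rule inj_on_subset[OF A(2)]) auto
  ultimately have "W n ((\<sigma> ^^ m) ` A) x = (\<Sum>y\<in>?S. exp (- birkhoff \<phi> n ((\<sigma> ^^ m) y)))"
    unfolding W_def by (simp add: sum.reindex)
  also have "\<dots> = (\<Sum>y\<in>?S. exp (birkhoff \<phi> m y) * exp (- birkhoff \<phi> (n + m) y))"
    by (intro sum.cong) (auto simp: birkhoff_add[of \<phi> m n] add.commute[of n m] simp flip: exp_add)
  finally have eq: "W n ((\<sigma> ^^ m) ` A) x = (\<Sum>y\<in>?S. exp (birkhoff \<phi> m y) * exp (- birkhoff \<phi> (n + m) y))" .
  show "exp a * W (n + m) A x \<le> W n ((\<sigma> ^^ m) ` A) x" "W n ((\<sigma> ^^ m) ` A) x \<le> exp b * W (n + m) A x"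
    unfolding eq unfolding W_def sum_distrib_left using ab by (auto intro!: sum_mono mult_right_mono)
qed

lemma W_shift:
  assumes A: "A \<in> K" "inj_on \<sigma> A" and ab: "\<And>x. x \<in> A \<Longrightarrow> a \<le> \<phi> x" "\<And>x. x \<in> A \<Longrightarrow> \<phi> x \<le> b"
  shows "exp a * W (Suc n) A x \<le> W n (\<sigma> ` A) x" "W n (\<sigma> ` A) x \<le> exp b * W (Suc n) A x"
  using W_nstep[of A 1 a b n x] A ab by (simp_all add: birkhoff_def)

lemma W_edge_bounds:
  assumes "e \<in> arcs G"
  shows "\<exists>b>0. \<forall>n x. W n (Z (head G e)) x \<le> b * W (Suc n) (E e) x"
    and "\<exists>b>0. \<forall>n x. W (Suc n) (E e) x \<le> b * W n (Z (head G e)) x"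
proof -
  obtain B where B: "\<And>x. x \<in> E e \<Longrightarrow> \<bar>\<phi> x\<bar> \<le> B" using phi_bounded[OF E_K] by blast
  have B': "- B \<le> \<phi> x" "\<phi> x \<le> B" if "x \<in> E e" for x using B[OF that] by auto
  note w = W_shift[OF E_K[of e] inj_on_shift_E B', unfolded shift_E[OF assms]]
  have "W n (Z (head G e)) x \<le> exp B * W (Suc n) (E e) x" for n x using w(2) by simp
  then show "\<exists>b>0. \<forall>n x. W n (Z (head G e)) x \<le> b * W (Suc n) (E e) x"
    by (intro exI[of _ "exp B"]) simp
  have "W (Suc n) (E e) x \<le> exp B * W n (Z (head G e)) x" for n x
  proof -
    have "exp B * (exp (- B) * W (Suc n) (E e) x) \<le> exp B * W n (Z (head G e)) x"
      using w(1) by (intro mult_left_mono) auto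
    then show ?thesis by (simp add: mult.assoc[symmetric] flip: exp_add)
  qed
  then show "\<exists>b>0. \<forall>n x. W (Suc n) (E e) x \<le> b * W n (Z (head G e)) x"
    by (intro exI[of _ "exp B"]) simp
qed

lemma E_subset_Z: "E e \<subseteq> Z (tail G e)"
  by (auto simp: E_def Z_def)

text \<open>
  The normalised measures $c^{-1} \sum_n q^n (L_{-\phi}^n)^* \delta_x$ fail to be conformal
  only through the factor $q$ and the mass $c^{-1}$ at $x$; both defects vanish in the limit.
\<close>

theorem weight_from_approximants:
  fixes q c :: "nat \<Rightarrow> real" and x :: "nat \<Rightarrow> nat \<Rightarrow> 'b"
  assumes v0: "v0 \<in> verts G" and x: "\<And>k. x k \<in> X"
    and q: "\<And>k. 1/2 \<le> q k" "\<And>k. q k \<le> 1" "q \<longlonglongrightarrow> 1"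
    and summ: "\<And>k v. v \<in> verts G \<Longrightarrow> summable (\<lambda>n. q k ^ n * W n (Z v) (x k))"
    and c: "\<And>k. c k = (\<Sum>n. q k ^ n * W n (Z v0) (x k))" and c_pos: "\<And>k. 0 < c k"
    and defect: "\<And>v. v \<in> verts G \<Longrightarrow> (\<lambda>k. if x k \<in> Z v then 1 / c k else 0) \<longlonglongrightarrow> 0"
  shows "\<exists>h. weight h \<and> h (Z v0) = 1"
proof -
  have q0: "0 < q k" for k using q(1)[of k] by linarith
  \<comment> \<open>The normalised term \<open>n = 0\<close>, a point mass at
    \<open>x k\<close>.\<close>
  define \<delta> where "\<delta> k A = (if x k \<in> A then 1 / c k else 0)" for k A
  have \<delta>_nonneg: "0 \<le> \<delta> k A" for k A using c_pos[of k] by (simp add: \<delta>_def)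
  have \<delta>_mono: "\<delta> k A \<le> \<delta> k B" if "A \<subseteq> B" for k A B
    using that c_pos[of k] by (auto simp: \<delta>_def)
  have summK: "summable (\<lambda>n. q k ^ n * W n A (x k))" if A: "A \<in> K" for k A
  proof (rule summable_comparison_test')
    let ?F = "(\<lambda>x. tail G (x 0)) ` A"
    show "summable (\<lambda>n. \<Sum>v\<in>?F. q k ^ n * W n (Z v) (x k))"
      using K_verts[OF A] by (intro summable_sum summ) auto
    show "norm (q k ^ n * W n A (x k)) \<le> (\<Sum>v\<in>?F. q k ^ n * W n (Z v) (x k))" if "n \<ge> 0" for n
      using W_K_le_Z[OF A, of n "x k"] W_nonneg[of n A "x k"] q0[of k]
      by (simp add: abs_mult flip: sum_distrib_left)
  qed
  define H where "H k A = (\<Sum>n. q k ^ n * W n A (x k)) / c k" for k A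
  have H_nonneg: "0 \<le> H k A" if "A \<in> K" for k A
    unfolding H_def using c_pos[of k] q0[of k] W_nonneg
    by (intro divide_nonneg_pos suminf_nonneg summK[OF that]) (auto intro!: mult_nonneg_nonneg)
  have H_add: "additive_on X (H k)" for k
    unfolding additive_on_def
  proof (intro ballI impI)
    fix B C assume BC: "B \<in> K" "C \<in> K" "B \<inter> C = {}"
    have "W n (B \<union> C) (x k) = W n B (x k) + W n C (x k)" for n
      using W_additive[of X n "x k"] BC K_subset unfolding additive_on_def by simp
    then have "(\<Sum>n. q k ^ n * W n (B \<union> C) (x k)) =
        (\<Sum>n. q k ^ n * W n B (x k)) + (\<Sum>n. q k ^ n * W n C (x k))"
      using suminf_add[OF summK[OF BC(1), of k] summK[OF BC(2), of k]] by (simp add: distrib_left)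
    then show "H k (B \<union> C) = H k B + H k C" unfolding H_def by (simp add: add_divide_distrib)
  qed
  have H_mono: "H k A \<le> H k B" if "A \<in> K" "B \<in> K" "A \<subseteq> B" for k A B
    unfolding H_def using c_pos[of k] q0[of k]
    by (intro divide_right_mono suminf_le summK that mult_left_mono W_mono) auto
  \<comment> \<open>Moving the summation index by one turns the drop in \<open>W_shift\<close> into
    the factor \<open>q k\<close> and leaves out the term \<open>n = 0\<close>. These are the only
    deviations from the weight inequalities.\<close>
  have H_shift: "exp a * (H k A - \<delta> k A) \<le> q k * H k (\<sigma> ` A)" "q k * H k (\<sigma> ` A) \<le> exp b * (H k A - \<delta> k A)"
    if A: "A \<in> K" "inj_on \<sigma> A" and ab: "\<And>x. x \<in> A \<Longrightarrow> a \<le> \<phi> x" "\<And>x. x \<in> A \<Longrightarrow> \<phi> x \<le> b" for k A a b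
  proof -
    define S where "S = (\<Sum>n. q k ^ n * W (Suc n) A (x k))"
    have s1: "summable (\<lambda>n. q k ^ Suc n * W (Suc n) A (x k))"
      using summable_Suc_iff[of "\<lambda>n. q k ^ n * W n A (x k)"] summK[OF A(1)] by blast
    have "summable (\<lambda>n. inverse (q k) * (q k ^ Suc n * W (Suc n) A (x k)))"
      by (rule summable_mult[OF s1])
    then have s2: "summable (\<lambda>n. q k ^ n * W (Suc n) A (x k))"
      using q0[of k] by (simp add: mult.assoc[symmetric])
    have "(\<Sum>n. q k ^ n * W n A (x k)) = W 0 A (x k) + (\<Sum>n. q k ^ Suc n * W (Suc n) A (x k))"
      using suminf_split_head[OF summK[OF A(1), of k]] by simp
    also have "(\<Sum>n. q k ^ Suc n * W (Suc n) A (x k)) = q k * S"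
      unfolding S_def using suminf_mult[OF s2, of "q k"] by (simp add: mult.assoc)
    finally have HS: "H k A - \<delta> k A = q k * S / c k"
      by (simp add: H_def \<delta>_def W_0 add_divide_distrib)
    have "exp a * S \<le> (\<Sum>n. q k ^ n * W n (\<sigma> ` A) (x k))"
      unfolding S_def suminf_mult[OF s2, symmetric]
    proof (rule suminf_le[OF _ summable_mult[OF s2] summK[OF shift_K[OF A(1)]]])
      fix n show "exp a * (q k ^ n * W (Suc n) A (x k)) \<le> q k ^ n * W n (\<sigma> ` A) (x k)"
        using W_shift(1)[OF A ab, of n "x k"] q0[of k] by (simp add: mult.left_commute)
    qed
    then have "exp a * S * q k / c k \<le> q k * H k (\<sigma> ` A)"
      unfolding H_def using q0[of k] c_pos[of k] by (simp add: divide_right_mono mult.commute)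
    then show "exp a * (H k A - \<delta> k A) \<le> q k * H k (\<sigma> ` A)"
      unfolding HS by (simp add: algebra_simps)
    have "(\<Sum>n. q k ^ n * W n (\<sigma> ` A) (x k)) \<le> exp b * S"
      unfolding S_def suminf_mult[OF s2, symmetric]
    proof (rule suminf_le[OF _ summK[OF shift_K[OF A(1)]] summable_mult[OF s2]])
      fix n show "q k ^ n * W n (\<sigma> ` A) (x k) \<le> exp b * (q k ^ n * W (Suc n) A (x k))"
        using W_shift(2)[OF A ab, of n "x k"] q0[of k] by (simp add: mult.left_commute)
    qed
    then have "q k * H k (\<sigma> ` A) \<le> exp b * S * q k / c k"
      unfolding H_def using q0[of k] c_pos[of k] by (simp add: divide_right_mono mult.commute)
    then show "q k * H k (\<sigma> ` A) \<le> exp b * (H k A - \<delta> k A)"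
      unfolding HS by (simp add: algebra_simps)
  qed
  let ?S = "{v. \<exists>M. \<forall>k. H k (Z v) \<le> M}"
  \<comment> \<open>Only the mass at \<open>v0\<close> is normalised. Bounds uniform in
    \<open>k\<close> spread to all vertices: forwards because \<open>q k\<close> stays away from 0,
    backwards because \<open>q k\<close> is at most 1 and the point masses converge, hence are
    bounded.\<close>
  have bounded: "verts G \<subseteq> ?S"
  proof (rule cofinal_induct[OF v0 _ order_refl])
    have "H k (Z v0) = 1" for k using c[of k] c_pos[of k] by (simp add: H_def)
    then show "v0 \<in> ?S" by auto
    show "head G e \<in> ?S" if e: "e \<in> arcs G" "tail G e \<in> ?S" for e
    proof -
      obtain M where M: "\<And>k. H k (Z (tail G e)) \<le> M" using e(2) by blast
      obtain B where B: "\<And>x. x \<in> E e \<Longrightarrow> \<bar>\<phi> x\<bar> \<le> B" using phi_bounded[OF E_K] by blast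
      have B': "- B \<le> \<phi> x" "\<phi> x \<le> B" if "x \<in> E e" for x using B[OF that] by auto
      have "H k (Z (head G e)) \<le> 2 * (exp B * M)" for k
      proof -
        have "q k * H k (Z (head G e)) \<le> exp B * (H k (E e) - \<delta> k (E e))"
          using H_shift(2)[OF E_K[of e] inj_on_shift_E B', where k = k] shift_E[OF e(1)] by simp
        also have "\<dots> \<le> exp B * M"
          using \<delta>_nonneg[of k "E e"] H_mono[OF E_K Z_K E_subset_Z[of e], where k = k] M[of k]
          by (intro mult_left_mono) (linarith, simp)
        finally have "q k * H k (Z (head G e)) \<le> exp B * M" .
        moreover have "1/2 * H k (Z (head G e)) \<le> q k * H k (Z (head G e))"
          by (rule mult_right_mono[OF q(1) H_nonneg[OF Z_K]])
        ultimately show ?thesis by linarith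
      qed
      then show ?thesis by blast
    qed
    show "v \<in> ?S" if v: "v \<in> verts G" "\<And>e. e \<in> out_arcs G v \<Longrightarrow> head G e \<in> ?S" for v
    proof -
      have "\<exists>M. \<forall>k. H k (E e) \<le> M" if e: "e \<in> out_arcs G v" for e
      proof -
        obtain M where M: "\<And>k. H k (Z (head G e)) \<le> M" using v(2)[OF e] by blast
        obtain B where B: "\<And>x. x \<in> E e \<Longrightarrow> \<bar>\<phi> x\<bar> \<le> B" using phi_bounded[OF E_K] by blast
        have B': "- B \<le> \<phi> x" "\<phi> x \<le> B" if "x \<in> E e" for x using B[OF that] by auto
        have "Bseq (\<lambda>k. \<delta> k (Z v))"
          using defect[OF v(1)] unfolding \<delta>_def by (auto intro: convergent_imp_Bseq convergentI)
        then obtain D where D: "\<And>k. norm (\<delta> k (Z v)) \<le> D" unfolding Bseq_def by blast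
        have "H k (E e) \<le> D + exp B * M" for k
        proof -
          have "exp (- B) * (H k (E e) - \<delta> k (E e)) \<le> q k * H k (Z (head G e))"
            using H_shift(1)[OF E_K[of e] inj_on_shift_E B', where k = k] shift_E e by simp
          also have "\<dots> \<le> 1 * M"
            using q(2)[of k] M[of k] H_nonneg[OF Z_K, of k "head G e"] by (intro mult_mono) auto
          finally have "exp B * (exp (- B) * (H k (E e) - \<delta> k (E e))) \<le> exp B * M"
            by (intro mult_left_mono) auto
          then have "H k (E e) - \<delta> k (E e) \<le> exp B * M"
            by (simp add: mult.assoc[symmetric] flip: exp_add)
          moreover have "\<delta> k (E e) \<le> D"
            using \<delta>_mono[OF E_subset_Z[of e], where k = k] D[of k] e by simp
          ultimately show ?thesis by linarith
        qed
        then show ?thesis by blast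
      qed
      then have "\<forall>e\<in>out_arcs G v. \<exists>M. \<forall>k. H k (E e) \<le> M" by blast
      then obtain M where M: "\<forall>e\<in>out_arcs G v. \<forall>k. H k (E e) \<le> M e" by (rule bchoice[THEN exE])
      have "H k (Z v) = (\<Sum>e\<in>out_arcs G v. H k (E e))" for k
        unfolding Z_Union_E using finite_out[OF v(1)] disjoint_E E_K K_subset[OF E_K]
        by (intro additive_on_UN[OF H_add]) auto
      moreover have "(\<Sum>e\<in>out_arcs G v. H k (E e)) \<le> (\<Sum>e\<in>out_arcs G v. M e)" for k
        by (rule sum_mono) (use M in blast)
      ultimately have "H k (Z v) \<le> (\<Sum>e\<in>out_arcs G v. M e)" for k by simp
      then show ?thesis by blast
    qed
  qed
  have "\<exists>M>0. \<forall>k. H k A \<le> M" if A: "A \<in> K" for A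
  proof -
    let ?F = "(\<lambda>x. tail G (x 0)) ` A"
    have "\<forall>v\<in>?F. \<exists>M. \<forall>k. H k (Z v) \<le> M" using bounded K_verts[OF A] by blast
    then obtain M where M: "\<forall>v\<in>?F. \<forall>k. H k (Z v) \<le> M v" by (rule bchoice[THEN exE])
    have FK: "(\<Union>v\<in>?F. Z v) \<in> K" using K_finite[OF A] by (rule K_UNION) simp
    have "A \<subseteq> (\<Union>v\<in>?F. Z v)" using K_subset[OF A] by (auto simp: Z_def)
    then have "H k A \<le> H k (\<Union>v\<in>?F. Z v)" for k by (rule H_mono[OF A FK])
    also have "H k (\<Union>v\<in>?F. Z v) = (\<Sum>v\<in>?F. H k (Z v))" for k
      using K_finite[OF A] disjoint_Z Z_subset by (intro additive_on_UN[OF H_add]) auto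
    finally have "H k A \<le> (\<Sum>v\<in>?F. H k (Z v))" for k .
    also have "(\<Sum>v\<in>?F. H k (Z v)) \<le> (\<Sum>v\<in>?F. M v)" for k using M by (intro sum_mono) auto
    finally have "H k A \<le> max 1 (\<Sum>v\<in>?F. M v)" for k by (simp add: le_max_iff_disj)
    then show ?thesis by (intro exI[of _ "max 1 (\<Sum>v\<in>?F. M v)"]) auto
  qed
  then have "\<forall>A\<in>K. \<exists>M. M > 0 \<and> (\<forall>k. H k A \<le> M)" by blast
  then obtain M where M: "\<forall>A\<in>K. M A > 0 \<and> (\<forall>k. H k A \<le> M A)" by (rule bchoice[THEN exE])
  \<comment> \<open>Rescaling each \<open>A\<close> by its own bound provides the common bound 1
    that the diagonal argument asks for; the scaling is undone after the subsequence is
    chosen.\<close>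
  have "norm (H k A / M A) \<le> 1" if "A \<in> K" for k A
    using M that H_nonneg[OF that, of k] by (simp add: abs_of_pos)
  then obtain r where r: "strict_mono (r :: nat \<Rightarrow> nat)"
    "\<And>A. A \<in> K \<Longrightarrow> \<exists>l. (\<lambda>k. H (r k) A / M A) \<longlonglongrightarrow> l"
    using function_convergent_subsequence[OF countable_K, of "\<lambda>k A. H k A / M A" 1] by blast
  have "\<exists>l. (\<lambda>k. H (r k) A) \<longlonglongrightarrow> l" if A: "A \<in> K" for A
  proof -
    obtain l where "(\<lambda>k. H (r k) A / M A) \<longlonglongrightarrow> l" using r(2)[OF A] by blast
    then have "(\<lambda>k. H (r k) A / M A * M A) \<longlonglongrightarrow> l * M A" by (intro tendsto_intros)
    moreover have "M A \<noteq> 0" using M A by fastforce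
    ultimately show ?thesis by auto
  qed
  then have "\<forall>A\<in>K. \<exists>l. (\<lambda>k. H (r k) A) \<longlonglongrightarrow> l" by blast
  then obtain h where h: "\<forall>A\<in>K. (\<lambda>k. H (r k) A) \<longlonglongrightarrow> h A" by (rule bchoice[THEN exE])
  have hl: "(\<lambda>k. H (r k) A) \<longlonglongrightarrow> h A" if "A \<in> K" for A using h that by blast
  have ql: "(\<lambda>k. q (r k)) \<longlonglongrightarrow> 1" using LIMSEQ_subseq_LIMSEQ[OF q(3) r(1)] by (simp add: o_def)
  have \<delta>l: "(\<lambda>k. \<delta> (r k) A) \<longlonglongrightarrow> 0" if A: "A \<in> K" for A
  proof -
    let ?F = "(\<lambda>x. tail G (x 0)) ` A"
    have "(\<lambda>k. \<Sum>v\<in>?F. \<delta> k (Z v)) \<longlonglongrightarrow> (\<Sum>v\<in>?F. 0)"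
      unfolding \<delta>_def using K_verts[OF A] by (intro tendsto_sum defect) auto
    then have lim: "(\<lambda>k. \<Sum>v\<in>?F. \<delta> k (Z v)) \<longlonglongrightarrow> 0" by simp
    have le: "\<delta> k A \<le> (\<Sum>v\<in>?F. \<delta> k (Z v))" for k
    proof (cases "x k \<in> A")
      case True
      then have "tail G (x k 0) \<in> ?F" by blast
      moreover have "\<delta> k A = \<delta> k (Z (tail G (x k 0)))" using True x by (simp add: \<delta>_def Z_def)
      ultimately show ?thesis
        using member_le_sum[of "tail G (x k 0)" ?F "\<lambda>v. \<delta> k (Z v)"] \<delta>_nonneg K_finite[OF A] by auto
    next
      case False
      then have "\<delta> k A = 0" by (simp add: \<delta>_def)
      then show ?thesis using \<delta>_nonneg by (simp add: sum_nonneg)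
    qed
    have "(\<lambda>k. \<delta> k A) \<longlonglongrightarrow> 0"
      by (rule tendsto_sandwich[OF _ _ tendsto_const lim]) (use \<delta>_nonneg le in auto)
    then show ?thesis using LIMSEQ_subseq_LIMSEQ[OF _ r(1)] by (fastforce simp: o_def)
  qed
  have "weight h"
    unfolding weight_def
  proof (intro conjI ballI allI impI)
    show "0 \<le> h A" if A: "A \<in> K" for A
      by (rule LIMSEQ_le_const[OF hl[OF A]]) (use H_nonneg[OF A] in auto)
    show "additive_on X h"
      unfolding additive_on_def
    proof (intro ballI impI)
      fix B C assume BC: "B \<in> K" "C \<in> K" "B \<subseteq> X" "C \<subseteq> X" "B \<inter> C = {}"
      have "(\<lambda>k. H (r k) (B \<union> C)) \<longlonglongrightarrow> h B + h C"
        using tendsto_add[OF hl[OF BC(1)] hl[OF BC(2)]] H_add BC unfolding additive_on_def by simp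
      then show "h (B \<union> C) = h B + h C" using hl[OF K_Un[OF BC(1,2)]] by (rule LIMSEQ_unique[rotated])
    qed
    fix A a b assume A: "A \<in> K" and inj: "inj_on \<sigma> A" and ab: "\<forall>x\<in>A. a \<le> \<phi> x \<and> \<phi> x \<le> b"
    have l1: "(\<lambda>k. exp s * (H (r k) A - \<delta> (r k) A)) \<longlonglongrightarrow> exp s * (h A - 0)" for s
      by (intro tendsto_intros hl \<delta>l A)
    have l2: "(\<lambda>k. q (r k) * H (r k) (\<sigma> ` A)) \<longlonglongrightarrow> 1 * h (\<sigma> ` A)"
      by (intro tendsto_intros hl ql shift_K A)
    have ab': "\<And>x. x \<in> A \<Longrightarrow> a \<le> \<phi> x" "\<And>x. x \<in> A \<Longrightarrow> \<phi> x \<le> b" using ab by auto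
    show "exp a * h A \<le> h (\<sigma> ` A)"
      using LIMSEQ_le[OF l1[of a] l2] H_shift(1)[OF A inj ab'] by auto
    show "h (\<sigma> ` A) \<le> exp b * h A"
      using LIMSEQ_le[OF l2 l1[of b]] H_shift(2)[OF A inj ab'] by auto
  qed
  moreover have "h (Z v0) = 1"
  proof -
    have "H k (Z v0) = 1" for k using c[of k] c_pos[of k] by (simp add: H_def)
    then show ?thesis using hl[of "Z v0"] LIMSEQ_unique[OF tendsto_const, of 1 "h (Z v0)"] by simp
  qed
  ultimately show ?thesis by blast
qed

subsection \<open>Pressure\<close>

abbreviation L where "L \<equiv> transfer_operator G (\<lambda>x. - \<phi> x)"

text \<open>The n-th iterate vanishes at points that are not n-fold shifts of points of
  \<open>A\<close>, so the possibly infinite sum in \<open>L\<close> runs over the image of a finite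
  fibre. Grouping the (n+1)-fibre by n-fold shifts identifies the result.\<close>

lemma transfer_iterate:
  assumes A: "A \<in> K" and f: "\<And>y. y \<in> X \<Longrightarrow> y \<notin> A \<Longrightarrow> f y = 0" and x: "x \<in> X"
  shows "(L ^^ n) f x = (\<Sum>y | y \<in> A \<and> (\<sigma> ^^ n) y = x. exp (- birkhoff \<phi> n y) * f y)"
  using x
proof (induction n arbitrary: x)
  case 0
  have "{y. y \<in> A \<and> y = x} = (if x \<in> A then {x} else {})" by auto
  then show ?case using f 0 by simp
next
  case (Suc n)
  let ?S = "{z. z \<in> A \<and> (\<sigma> ^^ Suc n) z = x}"
  let ?g = "\<lambda>z. exp (- birkhoff \<phi> (Suc n) z) * f z"
  have finS: "finite ?S" by (rule finite_fibre[OF A])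
  have AX: "A \<subseteq> X" by (rule K_subset[OF A])
  have tm: "exp (- \<phi> y) * (L ^^ n) f y = (\<Sum>z | z \<in> ?S \<and> (\<sigma> ^^ n) z = y. ?g z)"
    if y: "y \<in> X" "\<sigma> y = x" for y
  proof -
    have "{z. z \<in> A \<and> (\<sigma> ^^ n) z = y} = {z. z \<in> ?S \<and> (\<sigma> ^^ n) z = y}" using y by auto
    then have "exp (- \<phi> y) * (L ^^ n) f y =
        (\<Sum>z | z \<in> ?S \<and> (\<sigma> ^^ n) z = y. exp (- \<phi> y) * (exp (- birkhoff \<phi> n z) * f z))"
      unfolding Suc.IH[OF y(1)] sum_distrib_left by simp
    also have "\<dots> = (\<Sum>z | z \<in> ?S \<and> (\<sigma> ^^ n) z = y. ?g z)"
      by (intro sum.cong refl) (auto simp: birkhoff_Suc_right exp_diff exp_minus divide_inverse mult.commute)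
    finally show ?thesis .
  qed
  have "(L ^^ Suc n) f x = (\<Sum>\<^sub>\<infinity>y\<in>{y \<in> X. \<sigma> y = x}. exp (- \<phi> y) * (L ^^ n) f y)"
    by (simp add: transfer_operator_def)
  also have "\<dots> = (\<Sum>\<^sub>\<infinity>y\<in>(\<sigma> ^^ n) ` ?S. exp (- \<phi> y) * (L ^^ n) f y)"
  proof (rule infsum_cong_neutral)
    fix y assume y: "y \<in> {y \<in> X. \<sigma> y = x} - (\<sigma> ^^ n) ` ?S"
    have "{z. z \<in> ?S \<and> (\<sigma> ^^ n) z = y} = {}" using y by blast
    moreover have "y \<in> X" "\<sigma> y = x" using y by auto
    ultimately show "exp (- \<phi> y) * (L ^^ n) f y = 0" by (simp only: tm sum.empty)
  next
    fix y assume "y \<in> (\<sigma> ^^ n) ` ?S - {y \<in> X. \<sigma> y = x}"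
    then show "exp (- \<phi> y) * (L ^^ n) f y = 0" using AX shift_funpow_X by auto
  qed simp
  also have "\<dots> = (\<Sum>y\<in>(\<sigma> ^^ n) ` ?S. exp (- \<phi> y) * (L ^^ n) f y)"
    using finS by (intro infsum_finite finite_imageI)
  also have "\<dots> = (\<Sum>y\<in>(\<sigma> ^^ n) ` ?S. \<Sum>z | z \<in> ?S \<and> (\<sigma> ^^ n) z = y. ?g z)"
    using AX shift_funpow_X by (intro sum.cong refl tm) auto
  also have "\<dots> = (\<Sum>z\<in>?S. ?g z)" by (rule sum.image_gen[OF finS, symmetric])
  finally show ?case .
qed

lemma continuous_map_indicator_K:
  assumes "A \<in> K" shows "continuous_map T euclideanreal (indicator A)"
  unfolding continuous_map_def
proof (intro conjI allI impI)
  fix U :: "real set"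
  have "openin T (X - A)" using K_closedin[OF assms] by (simp add: closedin_def)
  moreover have "openin T {}" "openin T X" using openin_topspace[of T] by auto
  moreover have "{x \<in> topspace T. indicator A x \<in> U} = (if 1 \<in> U then A else {}) \<union> (if 0 \<in> U then X - A else {})"
    using K_subset[OF assms] by (auto simp: indicator_def)
  ultimately show "openin T {x \<in> topspace T. indicator A x \<in> U}"
    using K_openin[OF assms] K_subset[OF assms] by (auto simp: Un_absorb1)
qed auto

text \<open>The choice made inside \<open>pressure_at\<close>. It is controlled from above by a
  multiple of the indicator of a set in \<open>K\<close> and from below by a multiple of the
  indicator of a cylinder, which reduces pressure to growth of \<open>W\<close>.\<close>

definition test_fun :: "(nat \<Rightarrow> 'b) \<Rightarrow> real" where
  "test_fun = (SOME f. is_test_function G f)"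

lemma is_test_function_test_fun: "is_test_function G test_fun"
proof -
  obtain v where v: "v \<in> verts G" using verts_nonempty by blast
  let ?f = "indicator (Z v) :: (nat \<Rightarrow> 'b) \<Rightarrow> real"
  have "{x \<in> topspace T. ?f x \<noteq> 0} = Z v" using Z_subset by (auto simp: indicator_def)
  moreover have "T closure_of Z v = Z v" by (rule closure_of_closedin[OF K_closedin]) simp
  ultimately have "?f \<in> Cc T"
    unfolding Cc_def using continuous_map_indicator_K[OF Z_K] compactin_K[OF Z_K] by simp
  moreover have "\<exists>x\<in>X. ?f x \<noteq> 0" using Z_nonempty[OF v] Z_subset by (auto simp: indicator_def)
  ultimately have "is_test_function G ?f" unfolding is_test_function_def by auto
  then show ?thesis unfolding test_fun_def by (rule someI[where P = "is_test_function G"])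
qed

lemma test_function_upper:
  assumes f: "is_test_function G f"
  shows "\<exists>A\<in>K. \<exists>C\<ge>0. (\<forall>x\<in>A. f x \<le> C) \<and> (\<forall>x\<in>X. x \<notin> A \<longrightarrow> f x = 0)"
proof -
  have cont: "continuous_map T euclideanreal f"
    and comp: "compactin T (T closure_of {x \<in> topspace T. f x \<noteq> 0})"
    using f by (auto simp: is_test_function_def Cc_def)
  obtain A where A: "A \<in> K" "T closure_of {x \<in> topspace T. f x \<noteq> 0} \<subseteq> A"
    using compactin_subset_K[OF comp] by blast
  have "compact (f ` A)" using image_compactin[OF compactin_K[OF A(1)] cont] by simp
  then have "bdd_above (f ` A)" by (intro bounded_imp_bdd_above compact_imp_bounded)
  then obtain C where "\<And>x. x \<in> A \<Longrightarrow> f x \<le> C" by (auto simp: bdd_above_def)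
  moreover have "f x = 0" if "x \<in> X" "x \<notin> A" for x
    using closure_of_subset[of "{x \<in> topspace T. f x \<noteq> 0}" T] A(2) that by auto
  ultimately show ?thesis using A(1) by (intro bexI[of _ A] exI[of _ "max C 0"]) (auto simp: le_max_iff_disj)
qed

lemma test_function_lower:
  assumes f: "is_test_function G f"
  shows "\<exists>x0\<in>X. \<exists>n>0. \<exists>c>0. \<forall>x\<in>cyl n x0. c \<le> f x"
proof -
  obtain x0 where x0: "x0 \<in> X" "f x0 > 0" using f by (force simp: is_test_function_def)
  have cont: "continuous_map T euclideanreal f" using f by (simp add: is_test_function_def Cc_def)
  have "openin T {x \<in> topspace T. f x \<in> {f x0 / 2<..}}"
    by (rule openin_continuous_map_preimage[OF cont]) simp
  then obtain n where "cyl n x0 \<subseteq> {x \<in> topspace T. f x \<in> {f x0 / 2<..}}"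
    unfolding openin_T_iff using x0 by auto
  moreover have "cyl (Suc n) x0 \<subseteq> cyl n x0" by (rule cyl_mono) simp
  ultimately have "\<forall>x\<in>cyl (Suc n) x0. f x0 / 2 \<le> f x" by force
  moreover have "f x0 / 2 > 0" using x0(2) by simp
  ultimately show ?thesis using x0(1) zero_less_Suc[of n] by blast
qed

definition P :: "nat \<Rightarrow> (nat \<Rightarrow> 'b) \<Rightarrow> real" where
  "P n x = (L ^^ n) test_fun x"

lemma pressure_at_P: "pressure_at G (\<lambda>x. - \<phi> x) x = ln_ereal (limsup (\<lambda>n. ereal (root n (P n x))))"
  by (simp add: pressure_at_def P_def Let_def test_fun_def)

lemma P_upper: "\<exists>A\<in>K. \<exists>C\<ge>0. \<forall>n. \<forall>x\<in>X. P n x \<le> C * W n A x"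
proof -
  obtain A C where A: "A \<in> K" "C \<ge> 0" "\<forall>x\<in>A. test_fun x \<le> C" "\<forall>x\<in>X. x \<notin> A \<longrightarrow> test_fun x = 0"
    using test_function_upper[OF is_test_function_test_fun] by blast
  have "P n x \<le> C * W n A x" if x: "x \<in> X" for n x
  proof -
    have "P n x = (\<Sum>y | y \<in> A \<and> (\<sigma> ^^ n) y = x. exp (- birkhoff \<phi> n y) * test_fun y)"
      unfolding P_def by (rule transfer_iterate[OF A(1) _ x]) (use A(4) in blast)
    also have "\<dots> \<le> C * W n A x"
      unfolding W_def sum_distrib_left using A(3) by (intro sum_mono) (auto simp: mult.commute)
    finally show ?thesis .
  qed
  then show ?thesis using A(1,2) by blast
qed

lemma P_nonneg: assumes "x \<in> X" shows "0 \<le> P n x"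
proof -
  obtain A C where "A \<in> K" "C \<ge> 0" "\<forall>x\<in>A. test_fun x \<le> C" "\<forall>x\<in>X. x \<notin> A \<longrightarrow> test_fun x = 0"
    using test_function_upper[OF is_test_function_test_fun] by blast
  note A = this(1,4)
  have eq: "P n x = (\<Sum>y | y \<in> A \<and> (\<sigma> ^^ n) y = x. exp (- birkhoff \<phi> n y) * test_fun y)"
    unfolding P_def by (rule transfer_iterate[OF A(1) _ assms]) (use A(2) in blast)
  show ?thesis
    unfolding eq using is_test_function_test_fun K_subset[OF A(1)] by (intro sum_nonneg) (auto simp: is_test_function_def)
qed

lemma P_lower:
  "\<exists>x0\<in>X. \<exists>m>0. \<exists>c>0. \<forall>n. \<forall>x\<in>X. c * W n (cyl m x0) x \<le> P n x"
proof -
  obtain A C where "A \<in> K" "C \<ge> 0" "\<forall>x\<in>A. test_fun x \<le> C" "\<forall>x\<in>X. x \<notin> A \<longrightarrow> test_fun x = 0"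
    using test_function_upper[OF is_test_function_test_fun] by blast
  note A = this(1,4)
  obtain x0 m c where c: "x0 \<in> X" "m > 0" "c > 0" "\<forall>x\<in>cyl m x0. c \<le> test_fun x"
    using test_function_lower[OF is_test_function_test_fun] by blast
  have sub: "cyl m x0 \<subseteq> A"
  proof
    fix y assume y: "y \<in> cyl m x0"
    then have "test_fun y > 0" using c(3) bspec[OF c(4) y] by linarith
    then show "y \<in> A" using A(2) y cyl_subset[of m x0] by (metis less_irrefl subsetD)
  qed
  have "c * W n (cyl m x0) x \<le> P n x" if x: "x \<in> X" for n x
  proof -
    have eq: "P n x = (\<Sum>y | y \<in> A \<and> (\<sigma> ^^ n) y = x. exp (- birkhoff \<phi> n y) * test_fun y)"
      unfolding P_def by (rule transfer_iterate[OF A(1) _ x]) (use A(2) in blast)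
    have "c * W n (cyl m x0) x \<le> (\<Sum>y | y \<in> cyl m x0 \<and> (\<sigma> ^^ n) y = x. exp (- birkhoff \<phi> n y) * test_fun y)"
      unfolding W_def sum_distrib_left using c(4) by (intro sum_mono) (auto simp: mult.commute)
    also have "\<dots> \<le> P n x"
      unfolding eq using sub is_test_function_test_fun K_subset[OF A(1)]
      by (intro sum_mono2 finite_fibre A) (auto simp: is_test_function_def)
    finally show ?thesis .
  qed
  then show ?thesis using c(1-3) by blast
qed

text \<open>The root test gives convergence for the test function, hence for a cylinder below it.
  The m-fold shift carries this cylinder onto a full set \<open>Z u\<close> at the cost of a
  constant and of \<open>m\<close> terms, and cofinality extends summability from \<open>u\<close>
  to all vertices.\<close>

lemma summable_of_pressure:
  assumes x: "x \<in> X" and q: "q > 0" and p: "pressure_at G (\<lambda>x. - \<phi> x) x < ereal (- ln q)"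
    and v: "v \<in> verts G"
  shows "summable (\<lambda>n. q ^ n * W n (Z v) x)"
proof -
  define l where "l = limsup (\<lambda>n. ereal (root n (P n x)))"
  have "ln_ereal l < ereal (ln (1 / q))" using p q by (simp add: pressure_at_P ln_div l_def)
  from ln_ereal_less_imp[OF this] have "l < ereal (1 / q)" using q by simp
  moreover have "0 < ereal (1 / q)" using q by simp
  ultimately have "max l 0 < ereal (1 / q)" by simp
  \<comment> \<open>The maximum with 0 makes \<open>r\<close> positive whatever \<open>l\<close> is;
    \<open>r < 1/q\<close> leaves a convergent geometric series with ratio
    \<open>q * r\<close>.\<close>
  from ereal_dense2[OF this] obtain r where r: "max l 0 < ereal r" "ereal r < ereal (1 / q)" by blast
  have "0 < ereal r" using r(1) by simp
  then have r0: "0 < r" "q * r < 1" using q r(2) by (auto simp: field_simps)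
  have "eventually (\<lambda>n. ereal (root n (P n x)) < ereal r) sequentially"
    by (rule Limsup_lessD) (use r(1) in \<open>simp add: l_def\<close>)
  then have "eventually (\<lambda>n. norm (q ^ n * P n x) \<le> (q * r) ^ n) sequentially"
    using eventually_gt_at_top[of 0]
  proof eventually_elim
    case (elim n)
    have "P n x = root n (P n x) ^ n" using elim P_nonneg[OF x] by simp
    also have "\<dots> \<le> r ^ n" using elim P_nonneg[OF x] by (intro power_mono) auto
    finally have "q ^ n * P n x \<le> q ^ n * r ^ n" using q by simp
    then show ?case using q P_nonneg[OF x, of n] by (simp add: power_mult_distrib)
  qed
  then have sP: "summable (\<lambda>n. q ^ n * P n x)"
    using q r0 by (intro summable_comparison_test_ev[OF _ summable_geometric]) auto
  obtain x0 m c where c: "x0 \<in> X" "m > 0" "c > 0" "\<forall>n. \<forall>x\<in>X. c * W n (cyl m x0) x \<le> P n x"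
    using P_lower by blast
  have "summable (\<lambda>n. q ^ n * (c * W n (cyl m x0) x))"
    by (rule summable_comparison_test'[OF sP]) (use c q x W_nonneg in \<open>auto simp: abs_mult\<close>)
  then have "summable (\<lambda>n. (1/c) * (q ^ n * (c * W n (cyl m x0) x)))" by (rule summable_mult)
  then have scyl: "summable (\<lambda>n. q ^ n * W n (cyl m x0) x)" using c(3) by simp
  let ?w = "tail G (x0 m)"
  let ?S = "{v. summable (\<lambda>n. q ^ n * W n (Z v) x)}"
  have "verts G \<subseteq> ?S"
  proof (rule cofinal_induct[OF X_tail_verts[OF c(1), of m] _ order_refl])
    have img: "(\<sigma> ^^ m) ` cyl m x0 = Z ?w"
      using shift_funpow_cyl[OF c(1), of m 0] c(2) by (auto simp: cyl_def Z_def)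
    obtain B where "\<forall>y\<in>cyl m x0. \<bar>birkhoff \<phi> m y\<bar> \<le> B" using birkhoff_bounded cyl_K[OF c(2)] by blast
    then have B: "- B \<le> birkhoff \<phi> m y" "birkhoff \<phi> m y \<le> B" if "y \<in> cyl m x0" for y
      using that by fastforce+
    have le: "W n (Z ?w) x \<le> exp B * W (n + m) (cyl m x0) x" for n
      using W_nstep(2)[OF cyl_K[OF c(2)] _ B, of x0 n x] inj_on_shift_cyl[of m 0 x0] img by simp
    have "summable (\<lambda>n. (exp B / q ^ m) * (q ^ (n + m) * W (n + m) (cyl m x0) x))"
      by (rule summable_mult[OF summable_ignore_initial_segment[OF scyl]])
    then have "summable (\<lambda>n. q ^ n * (exp B * W (n + m) (cyl m x0) x))"
      using q by (simp add: power_add field_simps)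
    then have "summable (\<lambda>n. q ^ n * W n (Z ?w) x)"
      by (rule summable_comparison_test') (use le q W_nonneg in \<open>auto simp: abs_mult\<close>)
    then show "?w \<in> ?S" by simp
    show "head G e \<in> ?S" if e: "e \<in> arcs G" "tail G e \<in> ?S" for e
    proof -
      obtain b where b: "b > 0" "\<forall>n x. W n (Z (head G e)) x \<le> b * W (Suc n) (E e) x"
        using W_edge_bounds(1)[OF e(1)] by blast
      have le: "W n (Z (head G e)) x \<le> b * W (Suc n) (Z (tail G e)) x" for n
        using b(2)[rule_format, of n x] W_mono[OF Z_K E_subset_Z[of e], of "Suc n" x] b(1)
        by (meson mult_le_cancel_left_pos order_trans)
      have "summable (\<lambda>n. (b / q) * (q ^ Suc n * W (Suc n) (Z (tail G e)) x))"
        by (intro summable_mult) (use e(2) summable_Suc_iff[of "\<lambda>n. q ^ n * W n (Z (tail G e)) x"] in blast)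
      then have "summable (\<lambda>n. q ^ n * (b * W (Suc n) (Z (tail G e)) x))"
        using q by (simp add: field_simps)
      then have "summable (\<lambda>n. q ^ n * W n (Z (head G e)) x)"
        by (rule summable_comparison_test') (use le q W_nonneg in \<open>auto simp: abs_mult\<close>)
      then show ?thesis by simp
    qed
    show "u \<in> ?S" if u: "u \<in> verts G" "\<And>e. e \<in> out_arcs G u \<Longrightarrow> head G e \<in> ?S" for u
    proof -
      have "summable (\<lambda>n. q ^ n * W n (E e) x)" if e: "e \<in> out_arcs G u" for e
      proof -
        have ea: "e \<in> arcs G" using e by simp
        obtain b where b: "b > 0" "\<forall>n x. W (Suc n) (E e) x \<le> b * W n (Z (head G e)) x"
          using W_edge_bounds(2)[OF ea] by blast
        have le: "W (Suc n) (E e) x \<le> b * W n (Z (head G e)) x" for n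
          using b(2) by blast
        have "summable (\<lambda>n. (q * b) * (q ^ n * W n (Z (head G e)) x))"
          using u(2)[OF e] by (intro summable_mult) simp
        then have "summable (\<lambda>n. q ^ Suc n * (b * W n (Z (head G e)) x))"
          by (simp add: algebra_simps)
        then have "summable (\<lambda>n. q ^ Suc n * W (Suc n) (E e) x)"
          by (rule summable_comparison_test')
            (use le q W_nonneg in \<open>auto simp: abs_mult intro!: mult_left_mono\<close>)
        then show ?thesis using summable_Suc_iff[of "\<lambda>n. q ^ n * W n (E e) x"] by blast
      qed
      then have "summable (\<lambda>n. \<Sum>e\<in>out_arcs G u. q ^ n * W n (E e) x)" by (rule summable_sum)
      then show ?thesis using W_Z[OF u(1)] by (simp add: sum_distrib_left)
    qed
  qed
  then show ?thesis using v by blast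
qed

text \<open>The test function lives over finitely many vertices, so the separate constants combine
  into one, and a constant has no effect on n-th roots in the limit.\<close>

lemma pressure_at_le:
  assumes x: "x \<in> X" and th: "\<theta> > 0" and le: "\<And>v. v \<in> verts G \<Longrightarrow> \<exists>M. \<forall>n. W n (Z v) x \<le> M * \<theta> ^ n"
  shows "pressure_at G (\<lambda>x. - \<phi> x) x \<le> ereal (ln \<theta>)"
proof -
  obtain A C where A: "A \<in> K" "C \<ge> 0" "\<forall>n. \<forall>x\<in>X. P n x \<le> C * W n A x" using P_upper by blast
  let ?F = "(\<lambda>x. tail G (x 0)) ` A"
  have "\<forall>v\<in>?F. \<exists>M. \<forall>n. W n (Z v) x \<le> M * \<theta> ^ n" using le K_verts[OF A(1)] by blast
  then obtain M where M: "\<forall>v\<in>?F. \<forall>n. W n (Z v) x \<le> M v * \<theta> ^ n" by (rule bchoice[THEN exE])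
  \<comment> \<open>The maximum with 1 makes \<open>D\<close> positive, so that its n-th roots tend
    to 1.\<close>
  define D where "D = max 1 (C * (\<Sum>v\<in>?F. M v))"
  have D: "D > 0" by (simp add: D_def)
  have PD: "P n x \<le> D * \<theta> ^ n" for n
  proof -
    have "P n x \<le> C * W n A x" using A(3) x by blast
    also have "\<dots> \<le> C * (\<Sum>v\<in>?F. W n (Z v) x)" using W_K_le_Z[OF A(1)] A(2) by (rule mult_left_mono)
    also have "\<dots> \<le> C * (\<Sum>v\<in>?F. M v * \<theta> ^ n)" using M A(2) by (intro mult_left_mono sum_mono) auto
    also have "\<dots> = C * (\<Sum>v\<in>?F. M v) * \<theta> ^ n" by (simp add: sum_distrib_right mult.assoc)
    also have "\<dots> \<le> D * \<theta> ^ n" using th by (intro mult_right_mono) (auto simp: D_def)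
    finally show ?thesis .
  qed
  have ev: "eventually (\<lambda>n. ereal (root n (P n x)) \<le> ereal (root n D * \<theta>)) sequentially"
    using eventually_gt_at_top[of 0]
  proof eventually_elim
    case (elim n)
    have "root n (P n x) \<le> root n (D * \<theta> ^ n)" using PD elim by (simp add: real_root_le_iff)
    also have "\<dots> = root n D * \<theta>" using th elim by (simp add: real_root_mult real_root_power_cancel)
    finally show ?case by simp
  qed
  have "(\<lambda>n. root n D * \<theta>) \<longlonglongrightarrow> 1 * \<theta>" using D by (intro tendsto_intros LIMSEQ_root_const)
  then have "(\<lambda>n. ereal (root n D * \<theta>)) \<longlonglongrightarrow> ereal \<theta>" by simp
  then have "limsup (\<lambda>n. ereal (root n D * \<theta>)) = ereal \<theta>" by (rule lim_imp_Limsup[OF sequentially_bot])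
  then have "limsup (\<lambda>n. ereal (root n (P n x))) \<le> ereal \<theta>" using Limsup_mono[OF ev] by simp
  then show ?thesis unfolding pressure_at_P using th by (rule ln_ereal_le)
qed

section \<open>The pressure bound imposed by a weight\<close>

text \<open>The \<open>N\<close> additional common edges allow the oscillation bound to be used at
  each of the \<open>n\<close> shifts. Without Bowen's condition the distortion may grow linearly,
  but only at an arbitrarily small rate \<epsilon>.\<close>

lemma birkhoff_osc:
  assumes N: "\<forall>x\<in>X. \<forall>y\<in>X. (\<forall>i<N. x i = y i) \<longrightarrow> \<bar>\<phi> x - \<phi> y\<bar> \<le> \<epsilon>"
    and "x \<in> X" "y \<in> X" "\<And>i. i < n + N \<Longrightarrow> x i = y i"
  shows "\<bar>birkhoff \<phi> n x - birkhoff \<phi> n y\<bar> \<le> real n * \<epsilon>"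
  using assms(2-)
proof (induction n arbitrary: x y)
  case (Suc n)
  have "\<bar>\<phi> x - \<phi> y\<bar> \<le> \<epsilon>" using N Suc.prems by auto
  moreover have "\<bar>birkhoff \<phi> n (\<sigma> x) - birkhoff \<phi> n (\<sigma> y)\<bar> \<le> real n * \<epsilon>"
    using Suc.prems by (intro Suc.IH shift_X) (auto simp: path_shift_def)
  ultimately show ?case by (simp add: birkhoff_Suc algebra_simps)
qed simp

lemma weight_UN_le:
  assumes h: "weight h" and "finite I" "\<And>i. i \<in> I \<Longrightarrow> C i \<in> K"
  shows "h (\<Union>i\<in>I. C i) \<le> (\<Sum>i\<in>I. h (C i))"
  using assms(2,3)
proof (induction I rule: finite_induct)
  case empty then show ?case using additive_on_empty[OF weight_additive[OF h]] by simp
next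
  case (insert i I)
  let ?U = "\<Union>j\<in>I. C j"
  have K: "?U \<in> K" "C i \<in> K" using insert by (auto intro: K_UNION)
  have "h (C i \<union> (?U - C i)) = h (C i) + h (?U - C i)"
    using weight_additive[OF h, unfolded additive_on_def, rule_format, of "C i" "?U - C i"]
      K K_Diff[OF K] K_subset[OF K(2)] K_subset[OF K_Diff[OF K]] by auto
  moreover have "h (?U - C i) \<le> h ?U" using K by (intro weight_mono[OF h]) auto
  moreover have "C i \<union> (?U - C i) = (\<Union>j\<in>insert i I. C j)" by auto
  ultimately show ?case using insert by simp
qed

text \<open>The integral estimate localised at \<open>x\<close>: the cylinders around the points of
  the n-fibre of \<open>x\<close> are disjoint in \<open>Z v\<close>, and the n-fold shift maps each
  of them onto the same cylinder \<open>?C\<close> of positive mass. Each summand of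
  \<open>W n (Z v) x\<close> is therefore comparable to the mass of its cylinder, up to
  exp(n\<epsilon>).\<close>

theorem weight_pressure_at_le:
  assumes h: "weight h" and A: "A \<in> K" "h A \<noteq> 0" and x: "x \<in> X"
  shows "pressure_at G (\<lambda>x. - \<phi> x) x \<le> 0"
proof (rule ereal_le_epsilon2)
  fix \<epsilon> :: real assume e: "\<epsilon> > 0"
  obtain N where N: "\<forall>x\<in>X. \<forall>y\<in>X. (\<forall>i<N. x i = y i) \<longrightarrow> \<bar>\<phi> x - \<phi> y\<bar> \<le> \<epsilon>" using osc[OF e] by blast
  \<comment> \<open>\<open>N\<close> edges serve the oscillation bound; the successor keeps every
    cylinder inside a single \<open>Z v\<close>, also for \<open>n = 0\<close>.\<close>
  define k where "k = Suc N"
  let ?C = "cyl k x"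
  have hC: "h ?C > 0" using weight_cyl_pos[OF h A x] by (simp add: k_def)
  have "pressure_at G (\<lambda>x. - \<phi> x) x \<le> ereal (ln (exp \<epsilon>))"
  proof (rule pressure_at_le[OF x])
    fix v assume "v \<in> verts G"
    have "W n (Z v) x \<le> (h (Z v) / h ?C) * exp \<epsilon> ^ n" for n
    proof -
      let ?F = "{y. y \<in> Z v \<and> (\<sigma> ^^ n) y = x}"
      have fin: "finite ?F" by (rule finite_fibre[OF Z_K])
      have cK: "cyl (n + k) y \<in> K" for y by (rule cyl_K) (simp add: k_def)
      have le: "exp (- birkhoff \<phi> n y) * h ?C \<le> exp \<epsilon> ^ n * h (cyl (n + k) y)" if y: "y \<in> ?F" for y
      proof -
        have yX: "y \<in> X" using y Z_subset by blast
        have "tail G (y n) = tail G (x 0)" using y by (auto simp: shift_funpow)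
        then have img: "(\<sigma> ^^ n) ` cyl (n + k) y = ?C"
          using shift_funpow_cyl[OF yX, of n k] y by (auto simp: k_def cyl_def Z_def)
        have b: "\<bar>birkhoff \<phi> n z - birkhoff \<phi> n y\<bar> \<le> real n * \<epsilon>" if "z \<in> cyl (n + k) y" for z
          using that yX by (intro birkhoff_osc[OF N]) (auto simp: cyl_def k_def)
        have bb: "birkhoff \<phi> n y - real n * \<epsilon> \<le> birkhoff \<phi> n z"
          "birkhoff \<phi> n z \<le> birkhoff \<phi> n y + real n * \<epsilon>" if "z \<in> cyl (n + k) y" for z
          using b[OF that] by linarith+
        have "h ((\<sigma> ^^ n) ` cyl (n + k) y) \<le> exp (birkhoff \<phi> n y + real n * \<epsilon>) * h (cyl (n + k) y)"
          using weight_nstep[OF h cK inj_on_shift_cyl bb] by simp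
        then have "exp (- birkhoff \<phi> n y) * h ?C \<le>
            exp (- birkhoff \<phi> n y) * (exp (birkhoff \<phi> n y + real n * \<epsilon>) * h (cyl (n + k) y))"
          unfolding img by (intro mult_left_mono) auto
        also have "\<dots> = exp \<epsilon> ^ n * h (cyl (n + k) y)"
          by (simp add: mult.assoc[symmetric] exp_of_nat_mult flip: exp_add)
        finally show ?thesis .
      qed
      have "W n (Z v) x * h ?C = (\<Sum>y\<in>?F. exp (- birkhoff \<phi> n y) * h ?C)"
        by (simp add: W_def sum_distrib_right)
      also have "\<dots> \<le> (\<Sum>y\<in>?F. exp \<epsilon> ^ n * h (cyl (n + k) y))" using le by (rule sum_mono)
      also have "\<dots> = exp \<epsilon> ^ n * (\<Sum>y\<in>?F. h (cyl (n + k) y))" by (simp add: sum_distrib_left)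
      also have "(\<Sum>y\<in>?F. h (cyl (n + k) y)) = h (\<Union>y\<in>?F. cyl (n + k) y)"
      proof (rule weight_UN[OF h fin _ cK, symmetric])
        show "disjoint_family_on (cyl (n + k)) ?F"
          unfolding disjoint_family_on_def
        proof (intro ballI impI)
          fix y z assume yz: "y \<in> ?F" "z \<in> ?F" "y \<noteq> z"
          show "cyl (n + k) y \<inter> cyl (n + k) z = {}"
          proof (rule ccontr)
            assume "cyl (n + k) y \<inter> cyl (n + k) z \<noteq> {}"
            then have "\<And>i. i < n \<Longrightarrow> y i = z i" by (fastforce simp: cyl_def)
            then have "splice n y x = splice n z x" by (auto simp: splice_def)
            then show False using yz splice_self[of n y] splice_self[of n z] by auto
          qed
        qed
      qed
      also have "\<dots> \<le> h (Z v)"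
        by (rule weight_mono[OF h K_UNION[OF fin cK] Z_K]) (auto simp: cyl_def Z_def k_def)
      finally have "W n (Z v) x * h ?C \<le> exp \<epsilon> ^ n * h (Z v)" by simp
      then show ?thesis using hC by (simp add: field_simps)
    qed
    then show "\<exists>M. \<forall>n. W n (Z v) x \<le> M * exp \<epsilon> ^ n" by blast
  qed simp
  then show "pressure_at G (\<lambda>x. - \<phi> x) x \<le> 0 + ereal \<epsilon>" by simp
qed

subsection \<open>Non-wandering vertices\<close>

lemma finite_path_append: "finite_path G u \<mu> v \<Longrightarrow> finite_path G v \<nu> w \<Longrightarrow> finite_path G u (\<mu> @ \<nu>) w"
  unfolding finite_path_def by (auto intro: awalk_appendI)

lemma finite_path_arc: "e \<in> arcs G \<Longrightarrow> finite_path G (tail G e) [e] (head G e)"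
  by (simp add: finite_path_def awalk_simps)

text \<open>The complement of the set of vertices leading to \<open>v\<close> is saturated, and
  \<open>v\<close> leads back to itself, so some infinite path from \<open>v\<close> visits only
  vertices that lead to \<open>v\<close>. Cofinality connects \<open>w\<close> to this path.\<close>

lemma NW_reachable:
  assumes v: "v \<in> NW G" and w: "w \<in> verts G" shows "\<exists>\<mu>. finite_path G w \<mu> v"
proof -
  let ?R = "{u. \<exists>\<mu>. finite_path G u \<mu> v}"
  have vR: "v \<in> ?R" and vv: "v \<in> verts G" using v by (auto simp: NW_def)
  have "\<exists>p\<in>X. \<forall>i. tail G (p i) \<in> ?R"
  proof (rule avoiding_path[OF vv, of "- ?R"])
    show "v \<notin> - ?R" using vR by simp
    show "u \<in> - ?R" if u: "\<And>e. e \<in> out_arcs G u \<Longrightarrow> head G e \<in> - ?R" for u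
    proof
      assume "u \<in> ?R"
      then obtain \<mu> where \<mu>: "awalk u \<mu> v" "\<mu> \<noteq> []" by (auto simp: finite_path_def)
      then obtain e \<nu> where e: "\<mu> = e # \<nu>" by (cases \<mu>) auto
      then have en: "e \<in> out_arcs G u" "awalk (head G e) \<nu> v" using \<mu> by (auto simp: awalk_Cons_iff)
      have "head G e \<in> ?R"
      proof (cases "\<nu> = []")
        case True then show ?thesis using en vR by (simp add: awalk_Nil_iff)
      next
        case False then show ?thesis using en by (auto simp: finite_path_def)
      qed
      then show False using u[OF en(1)] by simp
    qed
  qed auto
  then obtain p where p: "p \<in> X" "\<forall>i. tail G (p i) \<in> ?R" by blast
  obtain \<mu> i where "finite_path G w \<mu> (tail G (p i))" using cofinalD[OF w p(1)] by blast
  moreover obtain \<nu> where "finite_path G (tail G (p i)) \<nu> v" using p(2) by blast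
  ultimately show ?thesis using finite_path_append by blast
qed

lemma NW_verts: "NW G \<subseteq> verts G"
  by (auto simp: NW_def)

text \<open>The range of the edge leads back to its source by \<open>NW_reachable\<close>, which
  closes a loop.\<close>

lemma NW_hereditary:
  assumes e: "e \<in> arcs G" "tail G e \<in> NW G" shows "head G e \<in> NW G"
proof -
  obtain \<mu> where "finite_path G (head G e) \<mu> (tail G e)" using NW_reachable[OF e(2)] e(1) by fastforce
  then have "finite_path G (head G e) (\<mu> @ [e]) (head G e)"
    by (rule finite_path_append[OF _ finite_path_arc[OF e(1)]])
  then show ?thesis using e(1) by (auto simp: NW_def)
qed

lemma NW_path: "x \<in> X \<Longrightarrow> tail G (x 0) \<in> NW G \<Longrightarrow> tail G (x n) \<in> NW G"
proof (induction n)
  case (Suc n)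
  then show ?case using NW_hereditary[OF X_arcs, of x n] X_head[of x n] by simp
qed

text \<open>By heredity, the requirement that every edge has its source in \<open>NW G\<close>
  reduces to the first edge.\<close>

lemma infinite_paths_NW_graph: "infinite_paths (NW_graph G) = {x \<in> X. tail G (x 0) \<in> NW G}"
  using NW_path by (auto simp: infinite_paths_def NW_graph_def)

lemma return_NW:
  assumes "y \<in> X" "n > 0" "tail G (y n) = tail G (y 0)" shows "tail G (y 0) \<in> NW G"
  using path_prefix_finite_path[OF assms(1,2)] assms X_tail_verts by (auto simp: NW_def)

subsection \<open>Existence of weights\<close>

text \<open>Each \<open>Z v\<close> contains at most one of the points, so the mass at
  \<open>x k\<close> is eventually absent from \<open>Z v\<close> and no growth of the normalising
  factors is required. Their positivity comes from \<open>reach\<close>.\<close>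

lemma weight_from_escaping_points:
  fixes q :: "nat \<Rightarrow> real" and x :: "nat \<Rightarrow> nat \<Rightarrow> 'b"
  assumes v0: "v0 \<in> verts G" and x: "\<And>k. x k \<in> X"
    and q: "\<And>k. 1/2 \<le> q k" "\<And>k. q k \<le> 1" "q \<longlonglongrightarrow> 1"
    and summ: "\<And>k v. v \<in> verts G \<Longrightarrow> summable (\<lambda>n. q k ^ n * W n (Z v) (x k))"
    and reach: "\<And>k. \<exists>n. \<exists>y\<in>Z v0. (\<sigma> ^^ n) y = x k"
    and escape: "\<And>v i j. x i \<in> Z v \<Longrightarrow> x j \<in> Z v \<Longrightarrow> i = j"
  shows "\<exists>h. weight h \<and> h (Z v0) = 1"
proof (rule weight_from_approximants[OF v0 x q summ refl])
  fix k
  obtain n y where y: "y \<in> Z v0" "(\<sigma> ^^ n) y = x k" using reach by blast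
  have q0: "0 < q k" using q(1)[of k] by linarith
  have "0 < q k ^ n * W n (Z v0) (x k)" using W_pos[OF Z_K y] q0 by simp
  then show "0 < (\<Sum>n. q k ^ n * W n (Z v0) (x k))"
    using q0 W_nonneg by (intro suminf_pos2[OF summ[OF v0]]) auto
next
  fix v
  have "eventually (\<lambda>k. x k \<notin> Z v) sequentially"
  proof (cases "\<exists>i. x i \<in> Z v")
    case True
    then obtain i where "x i \<in> Z v" by blast
    then have "x k \<notin> Z v" if "k > i" for k using escape that by blast
    then show ?thesis using eventually_gt_at_top[of i] by (rule eventually_mono[rotated])
  qed simp
  then show "(\<lambda>k. if x k \<in> Z v then 1 / (\<Sum>n. q k ^ n * W n (Z v0) (x k)) else 0) \<longlonglongrightarrow> 0"
    by (intro tendsto_eventually) (auto elim: eventually_mono)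
qed

text \<open>Without loops nothing needs damping: each series has finitely many non-zero terms, so
  \<open>q = 1\<close> is allowed and pressure does not enter. The points \<open>x k\<close> lie in
  different sets \<open>Z v\<close> because \<open>p\<close> cannot visit a vertex twice.\<close>

theorem weight_exists_wandering:
  assumes NW: "NW G = {}" shows "\<exists>h v. weight h \<and> h (Z v) = 1"
proof -
  obtain v0 where v0: "v0 \<in> verts G" using verts_nonempty by blast
  obtain p where p: "p \<in> X" "tail G (p 0) = v0" using Z_nonempty[OF v0] by (auto simp: Z_def)
  have noret: "tail G (y n) \<noteq> tail G (y 0)" if "y \<in> X" "n > 0" for y n
    using return_NW[OF that] NW by auto
  define x where "x k = (\<sigma> ^^ k) p" for k
  have xX: "x k \<in> X" for k using shift_funpow_X[OF p(1)] by (simp add: x_def)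
  \<comment> \<open>Start of the induction at the initial vertex of \<open>x k\<close> itself: a
    positive number of steps leading back to it would be a loop.\<close>
  have vanish: "verts G \<subseteq> {v. \<exists>N. \<forall>n\<ge>N. W n (Z v) (x k) = 0}" for k
  proof (rule cofinal_induct[OF X_tail_verts[OF p(1), of k] _ order_refl])
    let ?S = "{v. \<exists>N. \<forall>n\<ge>N. W n (Z v) (x k) = 0}"
    have "W n (Z (tail G (p k))) (x k) = 0" if "n \<ge> 1" for n
    proof -
      have "{y. y \<in> Z (tail G (p k)) \<and> (\<sigma> ^^ n) y = x k} = {}"
      proof (rule equals0I)
        fix y assume "y \<in> {y. y \<in> Z (tail G (p k)) \<and> (\<sigma> ^^ n) y = x k}"
        then have y: "y \<in> X" "tail G (y 0) = tail G (p k)" "(\<sigma> ^^ n) y = x k" by (auto simp: Z_def)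
        then have "y n = p k" by (auto simp: x_def shift_funpow dest: fun_cong[of _ _ 0])
        then show False using noret[OF y(1), of n] y(2) that by simp
      qed
      then show ?thesis by (simp only: W_def sum.empty)
    qed
    then show "tail G (p k) \<in> ?S" by blast
    show "head G e \<in> ?S" if e: "e \<in> arcs G" "tail G e \<in> ?S" for e
    proof -
      obtain N where N: "\<forall>n\<ge>N. W n (Z (tail G e)) (x k) = 0" using e(2) by blast
      obtain b where b: "b > 0" "\<forall>n x. W n (Z (head G e)) x \<le> b * W (Suc n) (E e) x"
        using W_edge_bounds(1)[OF e(1)] by blast
      have "W n (Z (head G e)) (x k) = 0" if "n \<ge> N" for n
      proof -
        have "W (Suc n) (E e) (x k) \<le> W (Suc n) (Z (tail G e)) (x k)" by (rule W_mono[OF Z_K E_subset_Z])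
        then have "W (Suc n) (E e) (x k) = 0" using N that W_nonneg[of "Suc n" "E e" "x k"] by auto
        then show ?thesis using b(2)[rule_format, of n "x k"] W_nonneg[of n "Z (head G e)" "x k"] by simp
      qed
      then show ?thesis by blast
    qed
    show "v \<in> ?S" if v: "v \<in> verts G" "\<And>e. e \<in> out_arcs G v \<Longrightarrow> head G e \<in> ?S" for v
    proof -
      have "\<forall>e\<in>out_arcs G v. \<exists>N. \<forall>n\<ge>N. W n (Z (head G e)) (x k) = 0" using v(2) by blast
      then obtain N where N: "\<forall>e\<in>out_arcs G v. \<forall>n\<ge>N e. W n (Z (head G e)) (x k) = 0"
        by (rule bchoice[THEN exE])
      define M where "M = Max (N ` out_arcs G v)"
      have M: "N e \<le> M" if "e \<in> out_arcs G v" for e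
        using finite_out[OF v(1)] that by (simp add: M_def)
      have "W n (Z v) (x k) = 0" if n: "n \<ge> Suc M" for n
      proof -
        obtain m where m: "n = Suc m" "m \<ge> M" using n by (cases n) auto
        have "W n (E e) (x k) = 0" if e: "e \<in> out_arcs G v" for e
        proof -
          have ea: "e \<in> arcs G" using e by simp
          obtain b where b: "b > 0" "\<forall>n x. W (Suc n) (E e) x \<le> b * W n (Z (head G e)) x"
            using W_edge_bounds(2)[OF ea] by blast
          have "W m (Z (head G e)) (x k) = 0" using N e M[OF e] m(2) by auto
          then have "W n (E e) (x k) \<le> 0" using b(2)[rule_format, of m "x k"] m(1) by simp
          then show ?thesis using W_nonneg[of n "E e" "x k"] by simp
        qed
        then show ?thesis using W_Z[OF v(1)] by simp
      qed
      then show ?thesis by blast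
    qed
  qed
  have "\<exists>h. weight h \<and> h (Z v0) = 1"
  proof (rule weight_from_escaping_points[where q = "\<lambda>_. 1" and x = x, OF v0 xX])
    show "summable (\<lambda>n. 1 ^ n * W n (Z v) (x k))" if v: "v \<in> verts G" for k v
    proof -
      obtain N where "\<forall>n\<ge>N. W n (Z v) (x k) = 0" using vanish[of k] v by blast
      then show ?thesis by (intro summable_finite[of "{..<N}"]) auto
    qed
    show "\<exists>n. \<exists>y\<in>Z v0. (\<sigma> ^^ n) y = x k" for k using p by (auto simp: x_def Z_def)
    show "i = j" if ij: "x i \<in> Z v" "x j \<in> Z v" for v i j
    proof -
      have *: "\<not> i < j" if "x i \<in> Z v" "x j \<in> Z v" for i j
      proof
        assume "i < j"
        then have "tail G (x i (j - i)) = tail G (x i 0)"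
          using that by (simp add: x_def shift_funpow Z_def)
        then show False using noret[OF xX, of "j - i" i] \<open>i < j\<close> by simp
      qed
      show ?thesis using *[OF ij] *[OF ij(2,1)] by simp
    qed
  qed auto
  then show ?thesis by blast
qed

text \<open>A sequence in [1/2, 1) tending to 1. Values below 1 make -ln q positive, so that
  pressure at most 0 gives convergence; the bound 1/2 is the one demanded by
  \<open>weight_from_approximants\<close>.\<close>

definition damp :: "nat \<Rightarrow> real" where
  "damp k = 1 - 1 / (real k + 2)"

lemma damp: "1/2 \<le> damp k" "damp k < 1" "damp \<longlonglongrightarrow> 1"
proof -
  show "1/2 \<le> damp k" "damp k < 1" by (auto simp: damp_def field_simps)
  have "(\<lambda>k. 1 - 1 / (real k + 2)) \<longlonglongrightarrow> 1" by real_asymp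
  then show "damp \<longlonglongrightarrow> 1" by (simp add: damp_def[abs_def])
qed

lemma summable_damped:
  assumes p: "pressure G (\<lambda>x. - \<phi> x) \<le> 0" and x: "x \<in> X" and v: "v \<in> verts G"
  shows "summable (\<lambda>n. damp k ^ n * W n (Z v) x)"
proof (rule summable_of_pressure[OF x _ _ v])
  show d0: "damp k > 0" using damp(1)[of k] by linarith
  have "pressure_at G (\<lambda>x. - \<phi> x) x \<le> pressure G (\<lambda>x. - \<phi> x)"
    unfolding pressure_def by (rule SUP_upper[OF x])
  then have "pressure_at G (\<lambda>x. - \<phi> x) x \<le> 0" using p by (rule order_trans)
  also have "0 < ereal (- ln (damp k))" using damp(2)[of k] d0 by simp
  finally show "pressure_at G (\<lambda>x. - \<phi> x) x < ereal (- ln (damp k))" .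
qed

text \<open>Taking the vertices in \<open>NW G\<close> ensures that each of them is reached from
  \<open>f 0\<close>, which makes every normalising factor positive; being distinct, they make the
  points escape.\<close>

theorem weight_exists_infinite_NW:
  assumes NW: "infinite (NW G)" and p: "pressure G (\<lambda>x. - \<phi> x) \<le> 0"
  shows "\<exists>h v. weight h \<and> h (Z v) = 1"
proof -
  obtain f :: "nat \<Rightarrow> 'a" where f: "inj f" "range f \<subseteq> NW G"
    using infinite_countable_subset[OF NW] by blast
  have fv: "f k \<in> verts G" for k using f(2) NW_verts by blast
  have "\<forall>k. \<exists>x. x \<in> Z (f k)" using Z_nonempty[OF fv] by blast
  then obtain x where x: "\<forall>k. x k \<in> Z (f k)" by (rule choice[THEN exE])
  have xX: "x k \<in> X" for k using x Z_subset by blast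
  have tl: "tail G (x k 0) = f k" for k using x by (simp add: Z_def)
  have "\<exists>h. weight h \<and> h (Z (f 0)) = 1"
  proof (rule weight_from_escaping_points[where q = damp and x = x, OF fv xX damp(1) less_imp_le[OF damp(2)] damp(3)])
    show "summable (\<lambda>n. damp k ^ n * W n (Z v) (x k))" if "v \<in> verts G" for k v
      by (rule summable_damped[OF p xX that])
    show "\<exists>n. \<exists>y\<in>Z (f 0). (\<sigma> ^^ n) y = x k" for k
    proof -
      have "f k \<in> NW G" using f(2) by blast
      then obtain \<mu> where "finite_path G (f 0) \<mu> (f k)" using NW_reachable[OF _ fv] by blast
      then show ?thesis using finite_path_preimage[OF _ xX, of "f 0" \<mu> k] tl by metis
    qed
    show "i = j" if "x i \<in> Z v" "x j \<in> Z v" for v i j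
      using that tl f(1) by (auto simp: Z_def dest: injD)
  qed
  then show ?thesis by blast
qed

text \<open>With a fixed base point the mass at \<open>x\<close> does not move away; it becomes
  negligible because the normalising factors tend to infinity.\<close>

theorem weight_exists_recurrent:
  assumes p: "pressure G (\<lambda>x. - \<phi> x) \<le> 0" and x: "x \<in> X" and v0: "v0 \<in> verts G"
    and ns: "\<not> summable (\<lambda>n. W n (Z v0) x)"
  shows "\<exists>h v. weight h \<and> h (Z v) = 1"
proof -
  let ?c = "\<lambda>k. \<Sum>n. damp k ^ n * W n (Z v0) x"
  have d0: "0 < damp k" for k using damp(1)[of k] by linarith
  have summ: "summable (\<lambda>n. damp k ^ n * W n (Z v) x)" if "v \<in> verts G" for k v
    by (rule summable_damped[OF p x that])
  have top: "filterlim ?c at_top sequentially"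
    using d0 by (intro suminf_damped_tendsto_at_top ns W_nonneg damp(3) summ v0) (auto intro: less_imp_le)
  have "\<exists>n. W n (Z v0) x \<noteq> 0"
  proof (rule ccontr)
    assume "\<nexists>n. W n (Z v0) x \<noteq> 0"
    then have "(\<lambda>n. W n (Z v0) x) = (\<lambda>_. 0)" by auto
    then show False using ns by simp
  qed
  then obtain i where "W i (Z v0) x > 0" using W_nonneg by (metis less_eq_real_def)
  then have c_pos: "0 < ?c k" for k
    using d0[of k] W_nonneg by (intro suminf_pos2[OF summ[OF v0], of _ i]) auto
  have inv: "(\<lambda>k. 1 / ?c k) \<longlonglongrightarrow> 0"
    using tendsto_inverse_0_at_top[OF top] by (simp add: inverse_eq_divide)
  have "\<exists>h. weight h \<and> h (Z v0) = 1"
  proof (rule weight_from_approximants[where q = damp and x = "\<lambda>_. x" and c = ?c,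
        OF v0 x damp(1) less_imp_le[OF damp(2)] damp(3) summ refl c_pos])
    fix v
    show "(\<lambda>k. if x \<in> Z v then 1 / ?c k else 0) \<longlonglongrightarrow> 0" using inv by (cases "x \<in> Z v") simp_all
  qed
  then show ?thesis by blast
qed

subsection \<open>Bowen's condition\<close>

text \<open>Bowen's condition restated for paths of \<open>G\<close> that start in
  \<open>NW G\<close>, with \<open>n = 0\<close> included.\<close>

definition bowen_bound :: "real \<Rightarrow> bool" where
  "bowen_bound C \<longleftrightarrow> 0 \<le> C \<and> (\<forall>n x y. x \<in> X \<longrightarrow> y \<in> X \<longrightarrow> tail G (x 0) \<in> NW G \<longrightarrow> tail G (y 0) \<in> NW G \<longrightarrow>
     (\<forall>i<n. x i = y i) \<longrightarrow> \<bar>birkhoff \<phi> n x - birkhoff \<phi> n y\<bar> \<le> C)"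

lemma bowen_boundD:
  assumes "bowen_bound C" "x \<in> X" "y \<in> X" "tail G (x 0) \<in> NW G" "tail G (y 0) \<in> NW G"
    "\<And>i. i < n \<Longrightarrow> x i = y i"
  shows "\<bar>birkhoff \<phi> n x - birkhoff \<phi> n y\<bar> \<le> C"
  using assms unfolding bowen_bound_def by blast

lemma bowen_condition_bound:
  assumes "bowen_condition (NW_graph G) \<phi>" shows "\<exists>C. bowen_bound C"
proof -
  obtain C where C: "C > 0" "\<forall>n\<ge>1. \<forall>x\<in>infinite_paths (NW_graph G). \<forall>y\<in>infinite_paths (NW_graph G).
      (\<forall>i<n. x i = y i) \<longrightarrow> \<bar>\<Sum>i<n. \<phi> ((\<sigma> ^^ i) x) - \<phi> ((\<sigma> ^^ i) y)\<bar> \<le> C"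
    using assms unfolding bowen_condition_def by blast
  have "\<bar>birkhoff \<phi> n x - birkhoff \<phi> n y\<bar> \<le> C"
    if "x \<in> X" "y \<in> X" "tail G (x 0) \<in> NW G" "tail G (y 0) \<in> NW G" "\<forall>i<n. x i = y i" for n x y
  proof (cases "n = 0")
    case False
    then have "n \<ge> 1" by simp
    then have "\<bar>\<Sum>i<n. \<phi> ((\<sigma> ^^ i) x) - \<phi> ((\<sigma> ^^ i) y)\<bar> \<le> C"
      using C(2) that unfolding infinite_paths_NW_graph by blast
    then show ?thesis by (simp add: birkhoff_def sum_subtractf)
  qed (use C(1) in simp)
  then have "bowen_bound C" unfolding bowen_bound_def using C(1) by simp
  then show ?thesis ..
qed

lemma cyl_full: "n > 0 \<Longrightarrow> x \<in> X \<Longrightarrow> (\<sigma> ^^ n) ` cyl n x = Z (tail G (x n))"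
  using shift_funpow_cyl[of x n 0] by (auto simp: cyl_def Z_def)

text \<open>The Gibbs property: cylinder masses are determined by Birkhoff sums and vertex masses,
  up to a factor exp(C) that does not depend on the length \<open>n\<close>.\<close>

lemma weight_bowen_cyl:
  assumes h: "weight h" and C: "bowen_bound C" and y: "y \<in> X" "tail G (y 0) \<in> NW G" and n: "n > 0"
  shows "exp (birkhoff \<phi> n y - C) * h (cyl n y) \<le> h (Z (tail G (y n)))"
    "h (Z (tail G (y n))) \<le> exp (birkhoff \<phi> n y + C) * h (cyl n y)"
proof -
  have b: "\<bar>birkhoff \<phi> n z - birkhoff \<phi> n y\<bar> \<le> C" if z: "z \<in> cyl n y" for z
  proof (rule bowen_boundD[OF C _ y(1)])
    show "tail G (z 0) \<in> NW G" using z y(2) n by (simp add: cyl_def)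
  qed (use z y in \<open>auto simp: cyl_def\<close>)
  have bb: "birkhoff \<phi> n y - C \<le> birkhoff \<phi> n z" "birkhoff \<phi> n z \<le> birkhoff \<phi> n y + C" if "z \<in> cyl n y" for z
    using b[OF that] by linarith+
  have "inj_on (\<sigma> ^^ n) (cyl n y)" using inj_on_shift_cyl[of n 0 y] by simp
  from weight_nstep[OF h cyl_K[OF n] this bb]
  show "exp (birkhoff \<phi> n y - C) * h (cyl n y) \<le> h (Z (tail G (y n)))"
    "h (Z (tail G (y n))) \<le> exp (birkhoff \<phi> n y + C) * h (cyl n y)"
    unfolding cyl_full[OF n y(1)] by simp_all
qed

lemma NW_representatives: obtains r where "\<And>u. u \<in> NW G \<Longrightarrow> r u \<in> Z u"
proof -
  have "\<forall>u\<in>NW G. \<exists>x. x \<in> Z u" using Z_nonempty NW_verts by blast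
  then obtain r where "\<forall>u\<in>NW G. r u \<in> Z u" by (rule bchoice[THEN exE])
  then show thesis by (intro that) auto
qed

text \<open>A lower bound for \<open>W n\<close> that is uniform in \<open>n\<close>: the cylinders
  around the fibres of finitely many representatives cover \<open>Z v\<close>, and the Gibbs
  property estimates their masses by the summands of \<open>W n\<close>.\<close>

lemma weight_bowen_le_W:
  assumes h: "weight h" and C: "bowen_bound C" and fin: "finite (NW G)" and v: "v \<in> NW G" and n: "n > 0"
    and r: "\<And>u. u \<in> NW G \<Longrightarrow> r u \<in> Z u"
  shows "h (Z v) \<le> exp C * (\<Sum>u\<in>NW G. h (Z u) * W n (Z v) (r u))"
proof -
  let ?F = "\<lambda>u. {y. y \<in> Z v \<and> (\<sigma> ^^ n) y = r u}"
  have finF: "finite (?F u)" for u by (rule finite_fibre[OF Z_K])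
  have UK: "(\<Union>y\<in>?F u. cyl n y) \<in> K" for u using finF cyl_K[OF n] by (intro K_UNION)
  have "Z v \<subseteq> (\<Union>u\<in>NW G. \<Union>y\<in>?F u. cyl n y)"
  proof
    fix z assume z: "z \<in> Z v"
    then have zX: "z \<in> X" "tail G (z 0) = v" by (auto simp: Z_def)
    define u where "u = tail G (z n)"
    have u: "u \<in> NW G" using NW_path[OF zX(1)] zX(2) v by (simp add: u_def)
    \<comment> \<open>Keep the first \<open>n\<close> edges of \<open>z\<close> and continue with
      the representative of the vertex reached; the result lies in a fibre and in the same
      n-cylinder as \<open>z\<close>.\<close>
    let ?y = "splice n z (r u)"
    have "?y \<in> X" using r[OF u] by (intro splice_X zX) (auto simp: Z_def u_def)
    then have "?y \<in> ?F u" using zX n by (simp add: Z_def splice_agree)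
    moreover have "z \<in> cyl n ?y" using zX by (simp add: cyl_def splice_agree)
    ultimately show "z \<in> (\<Union>u\<in>NW G. \<Union>y\<in>?F u. cyl n y)" using u by blast
  qed
  then have "h (Z v) \<le> h (\<Union>u\<in>NW G. \<Union>y\<in>?F u. cyl n y)"
    by (intro weight_mono[OF h] K_UNION fin UK Z_K)
  also have "\<dots> \<le> (\<Sum>u\<in>NW G. h (\<Union>y\<in>?F u. cyl n y))" by (rule weight_UN_le[OF h fin UK])
  also have "\<dots> \<le> (\<Sum>u\<in>NW G. \<Sum>y\<in>?F u. h (cyl n y))"
    by (intro sum_mono weight_UN_le[OF h finF cyl_K[OF n]])
  also have "\<dots> \<le> (\<Sum>u\<in>NW G. \<Sum>y\<in>?F u. exp C * (h (Z u) * exp (- birkhoff \<phi> n y)))"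
  proof (intro sum_mono)
    fix u y assume u: "u \<in> NW G" and y: "y \<in> ?F u"
    have yX: "y \<in> X" "tail G (y 0) \<in> NW G" using y v by (auto simp: Z_def)
    have "y n = r u 0" using y by (auto simp: shift_funpow dest: fun_cong[of _ _ 0])
    then have "tail G (y n) = u" using r[OF u] by (simp add: Z_def)
    then have "exp (C - birkhoff \<phi> n y) * (exp (birkhoff \<phi> n y - C) * h (cyl n y)) \<le>
        exp (C - birkhoff \<phi> n y) * h (Z u)"
      using weight_bowen_cyl(1)[OF h C yX n] by (intro mult_left_mono) auto
    then have "h (cyl n y) \<le> exp (C - birkhoff \<phi> n y) * h (Z u)"
      by (simp add: mult.assoc[symmetric] flip: exp_add)
    then show "h (cyl n y) \<le> exp C * (h (Z u) * exp (- birkhoff \<phi> n y))"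
      by (simp add: exp_diff exp_minus field_simps)
  qed
  also have "\<dots> = exp C * (\<Sum>u\<in>NW G. h (Z u) * W n (Z v) (r u))"
    by (simp add: W_def sum_distrib_left)
  finally show ?thesis .
qed

text \<open>At negative pressure the series converge undamped, so \<open>W n (Z v)\<close> tends to
  0 at the finitely many representatives. By \<open>weight_bowen_le_W\<close> this would force
  \<open>h (Z v) = 0\<close>.\<close>

theorem weight_pressure_nonneg:
  assumes h: "weight h" and A: "A \<in> K" "h A \<noteq> 0"
    and fin: "finite (NW G)" and ne: "NW G \<noteq> {}" and C: "bowen_bound C"
  shows "0 \<le> pressure G (\<lambda>x. - \<phi> x)"
proof (rule ccontr)
  assume "\<not> 0 \<le> pressure G (\<lambda>x. - \<phi> x)"
  then have neg: "pressure G (\<lambda>x. - \<phi> x) < 0" by simp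
  obtain v where v: "v \<in> NW G" using ne by blast
  have vv: "v \<in> verts G" using v NW_verts by blast
  obtain r where r: "\<And>u. u \<in> NW G \<Longrightarrow> r u \<in> Z u" using NW_representatives by blast
  have lim: "(\<lambda>n. W n (Z v) (r u)) \<longlonglongrightarrow> 0" if u: "u \<in> NW G" for u
  proof -
    have x: "r u \<in> X" using r[OF u] Z_subset by blast
    have "pressure_at G (\<lambda>x. - \<phi> x) (r u) \<le> pressure G (\<lambda>x. - \<phi> x)"
      unfolding pressure_def by (rule SUP_upper[OF x])
    from le_less_trans[OF this neg] have "pressure_at G (\<lambda>x. - \<phi> x) (r u) < ereal (- ln 1)"
      by (simp add: zero_ereal_def)
    from summable_of_pressure[OF x _ this vv] show ?thesis by (simp add: summable_LIMSEQ_zero)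
  qed
  have "(\<lambda>n. exp C * (\<Sum>u\<in>NW G. h (Z u) * W n (Z v) (r u))) \<longlonglongrightarrow> exp C * (\<Sum>u\<in>NW G. h (Z u) * 0)"
    by (intro tendsto_intros lim)
  then have "(\<lambda>n. exp C * (\<Sum>u\<in>NW G. h (Z u) * W n (Z v) (r u))) \<longlonglongrightarrow> 0" by simp
  moreover have "eventually (\<lambda>n. h (Z v) \<le> exp C * (\<Sum>u\<in>NW G. h (Z u) * W n (Z v) (r u))) sequentially"
    using eventually_gt_at_top[of 0]
    by (rule eventually_mono) (rule weight_bowen_le_W[OF h C fin v _ r])
  ultimately have "h (Z v) \<le> 0" by (rule tendsto_lowerbound) simp
  then show False using weight_Z_pos[OF h A vv] by simp
qed

section \<open>Recurrence from non-negative pressure\<close>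

text \<open>Both base points start at \<open>u\<close>, so replacing the tail \<open>y\<close> by
  \<open>y'\<close> after \<open>n\<close> edges maps one fibre injectively into the other and
  changes Birkhoff sums by at most \<open>C\<close>.\<close>

lemma W_bowen:
  assumes C: "bowen_bound C" and v: "v \<in> NW G" and y: "y \<in> Z u" "y' \<in> Z u" and n: "n > 0"
  shows "W n (Z v) y \<le> exp C * W n (Z v) y'"
proof -
  let ?F = "\<lambda>y. {z. z \<in> Z v \<and> (\<sigma> ^^ n) z = y}"
  have sp: "splice n z y' \<in> ?F y'" "exp (- birkhoff \<phi> n z) \<le> exp C * exp (- birkhoff \<phi> n (splice n z y'))"
    if z: "z \<in> ?F y" for z
  proof -
    have zX: "z \<in> X" "tail G (z 0) = v" using z by (auto simp: Z_def)
    have "tail G (z n) = u" using z y(1) by (auto simp: Z_def shift_funpow)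
    then have sX: "splice n z y' \<in> X" using y(2) by (intro splice_X zX) (auto simp: Z_def)
    then show "splice n z y' \<in> ?F y'" using zX n by (simp add: Z_def splice_agree)
    have "\<bar>birkhoff \<phi> n z - birkhoff \<phi> n (splice n z y')\<bar> \<le> C"
      by (rule bowen_boundD[OF C zX(1) sX]) (use zX v n in \<open>auto simp: splice_agree\<close>)
    then show "exp (- birkhoff \<phi> n z) \<le> exp C * exp (- birkhoff \<phi> n (splice n z y'))"
      unfolding exp_add[symmetric] by simp
  qed
  have inj: "inj_on (\<lambda>z. splice n z y') (?F y)"
  proof (rule inj_onI)
    fix z w assume zw: "z \<in> ?F y" "w \<in> ?F y" "splice n z y' = splice n w y'"
    have "z i = w i" if "i < n" for i using fun_cong[OF zw(3), of i] that by (simp add: splice_agree)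
    then have "splice n z y = splice n w y" by (auto simp: splice_def)
    then show "z = w" using zw(1,2) splice_self[of n z] splice_self[of n w] by auto
  qed
  have "W n (Z v) y \<le> (\<Sum>z\<in>?F y. exp C * exp (- birkhoff \<phi> n (splice n z y')))"
    unfolding W_def by (rule sum_mono) (rule sp(2))
  also have "\<dots> = exp C * (\<Sum>z\<in>(\<lambda>z. splice n z y') ` ?F y. exp (- birkhoff \<phi> n z))"
    using inj by (simp add: sum.reindex sum_distrib_left)
  also have "\<dots> \<le> exp C * W n (Z v) y'"
    unfolding W_def using sp(1) by (intro mult_left_mono sum_mono2 finite_fibre Z_K) auto
  finally show ?thesis .
qed

text \<open>The (N+n)-fibre is grouped by N-fold shifts. These stay in \<open>Y\<close>, so each
  group contributes at most \<open>c\<close> times the weight of a point of the n-fibre.\<close>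

lemma W_submultiplicative:
  assumes Y: "Y \<in> K" "\<sigma> ` Y \<subseteq> Y" and c: "\<And>w. w \<in> Y \<Longrightarrow> W N Y w \<le> c"
  shows "W (N + n) Y x \<le> c * W n Y x"
proof -
  let ?S = "{z. z \<in> Y \<and> (\<sigma> ^^ (N + n)) z = x}"
  let ?g = "\<lambda>z. exp (- birkhoff \<phi> (N + n) z)"
  have comp: "(\<sigma> ^^ (N + n)) z = (\<sigma> ^^ n) ((\<sigma> ^^ N) z)" for z by (simp add: add.commute[of N n] funpow_add)
  have stay: "(\<sigma> ^^ N) z \<in> Y" if "z \<in> Y" for z
    using that Y(2) by (induction N) auto
  have fS: "finite ?S" by (rule finite_fibre[OF Y(1)])
  have "W (N + n) Y x = (\<Sum>w\<in>(\<sigma> ^^ N) ` ?S. \<Sum>z | z \<in> ?S \<and> (\<sigma> ^^ N) z = w. ?g z)"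
    unfolding W_def by (rule sum.image_gen[OF fS])
  also have "\<dots> = (\<Sum>w\<in>(\<sigma> ^^ N) ` ?S. exp (- birkhoff \<phi> n w) * W N Y w)"
  proof (rule sum.cong[OF refl])
    fix w assume w: "w \<in> (\<sigma> ^^ N) ` ?S"
    then have "(\<sigma> ^^ n) w = x" using comp by auto
    then have "{z. z \<in> ?S \<and> (\<sigma> ^^ N) z = w} = {z. z \<in> Y \<and> (\<sigma> ^^ N) z = w}" using comp by auto
    then have "(\<Sum>z | z \<in> ?S \<and> (\<sigma> ^^ N) z = w. ?g z) = (\<Sum>z | z \<in> Y \<and> (\<sigma> ^^ N) z = w. ?g z)" by simp
    also have "\<dots> = (\<Sum>z | z \<in> Y \<and> (\<sigma> ^^ N) z = w. exp (- birkhoff \<phi> n w) * exp (- birkhoff \<phi> N z))"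
      by (intro sum.cong refl) (auto simp: birkhoff_add simp flip: exp_add)
    finally show "(\<Sum>z | z \<in> ?S \<and> (\<sigma> ^^ N) z = w. ?g z) = exp (- birkhoff \<phi> n w) * W N Y w"
      by (simp add: W_def sum_distrib_left)
  qed
  also have "\<dots> \<le> (\<Sum>w\<in>(\<sigma> ^^ N) ` ?S. exp (- birkhoff \<phi> n w) * c)"
    using c stay by (intro sum_mono mult_left_mono) auto
  also have "\<dots> = c * (\<Sum>w\<in>(\<sigma> ^^ N) ` ?S. exp (- birkhoff \<phi> n w))"
    by (simp add: sum_distrib_left mult.commute)
  \<comment> \<open>The sign of \<open>c\<close> is known only through a point of \<open>Y\<close>,
    hence the case distinctions.\<close>
  also have "\<dots> \<le> c * W n Y x"
  proof (cases "?S = {}")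
    case True
    have "0 \<le> c * W n Y x"
    proof (cases "Y = {}")
      case True then show ?thesis by (simp add: W_def)
    next
      case False
      then obtain w where "w \<in> Y" by blast
      then have "0 \<le> c" using c[of w] W_nonneg[of N Y w] by linarith
      then show ?thesis using W_nonneg by simp
    qed
    then show ?thesis unfolding True by simp
  next
    case False
    then obtain z where "z \<in> ?S" by blast
    then have "0 \<le> c" using c[OF stay, of z] W_nonneg[of N Y "(\<sigma> ^^ N) z"] by simp
    moreover have "(\<Sum>w\<in>(\<sigma> ^^ N) ` ?S. exp (- birkhoff \<phi> n w)) \<le> W n Y x"
      unfolding W_def using stay comp by (intro sum_mono2 finite_fibre Y(1)) auto
    ultimately show ?thesis by (rule mult_left_mono[rotated])
  qed
  finally show ?thesis .
qed

text \<open>Going backwards along an edge costs one step, hence a factor 1/\<theta> in the constant.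
  Only this direction is needed, as the hypothesis covers the hereditary set
  \<open>NW G\<close>.\<close>

lemma W_decay_saturate:
  assumes ne: "NW G \<noteq> {}" and th: "\<theta> > 0"
    and NW: "\<And>v. v \<in> NW G \<Longrightarrow> \<exists>M. \<forall>n. W n (Z v) x \<le> M * \<theta> ^ n" and v: "v \<in> verts G"
  shows "\<exists>M. \<forall>n. W n (Z v) x \<le> M * \<theta> ^ n"
proof -
  let ?S = "{v. \<exists>M. \<forall>n. W n (Z v) x \<le> M * \<theta> ^ n}"
  obtain v0 where v0: "v0 \<in> NW G" using ne by blast
  have "verts G \<subseteq> ?S"
  proof (rule cofinal_induct[of v0 "NW G"])
    show "v0 \<in> verts G" "v0 \<in> NW G" using v0 NW_verts by auto
    show "NW G \<subseteq> ?S" using NW by blast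
    show "head G e \<in> NW G" if "e \<in> arcs G" "tail G e \<in> NW G" for e using NW_hereditary that .
    show "u \<in> ?S" if u: "u \<in> verts G" "\<And>e. e \<in> out_arcs G u \<Longrightarrow> head G e \<in> ?S" for u
    proof -
      have "\<exists>M. \<forall>n. W n (E e) x \<le> M * \<theta> ^ n" if e: "e \<in> out_arcs G u" for e
      proof -
        obtain M where M: "\<forall>n. W n (Z (head G e)) x \<le> M * \<theta> ^ n" using u(2)[OF e] by blast
        have ea: "e \<in> arcs G" using e by simp
        obtain b where b: "b > 0" "\<forall>n x. W (Suc n) (E e) x \<le> b * W n (Z (head G e)) x"
          using W_edge_bounds(2)[OF ea] by blast
        have "W n (E e) x \<le> max 1 (b * M / \<theta>) * \<theta> ^ n" for n
        proof (cases n)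
          case 0 then show ?thesis by (auto simp: W_0 le_max_iff_disj)
        next
          case (Suc m)
          have "W n (E e) x \<le> b * W m (Z (head G e)) x" using b(2) Suc by blast
          also have "\<dots> \<le> b * (M * \<theta> ^ m)" using M b(1) by (intro mult_left_mono) auto
          also have "\<dots> = b * M / \<theta> * \<theta> ^ n" using th Suc by simp
          also have "\<dots> \<le> max 1 (b * M / \<theta>) * \<theta> ^ n" using th by (intro mult_right_mono) auto
          finally show ?thesis .
        qed
        then show ?thesis by blast
      qed
      then have "\<forall>e\<in>out_arcs G u. \<exists>M. \<forall>n. W n (E e) x \<le> M * \<theta> ^ n" by blast
      then obtain M where M: "\<forall>e\<in>out_arcs G u. \<forall>n. W n (E e) x \<le> M e * \<theta> ^ n" by (rule bchoice[THEN exE])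
      have "W n (Z u) x \<le> (\<Sum>e\<in>out_arcs G u. M e) * \<theta> ^ n" for n
        unfolding W_Z[OF u(1)] sum_distrib_right by (rule sum_mono) (use M in blast)
      then show ?thesis by blast
    qed
  qed
  then show ?thesis using v by blast
qed

text \<open>If all series converged, their terms would tend to 0 at finitely many representatives,
  hence by \<open>W_bowen\<close> uniformly on the compact invariant set \<open>?Y\<close>. A single
  \<open>N\<close> with \<open>W N ?Y\<close> at most 1/2 on \<open>?Y\<close> then gives
  exponential decay everywhere, and the pressure would be negative.\<close>

theorem recurrent_of_pressure_nonneg:
  assumes fin: "finite (NW G)" and ne: "NW G \<noteq> {}" and C: "bowen_bound C"
    and p: "0 \<le> pressure G (\<lambda>x. - \<phi> x)"
  shows "\<exists>v\<in>verts G. \<exists>x\<in>X. \<not> summable (\<lambda>n. W n (Z v) x)"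
proof (rule ccontr)
  assume "\<not> ?thesis"
  then have summ: "summable (\<lambda>n. W n (Z v) x)" if "v \<in> verts G" "x \<in> X" for v x using that by blast
  obtain r where r: "\<And>u. u \<in> NW G \<Longrightarrow> r u \<in> Z u" using NW_representatives by blast
  define f where "f n = (\<Sum>u\<in>NW G. \<Sum>v\<in>NW G. W n (Z v) (r u))" for n
  have "f \<longlonglongrightarrow> (\<Sum>u\<in>NW G. \<Sum>v\<in>NW G. 0)"
    unfolding f_def using r NW_verts Z_subset
    by (intro tendsto_sum summable_LIMSEQ_zero summ) blast+
  then have "f \<longlonglongrightarrow> 0" by simp
  then have "(\<lambda>n. exp C * f n) \<longlonglongrightarrow> 0" by (rule tendsto_mult_right_zero)
  then have "eventually (\<lambda>n. exp C * f n < 1/2) sequentially" by (rule order_tendstoD(2)) simp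
  then have "eventually (\<lambda>n. exp C * f n < 1/2 \<and> n > 0) sequentially"
    using eventually_gt_at_top[of 0] by (rule eventually_conj)
  \<comment> \<open>Any bound below 1 in place of 1/2 would serve. \<open>f\<close> sums over all
    representatives, so one \<open>N\<close> works for all of them; the factor exp(C) pays for
    leaving the representatives.\<close>
  then obtain N where N: "exp C * f N < 1/2" "N > 0" by (auto simp: eventually_sequentially)
  let ?Y = "\<Union>v\<in>NW G. Z v"
  have Y: "?Y \<in> K" using fin by (intro K_UNION) auto
  have stay: "\<sigma> ` ?Y \<subseteq> ?Y"
  proof
    fix y assume "y \<in> \<sigma> ` ?Y"
    then obtain x where x: "x \<in> X" "tail G (x 0) \<in> NW G" "y = \<sigma> x" by (auto simp: Z_def)
    then have "tail G (y 0) \<in> NW G" using NW_path[OF x(1,2), of 1] by (simp add: path_shift_def)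
    then show "y \<in> ?Y" using shift_X[OF x(1)] x(3) by (simp add: Z_def)
  qed
  have W_Y: "W n ?Y y = (\<Sum>v\<in>NW G. W n (Z v) y)" for n y
    using fin disjoint_Z by (intro W_UN) auto
  have small: "W N ?Y y \<le> 1/2" if y: "y \<in> ?Y" for y
  proof -
    obtain u where u: "u \<in> NW G" "y \<in> Z u" using y by blast
    have "W N ?Y y \<le> (\<Sum>v\<in>NW G. exp C * W N (Z v) (r u))"
      unfolding W_Y by (rule sum_mono) (rule W_bowen[OF C _ u(2) r[OF u(1)] N(2)])
    also have "\<dots> = exp C * (\<Sum>v\<in>NW G. W N (Z v) (r u))" by (simp add: sum_distrib_left)
    also have "\<dots> \<le> exp C * f N"
      unfolding f_def using fin u(1) W_nonneg
      by (intro mult_left_mono member_le_sum[where f = "\<lambda>u. \<Sum>v\<in>NW G. W N (Z v) (r u)"]) (auto intro: sum_nonneg)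
    finally show ?thesis using N(1) by simp
  qed
  \<comment> \<open>The decay rate per step that corresponds to halving in every \<open>N\<close>
    steps.\<close>
  define \<theta> where "\<theta> = root N (1/2)"
  have \<theta>: "0 < \<theta>" "\<theta> < 1" "\<theta> ^ N = 1/2" using N(2) by (auto simp: \<theta>_def)
  have "pressure_at G (\<lambda>x. - \<phi> x) x \<le> ereal (ln \<theta>)" if x: "x \<in> X" for x
  proof (rule pressure_at_le[OF x \<theta>(1)], rule W_decay_saturate[OF ne \<theta>(1)])
    fix v assume v: "v \<in> NW G"
    \<comment> \<open>Large enough for all \<open>n < N\<close>; from there the induction advances
      by \<open>N\<close> steps at a time.\<close>
    define M where "M = (\<Sum>i<N. W i ?Y x / \<theta> ^ i)"
    have "W n ?Y x \<le> M * \<theta> ^ n" for n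
    proof (induction n rule: less_induct)
      case (less n)
      show ?case
      proof (cases "n < N")
        case True
        have "W n ?Y x / \<theta> ^ n \<le> M"
          unfolding M_def using True \<theta>(1) W_nonneg
          by (intro member_le_sum[where f = "\<lambda>i. W i ?Y x / \<theta> ^ i"]) auto
        then show ?thesis using \<theta>(1) by (simp add: field_simps)
      next
        case False
        then have n: "n = N + (n - N)" by simp
        have "W n ?Y x \<le> 1/2 * W (n - N) ?Y x"
          by (subst n) (rule W_submultiplicative[OF Y stay small])
        also have "\<dots> \<le> \<theta> ^ N * (M * \<theta> ^ (n - N))"
          unfolding \<theta>(3) using less[of "n - N"] False N(2) by simp
        also have "\<dots> = M * \<theta> ^ n" by (subst (2) n) (simp add: power_add)
        finally show ?thesis .
      qed
    qed
    moreover have "W n (Z v) x \<le> W n ?Y x" for n using v by (intro W_mono[OF Y]) blast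
    ultimately show "\<exists>M. \<forall>n. W n (Z v) x \<le> M * \<theta> ^ n" by (meson order_trans)
  qed
  then have "pressure G (\<lambda>x. - \<phi> x) \<le> ereal (ln \<theta>)" unfolding pressure_def by (rule SUP_least)
  also have "\<dots> < 0" using \<theta> by simp
  finally show False using p by simp
qed

subsection \<open>Uniqueness of weights\<close>

text \<open>On cylinders starting in \<open>NW G\<close> the Gibbs property compares the two
  weights, with a constant from the finitely many vertex masses. Pulling back along an edge
  multiplies both weights by the same exp(-\<phi>), and refinement makes this exact, so the same
  \<delta> survives at all, possibly infinitely many, vertices.\<close>

lemma weight_domination:
  assumes D: "weight D" and nz: "A0 \<in> K" "D A0 \<noteq> 0" and h: "weight h"
    and fin: "finite (NW G)" and ne: "NW G \<noteq> {}" and C: "bowen_bound C"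
  shows "\<exists>\<delta>>0. \<forall>A\<in>K. \<delta> * h A \<le> D A"
proof -
  \<comment> \<open>\<open>h\<close> may be the zero weight; adding 1 keeps the quotient
    positive.\<close>
  define d where "d = Min ((\<lambda>u. D (Z u) / (1 + h (Z u))) ` NW G)"
  have pos: "0 < D (Z u) / (1 + h (Z u))" if "u \<in> NW G" for u
    using weight_Z_pos[OF D nz] NW_verts weight_nonneg[OF h, of "Z u"] that
    by (intro divide_pos_pos) auto
  have d: "d > 0" unfolding d_def using fin ne pos by (subst Min_gr_iff) auto
  have dle: "d * h (Z u) \<le> D (Z u)" if u: "u \<in> NW G" for u
  proof -
    have "d \<le> D (Z u) / (1 + h (Z u))" unfolding d_def using fin u by (intro Min_le) auto
    then have "d * (1 + h (Z u)) \<le> D (Z u)"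
      using weight_nonneg[OF h, of "Z u"] by (simp add: pos_le_divide_eq)
    then show ?thesis using d by (simp add: algebra_simps)
  qed
  \<comment> \<open>One factor exp(-C) for passing from a cylinder to a vertex mass of
    \<open>h\<close>, another for returning to the cylinder mass of \<open>D\<close>.\<close>
  define \<delta> where "\<delta> = exp (- 2 * C) * d"
  have \<delta>: "\<delta> > 0" using d by (simp add: \<delta>_def)
  have cyl: "\<delta> * h (cyl n y) \<le> D (cyl n y)"
    if y: "y \<in> X" "tail G (y 0) \<in> NW G" and n: "n > 0" for n y
  proof -
    let ?b = "birkhoff \<phi> n y"
    let ?u = "tail G (y n)"
    have "d * (exp (?b - C) * h (cyl n y)) \<le> d * h (Z ?u)"
      using weight_bowen_cyl(1)[OF h C y n] d by (intro mult_left_mono) auto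
    also have "\<dots> \<le> D (Z ?u)" by (rule dle[OF NW_path[OF y]])
    also have "\<dots> \<le> exp (?b + C) * D (cyl n y)" by (rule weight_bowen_cyl(2)[OF D C y n])
    finally have "exp (- ?b - C) * (d * (exp (?b - C) * h (cyl n y))) \<le>
        exp (- ?b - C) * (exp (?b + C) * D (cyl n y))" by (intro mult_left_mono) auto
    moreover have "exp (- ?b - C) * (exp (?b + C) * D (cyl n y)) = D (cyl n y)"
      by (simp add: mult.assoc[symmetric] flip: exp_add)
    moreover have "exp (- ?b - C) * (d * (exp (?b - C) * h (cyl n y))) =
        (exp (- ?b - C) * exp (?b - C)) * d * h (cyl n y)" by (simp add: algebra_simps)
    moreover have "exp (- ?b - C) * exp (?b - C) = exp (- 2 * C)" unfolding exp_add[symmetric] by simp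
    ultimately show ?thesis by (simp add: \<delta>_def)
  qed
  let ?S = "{v. \<forall>A\<in>K. A \<subseteq> Z v \<longrightarrow> \<delta> * h A \<le> D A}"
  obtain v0 where v0: "v0 \<in> NW G" using ne by blast
  have all: "verts G \<subseteq> ?S"
  proof (rule cofinal_induct[of v0 "NW G"])
    show "v0 \<in> verts G" "v0 \<in> NW G" using v0 NW_verts by auto
    show "head G e \<in> NW G" if "e \<in> arcs G" "tail G e \<in> NW G" for e using NW_hereditary that .
    show "NW G \<subseteq> ?S"
    proof (intro subsetI CollectI ballI impI)
      fix v A assume v: "v \<in> NW G" and A: "A \<in> K" "A \<subseteq> Z v"
      obtain n where n: "\<forall>x\<in>A. cyl n x \<subseteq> A" using K_determined[OF A(1)] by blast
      have "\<delta> * h B \<le> D B" if B: "B \<in> pieces (Suc n) A" for B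
      proof -
        obtain x where x: "x \<in> A" "B = A \<inter> cyl (Suc n) x" using B by (auto simp: pieces_def)
        have "cyl (Suc n) x \<subseteq> A" using n x(1) cyl_mono[of n "Suc n" x] by auto
        then have "B = cyl (Suc n) x" using x(2) by blast
        moreover have "x \<in> X" "tail G (x 0) \<in> NW G" using x(1) A(2) v by (auto simp: Z_def)
        ultimately show ?thesis using cyl by simp
      qed
      then have "(\<Sum>B\<in>pieces (Suc n) A. \<delta> * h B) \<le> (\<Sum>B\<in>pieces (Suc n) A. D B)" by (rule sum_mono)
      then show "\<delta> * h A \<le> D A"
        using additive_on_pieces[OF weight_additive_on[OF h A(1)] A(1), of "Suc n"]
          additive_on_pieces[OF weight_additive_on[OF D A(1)] A(1), of "Suc n"]
        by (simp add: sum_distrib_left)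
    qed
    show "v \<in> ?S" if v: "v \<in> verts G" "\<And>e. e \<in> out_arcs G v \<Longrightarrow> head G e \<in> ?S" for v
    proof (intro CollectI ballI impI)
      fix A assume A: "A \<in> K" "A \<subseteq> Z v"
      have edge: "\<delta> * h (A \<inter> E e) \<le> D (A \<inter> E e)" if e: "e \<in> out_arcs G v" for e
      proof -
        let ?B = "A \<inter> E e"
        have ea: "e \<in> arcs G" using e by simp
        have BK: "?B \<in> K" using A by blast
        have addh: "additive_on ?B (\<lambda>B. \<delta> * h B)"
          by (intro additive_on_mult weight_additive_on[OF h BK])
        have addD: "additive_on ?B D" by (rule weight_additive_on[OF D BK])
        show ?thesis
        proof (rule refine_le[OF BK addh addD addD])
          fix \<eta> B assume \<eta>: "\<eta> > 0" and B: "B \<in> K" "B \<subseteq> ?B" "B \<noteq> {}"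
            and o: "\<And>x y. x \<in> B \<Longrightarrow> y \<in> B \<Longrightarrow> \<bar>\<phi> x - \<phi> y\<bar> \<le> \<eta>"
          obtain x0 where x0: "x0 \<in> B" using B(3) by blast
          define c where "c = \<phi> x0"
          have phiB: "c - \<eta> \<le> \<phi> x" "\<phi> x \<le> c + \<eta>" if "x \<in> B" for x
            using o[OF that x0] by (auto simp: c_def)
          have inj: "inj_on \<sigma> B" by (rule inj_on_subset[OF inj_on_shift_E]) (use B(2) in blast)
          have "\<sigma> ` B \<subseteq> Z (head G e)" using shift_E[OF ea] B(2) by blast
          then have "\<delta> * h (\<sigma> ` B) \<le> D (\<sigma> ` B)" using v(2)[OF e] shift_K[OF B(1)] by blast
          moreover have "\<delta> * (exp (c - \<eta>) * h B) \<le> \<delta> * h (\<sigma> ` B)"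
            using weight_shift(1)[OF h B(1) inj phiB] \<delta> by (intro mult_left_mono) auto
          moreover have "D (\<sigma> ` B) \<le> exp (c + \<eta>) * D B"
            using weight_shift(2)[OF D B(1) inj phiB] by simp
          ultimately have "\<delta> * (exp (c - \<eta>) * h B) \<le> exp (c + \<eta>) * D B" by linarith
          then have "exp (\<eta> - c) * (\<delta> * (exp (c - \<eta>) * h B)) \<le> exp (\<eta> - c) * (exp (c + \<eta>) * D B)"
            by (intro mult_left_mono) auto
          moreover have "exp (\<eta> - c) * (\<delta> * (exp (c - \<eta>) * h B)) = (exp (\<eta> - c) * exp (c - \<eta>)) * (\<delta> * h B)"
            by (simp add: algebra_simps)
          moreover have "exp (\<eta> - c) * exp (c - \<eta>) = 1" unfolding exp_add[symmetric] by simp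
          moreover have "exp (\<eta> - c) * (exp (c + \<eta>) * D B) = exp (2 * \<eta>) * D B"
            unfolding mult.assoc[symmetric] exp_add[symmetric] by simp
          ultimately have "\<delta> * h B \<le> exp (2 * \<eta>) * D B" by simp
          then show "\<delta> * h B \<le> D B + (exp (2 * \<eta>) - 1) * D B" by (simp add: algebra_simps)
        qed
      qed
      have un: "A = (\<Union>e\<in>out_arcs G v. A \<inter> E e)" using A(2) Z_Union_E by blast
      have dis: "disjoint_family_on (\<lambda>e. A \<inter> E e) (out_arcs G v)"
        by (auto simp: disjoint_family_on_def E_def)
      have AE: "A \<inter> E e \<in> K" for e using A by blast
      have "h A = (\<Sum>e\<in>out_arcs G v. h (A \<inter> E e))" "D A = (\<Sum>e\<in>out_arcs G v. D (A \<inter> E e))"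
        using weight_UN[OF h finite_out[OF v(1)] dis AE] weight_UN[OF D finite_out[OF v(1)] dis AE] un by simp_all
      moreover have "(\<Sum>e\<in>out_arcs G v. \<delta> * h (A \<inter> E e)) \<le> (\<Sum>e\<in>out_arcs G v. D (A \<inter> E e))"
        using edge by (rule sum_mono)
      ultimately show "\<delta> * h A \<le> D A" by (simp add: sum_distrib_left)
    qed
  qed
  have "\<delta> * h A \<le> D A" if A: "A \<in> K" for A
  proof -
    let ?F = "(\<lambda>x. tail G (x 0)) ` A"
    have un: "A = (\<Union>v\<in>?F. A \<inter> Z v)" using K_subset[OF A] by (auto simp: Z_def)
    have dis: "disjoint_family_on (\<lambda>v. A \<inter> Z v) ?F" by (auto simp: disjoint_family_on_def Z_def)
    have AZ: "A \<inter> Z v \<in> K" for v using A by blast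
    have "\<delta> * h (A \<inter> Z v) \<le> D (A \<inter> Z v)" if "v \<in> ?F" for v
      using all K_verts[OF A] that AZ by blast
    then have "(\<Sum>v\<in>?F. \<delta> * h (A \<inter> Z v)) \<le> (\<Sum>v\<in>?F. D (A \<inter> Z v))" by (rule sum_mono)
    moreover have "h A = (\<Sum>v\<in>?F. h (A \<inter> Z v))" "D A = (\<Sum>v\<in>?F. D (A \<inter> Z v))"
      using weight_UN[OF h K_finite[OF A] dis AZ] weight_UN[OF D K_finite[OF A] dis AZ] un by simp_all
    ultimately show ?thesis by (simp add: sum_distrib_left)
  qed
  then show ?thesis using \<delta> by blast
qed

theorem weight_unique:
  assumes h: "weight h" "A \<in> K" "h A \<noteq> 0" and h': "weight h'" "A' \<in> K" "h' A' \<noteq> 0"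
    and fin: "finite (NW G)" and ne: "NW G \<noteq> {}" and C: "bowen_bound C"
  shows "\<exists>t>0. \<forall>B\<in>K. h B = t * h' B"
proof -
  obtain v where v: "v \<in> verts G" using verts_nonempty by blast
  have pos: "h (Z v) > 0" "h' (Z v) > 0" using weight_Z_pos h h' v by blast+
  let ?I = "{t. t \<ge> 0 \<and> (\<forall>B\<in>K. t * h' B \<le> h B)}"
  have zero: "0 \<in> ?I" using weight_nonneg[OF h(1)] by simp
  have upper: "t \<le> h (Z v) / h' (Z v)" if "t \<in> ?I" for t
    using that pos(2) by (simp add: pos_le_divide_eq)
  then have bdd: "bdd_above ?I" by (rule bdd_aboveI)
  define t where "t = Sup ?I"
  have t0: "t \<ge> 0" unfolding t_def using zero bdd by (rule cSup_upper)
  have tle: "t * h' B \<le> h B" if B: "B \<in> K" for B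
  proof (cases "h' B = 0")
    case True then show ?thesis using weight_nonneg[OF h(1) B] by simp
  next
    case False
    then have p: "h' B > 0" using weight_nonneg[OF h'(1) B] by simp
    have "t \<le> h B / h' B"
      unfolding t_def
    proof (rule cSup_least)
      show "?I \<noteq> {}" using zero by blast
      show "s \<le> h B / h' B" if "s \<in> ?I" for s using that B p by (simp add: pos_le_divide_eq)
    qed
    then show ?thesis using p by (simp add: pos_le_divide_eq)
  qed
  have D: "weight (\<lambda>B. h B - t * h' B)" by (rule weight_diff[OF h(1) h'(1) t0 tle])
  have eq: "h B = t * h' B" if B: "B \<in> K" for B
  proof (rule ccontr)
    assume "h B \<noteq> t * h' B"
    then have "h B - t * h' B \<noteq> 0" by simp
    \<comment> \<open>A non-zero difference would dominate some positive multiple of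
      \<open>h'\<close>, so that \<open>t\<close> could be increased.\<close>
    from weight_domination[OF D B this h'(1) fin ne C]
    obtain \<delta> where \<delta>: "\<delta> > 0" "\<forall>A\<in>K. \<delta> * h' A \<le> h A - t * h' A" by blast
    then have "t + \<delta> \<in> ?I" using t0 by (auto simp: algebra_simps)
    then have "t + \<delta> \<le> t" unfolding t_def using bdd by (rule cSup_upper)
    then show False using \<delta>(1) by simp
  qed
  moreover have "t > 0" using eq[of "Z v"] pos t0 by (cases "t = 0") auto
  ultimately show ?thesis by blast
qed

end

theorem theorem4p6:
  fixes G :: "('a, 'b) pre_digraph"
    and \<phi> :: "(nat \<Rightarrow> 'b) \<Rightarrow> real"
  assumes "wf_digraph G"
    and "verts G \<noteq> {}"
    and "countable (verts G)"
    and "countable (arcs G)"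
    and "cofinal_graph G"
    and "(\<lambda>k. var G \<phi> k) \<longlonglongrightarrow> 0"
  shows "(NW G = {} \<longrightarrow> (\<exists>m. conformal_measure G \<phi> m)) \<and>
         (NW G \<noteq> {} \<and> finite (NW G) \<and> bowen_condition (NW_graph G) \<phi> \<longrightarrow>
            ((\<exists>m. conformal_measure G \<phi> m) \<longleftrightarrow> pressure G (\<lambda>x. - \<phi> x) = 0) \<and>
            (\<forall>m m'. conformal_measure G \<phi> m \<and> conformal_measure G \<phi> m' \<longrightarrow>
               (\<exists>c::real. c > 0 \<and> m' = scale_measure (ennreal c) m))) \<and>
         (infinite (NW G) \<longrightarrow>
            ((\<exists>m. conformal_measure G \<phi> m) \<longleftrightarrow> pressure G (\<lambda>x. - \<phi> x) \<le> 0))"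
proof -
  interpret wf_digraph G by fact
  interpret cofinal_system G \<phi> by unfold_locales (use assms in simp_all)
  have existence: "\<exists>m. conformal_measure G \<phi> m" if hv: "\<exists>h v. weight h \<and> h (Z v) = 1"
  proof -
    obtain h v where "weight h" "h (Z v) = 1" using hv by blast
    then show ?thesis using weight_conformal_measure[of h "Z v"] by simp
  qed
  have nonpos: "pressure G (\<lambda>x. - \<phi> x) \<le> 0" if m: "conformal_measure G \<phi> m" for m
  proof -
    obtain A where "A \<in> K" "measure m A \<noteq> 0" using conformal_nonzero_K[OF m] by blast
    then show ?thesis
      unfolding pressure_def by (intro SUP_least weight_pressure_at_le[OF conformal_weight[OF m]])
  qed
  show ?thesis
  proof (intro conjI impI iffI allI)
    show "\<exists>m. conformal_measure G \<phi> m" if "NW G = {}"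
      using existence weight_exists_wandering[OF that] by blast
    show "pressure G (\<lambda>x. - \<phi> x) \<le> 0" if "infinite (NW G)" "\<exists>m. conformal_measure G \<phi> m"
      using nonpos that by blast
    show "\<exists>m. conformal_measure G \<phi> m" if "infinite (NW G)" "pressure G (\<lambda>x. - \<phi> x) \<le> 0"
      using existence weight_exists_infinite_NW[OF that] by blast
  next
    assume *: "NW G \<noteq> {} \<and> finite (NW G) \<and> bowen_condition (NW_graph G) \<phi>"
    then have ne: "NW G \<noteq> {}" and fin: "finite (NW G)" by auto
    obtain C where C: "bowen_bound C" using * bowen_condition_bound by blast
    show "pressure G (\<lambda>x. - \<phi> x) = 0" if ex: "\<exists>m. conformal_measure G \<phi> m"
    proof -
      obtain m where m: "conformal_measure G \<phi> m" using ex by blast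
      obtain A where "A \<in> K" "measure m A \<noteq> 0" using conformal_nonzero_K[OF m] by blast
      from weight_pressure_nonneg[OF conformal_weight[OF m] this fin ne C] nonpos[OF m]
      show ?thesis by simp
    qed
    show "\<exists>m. conformal_measure G \<phi> m" if p: "pressure G (\<lambda>x. - \<phi> x) = 0"
    proof -
      obtain v x where "v \<in> verts G" "x \<in> X" "\<not> summable (\<lambda>n. W n (Z v) x)"
        using recurrent_of_pressure_nonneg[OF fin ne C] p by auto
      then show ?thesis using existence weight_exists_recurrent[of x v] p by simp
    qed
    show "\<exists>c::real. c > 0 \<and> m' = scale_measure (ennreal c) m"
      if mm: "conformal_measure G \<phi> m \<and> conformal_measure G \<phi> m'" for m m'
    proof -
      have m: "conformal_measure G \<phi> m" and m': "conformal_measure G \<phi> m'" using mm by auto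
      obtain A where A: "A \<in> K" "measure m A \<noteq> 0" using conformal_nonzero_K[OF m] by blast
      obtain A' where A': "A' \<in> K" "measure m' A' \<noteq> 0" using conformal_nonzero_K[OF m'] by blast
      obtain c where "c > 0" "\<forall>B\<in>K. measure m' B = c * measure m B"
        using weight_unique[OF conformal_weight[OF m'] A' conformal_weight[OF m] A fin ne C] by blast
      then show ?thesis using proportional_measures[OF m m'] by blast
    qed
  qed
qed

end
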